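(* Let $M$ be a preprojective $k(\Gamma,\Lambda)$-module. (a) There exists a unique up to equivalence $\sim$ shortest sequence $S_M\in\mathfrak S$ annihilating $M$. If $M\cong M_1^{m_1}\oplus\dots\oplus M_t^{m_t}$ where the $M_i$'s are pairwise nonisomorphic indecomposable $k(\Gamma,\Lambda)$-modules and $m_i>0$ for all $i$, then each $M_i$ is preprojective and $S_M= S_{M_1}\vee\dots\vee S_{M_t}$ (up to $\sim$). (b) If $L$ is a preprojective $k(\Gamma,\Lambda)$-module, then $S_L\preccurlyeq S_M$ if and only if for each indecomposable direct summand $X$ of $L$ there exists an indecomposable direct summand $Y$ of $M$ satisfying $S_X\preccurlyeq S_Y$.
   Context: $k$ is an arbitrary field and $\Gamma=(\Gamma_0,\Gamma_1)$ is a finite connected graph (multiple edges allowed) without loops and with more than one vertex. An orientation $\Lambda$ on $\Gamma$ chooses for each edge a starting point and an endpoint among its incident vertices, giving a quiver $(\Gamma,\Lambda)$; all orientations are assumed to have no oriented cycles. $\Gamma_0$ is a poset $(\Gamma_0,\Lambda)$ with $x\le y$ iff there is a path (possibly of length $0$) from $x$ to $y$. A sink is a vertex at which no arrow starts; a source is a vertex at which no arrow ends. $\sigma_x\Lambda$ is the orientation obtained by reversing all arrows incident with $x$. A finite sequence $S=x_1,\dots,x_s$ of vertices ($s\ge 0$) is (+)-admissible on $(\Gamma,\Lambda)$ if $x_1$ is a sink for $\Lambda$, $x_2$ is a sink for $\sigma_{x_1}\Lambda$, and so on; put $\Lambda^S=\sigma_{x_s}\cdots\sigma_{x_1}\Lambda$.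 $\mathfrak S$ is the set of (+)-admissible sequences on $(\Gamma,\Lambda)$. $\sim$ is the equivalence relation on $\mathfrak S$ generated by interchanging two consecutive terms $x_i,x_{i+1}$ that are not connected by an edge of $\Gamma$. For $S,T\in\mathfrak S$, $S\preccurlyeq T$ ($S$ is a subsequence of $T$) means $T\sim SU$ (concatenation) for some (+)-admissible sequence $U$ on $(\Gamma,\Lambda^S)$; one has $S\preccurlyeq T$ and $T\preccurlyeq S$ iff $S\sim T$. $\mathrm{Supp}\,S$ is the set of vertices occurring in $S$. Canonical form: every nonempty $S\in\mathfrak S$ satisfies $S\sim S_1\cdots S_r$ where each segment $S_i$ is nonempty, consists of distinct vertices, and $\mathrm{Supp}\,S_i=\mathrm{Supp}\,S_iS_{i+1}\cdots S_r$; $r$ and the segments up to equivalence are determined by $S$. Join: if $S,T$ are nonempty with canonical forms $S_1\cdots S_r$, $T_1\cdots T_q$, $r\le q$, then $S\vee T$ is the (unique up to $\sim$) sequence in $\mathfrak S$ with canonical form $R_1\cdots R_q$, where $\mathrm{Supp}\,R_i=\mathrm{Supp}\,S_i\cup\mathrm{Supp}\,T_i$ for $i\le r$ and $\mathrm{Supp}\,R_i=\mathrm{Supp}\,T_i$ for $r<i\le q$; also $S\vee\emptyset=S$ for the empty sequence $\emptyset$. $k(\Gamma,\Lambda)$-modules are finite-dimensional left modules over the path algebra, identified with finite-dimensional representations $(V,f)$ of $(\Gamma,\Lambda)$ over $k$. For a sink $x$ of $(\Gamma,\Lambda)$, the positive reflection functor $F_x^+$ from $k(\Gamma,\Lambda)$-modules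 to $k(\Gamma,\sigma_x\Lambda)$-modules sends $(V,f)$ to $(W,g)$ with $W(z)=V(z)$ for $z\ne x$ and $W(x)=\ker\big(h:\bigoplus_i V(y_i)\to V(x)\big)$, where $a_i:y_i\to x$ are all the arrows ending at $x$ and $h$ is induced by the $f_{a_i}$; $g$ agrees with $f$ on arrows not incident with $x$, and for the reversed arrows $x\to y_i$ the maps $W(x)\to V(y_i)$ are induced by the inclusion $W(x)\subset\bigoplus_i V(y_i)$; on morphisms $F_x^+$ is defined naturally. For $S=x_1,\dots,x_s$ in $\mathfrak S$, $F(S)=F^+_{x_s}\cdots F^+_{x_1}$ (the identity if $S=\emptyset$); $S$ annihilates $M$ if $F(S)M=0$. $M$ is preprojective if some $S\in\mathfrak S$ annihilates it. A shortest sequence annihilating $M$ is an $S\in\mathfrak S$ that annihilates $M$ while no proper subsequence of $S$ (no $S'\preccurlyeq S$ with $S'\not\sim S$) annihilates $M$. *)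

theory Defs
  imports Complex_Main "HOL-Library.Function_Algebras"
begin

section \<open>Graphs, orientations and admissible sequences\<close>

text \<open>
  A finite graph with multiple edges has vertex type \<open>'v\<close> and edge type \<open>'e\<close>; the map \<open>\<Gamma>\<close> sends an
  edge to its set of incident vertices. Requiring this set to have two elements excludes loops.
\<close>

definition connected_graph :: "('e \<Rightarrow> 'v set) \<Rightarrow> bool" where
  "connected_graph \<Gamma> \<longleftrightarrow>
     (\<forall>e. card (\<Gamma> e) = 2) \<and>
     (\<forall>x y. (x, y) \<in> {(a, b). \<exists>e. \<Gamma> e = {a, b}}\<^sup>*) \<and>
     card (UNIV :: 'v set) > 1"

text \<open>An orientation sends an edge to the pair (starting point, endpoint).\<close>

type_synonym ('v, 'e) orientation = "'e \<Rightarrow> 'v \<times> 'v"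

abbreviation src :: "('v, 'e) orientation \<Rightarrow> 'e \<Rightarrow> 'v" where
  "src \<Lambda> e \<equiv> fst (\<Lambda> e)"

abbreviation tgt :: "('v, 'e) orientation \<Rightarrow> 'e \<Rightarrow> 'v" where
  "tgt \<Lambda> e \<equiv> snd (\<Lambda> e)"

definition acyclic_orientation :: "('e \<Rightarrow> 'v set) \<Rightarrow> ('v, 'e) orientation \<Rightarrow> bool" where
  "acyclic_orientation \<Gamma> \<Lambda> \<longleftrightarrow> (\<forall>e. \<Gamma> e = {src \<Lambda> e, tgt \<Lambda> e}) \<and> acyclic (range \<Lambda>)"

definition sink :: "('v, 'e) orientation \<Rightarrow> 'v \<Rightarrow> bool" where
  "sink \<Lambda> x \<longleftrightarrow> (\<forall>e. src \<Lambda> e \<noteq> x)"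

definition reorient :: "'v \<Rightarrow> ('v, 'e) orientation \<Rightarrow> ('v, 'e) orientation" where
  "reorient x \<Lambda> =
     (\<lambda>e. if src \<Lambda> e = x \<or> tgt \<Lambda> e = x then (tgt \<Lambda> e, src \<Lambda> e) else \<Lambda> e)"

definition reorient_seq :: "'v list \<Rightarrow> ('v, 'e) orientation \<Rightarrow> ('v, 'e) orientation" where
  "reorient_seq S \<Lambda> = fold reorient S \<Lambda>"

fun admissible :: "('v, 'e) orientation \<Rightarrow> 'v list \<Rightarrow> bool" where
  "admissible \<Lambda> [] \<longleftrightarrow> True"
| "admissible \<Lambda> (x # S) \<longleftrightarrow> sink \<Lambda> x \<and> admissible (reorient x \<Lambda>) S"

definition interchange ::
    "('e \<Rightarrow> 'v set) \<Rightarrow> ('v, 'e) orientation \<Rightarrow> 'v list \<Rightarrow> 'v list \<Rightarrow> bool" where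
  "interchange \<Gamma> \<Lambda> S T \<longleftrightarrow> admissible \<Lambda> S \<and> admissible \<Lambda> T \<and>
     (\<exists>A x y B. S = A @ [x, y] @ B \<and> T = A @ [y, x] @ B \<and> \<not> (\<exists>e. \<Gamma> e = {x, y}))"

definition seq_equiv ::
    "('e \<Rightarrow> 'v set) \<Rightarrow> ('v, 'e) orientation \<Rightarrow> 'v list \<Rightarrow> 'v list \<Rightarrow> bool" where
  "seq_equiv \<Gamma> \<Lambda> S T \<longleftrightarrow>
     admissible \<Lambda> S \<and> admissible \<Lambda> T \<and> equivclp (interchange \<Gamma> \<Lambda>) S T"

definition seq_le ::
    "('e \<Rightarrow> 'v set) \<Rightarrow> ('v, 'e) orientation \<Rightarrow> 'v list \<Rightarrow> 'v list \<Rightarrow> bool" where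
  "seq_le \<Gamma> \<Lambda> S T \<longleftrightarrow> admissible \<Lambda> S \<and> admissible \<Lambda> T \<and>
     (\<exists>U. admissible (reorient_seq S \<Lambda>) U \<and> seq_equiv \<Gamma> \<Lambda> T (S @ U))"

definition canonical_form ::
    "('e \<Rightarrow> 'v set) \<Rightarrow> ('v, 'e) orientation \<Rightarrow> 'v list \<Rightarrow> 'v list list \<Rightarrow> bool" where
  "canonical_form \<Gamma> \<Lambda> S Ss \<longleftrightarrow> seq_equiv \<Gamma> \<Lambda> S (concat Ss) \<and>
     (\<forall>i < length Ss. Ss ! i \<noteq> [] \<and> distinct (Ss ! i) \<and>
        set (Ss ! i) = set (concat (drop i Ss)))"

text \<open>Support of the segment with index \<open>i\<close> (from 0), empty beyond the last segment.\<close>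

definition seg_supp :: "'v list list \<Rightarrow> nat \<Rightarrow> 'v set" where
  "seg_supp Ss i = (if i < length Ss then set (Ss ! i) else {})"

text \<open>
  The join is determined only up to equivalence, so a representative is chosen.
\<close>

definition seq_join ::
    "('e \<Rightarrow> 'v set) \<Rightarrow> ('v, 'e) orientation \<Rightarrow> 'v list \<Rightarrow> 'v list \<Rightarrow> 'v list" where
  "seq_join \<Gamma> \<Lambda> S T =
     (if T = [] then S else if S = [] then T else
      (SOME R. admissible \<Lambda> R \<and>
         (\<exists>Ss Ts Rs. canonical_form \<Gamma> \<Lambda> S Ss \<and> canonical_form \<Gamma> \<Lambda> T Ts \<and>
            canonical_form \<Gamma> \<Lambda> R Rs \<and> length Rs = max (length Ss) (length Ts) \<and>
            (\<forall>i < length Rs. set (Rs ! i) = seg_supp Ss i \<union> seg_supp Ts i))))"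


section \<open>Representations\<close>

text \<open>
  The vector spaces of a representation are subspaces of an ambient vector space, given by a type
  \<open>'w\<close> with scalar multiplication \<open>s\<close>. Only the restriction of \<open>arr M e\<close> to the space at the
  starting point of \<open>e\<close> is meaningful.
\<close>

record ('v, 'e, 'w) rep =
  spc :: "'v \<Rightarrow> 'w set"
  arr :: "'e \<Rightarrow> 'w \<Rightarrow> 'w"

definition linear_between ::
    "('k \<Rightarrow> 'w::ab_group_add \<Rightarrow> 'w) \<Rightarrow> ('k \<Rightarrow> 'z::ab_group_add \<Rightarrow> 'z) \<Rightarrow>
     'w set \<Rightarrow> 'z set \<Rightarrow> ('w \<Rightarrow> 'z) \<Rightarrow> bool" where
  "linear_between s s' V W f \<longleftrightarrow> f ` V \<subseteq> W \<and>
     (\<forall>u\<in>V. \<forall>v\<in>V. f (u + v) = f u + f v) \<and> (\<forall>c. \<forall>v\<in>V. f (s c v) = s' c (f v))"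

definition is_rep ::
    "('k::field \<Rightarrow> 'w::ab_group_add \<Rightarrow> 'w) \<Rightarrow> ('v, 'e) orientation \<Rightarrow> ('v, 'e, 'w) rep \<Rightarrow> bool" where
  "is_rep s \<Lambda> M \<longleftrightarrow>
     (\<forall>x. module.subspace s (spc M x) \<and> (\<exists>B. finite B \<and> module.span s B = spc M x)) \<and>
     (\<forall>e. linear_between s s (spc M (src \<Lambda> e)) (spc M (tgt \<Lambda> e)) (arr M e))"

definition zero_rep :: "('v, 'e, 'w::zero) rep \<Rightarrow> bool" where
  "zero_rep M \<longleftrightarrow> (\<forall>x. spc M x = {0})"

definition rep_iso ::
    "('k \<Rightarrow> 'w::ab_group_add \<Rightarrow> 'w) \<Rightarrow> ('k \<Rightarrow> 'z::ab_group_add \<Rightarrow> 'z) \<Rightarrow> ('v, 'e) orientation \<Rightarrow>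
     ('v, 'e, 'w) rep \<Rightarrow> ('v, 'e, 'z) rep \<Rightarrow> bool" where
  "rep_iso s s' \<Lambda> M N \<longleftrightarrow> (\<exists>\<phi>.
     (\<forall>x. linear_between s s' (spc M x) (spc N x) (\<phi> x) \<and> bij_betw (\<phi> x) (spc M x) (spc N x)) \<and>
     (\<forall>e. \<forall>v \<in> spc M (src \<Lambda> e). \<phi> (tgt \<Lambda> e) (arr M e v) = arr N e (\<phi> (src \<Lambda> e) v)))"

definition pointwise :: "('k \<Rightarrow> 'w \<Rightarrow> 'w) \<Rightarrow> 'k \<Rightarrow> ('i \<Rightarrow> 'w) \<Rightarrow> 'i \<Rightarrow> 'w" where
  "pointwise s c v = (\<lambda>i. s c (v i))"

text \<open>
  The direct sum of a family indexed by a finite set \<open>I\<close>; its ambient space is \<open>'i \<Rightarrow> 'w\<close> with scalar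
  multiplication \<open>pointwise s\<close>.
\<close>

definition rep_sum ::
    "'i set \<Rightarrow> ('i \<Rightarrow> ('v, 'e, 'w::zero) rep) \<Rightarrow> ('v, 'e, 'i \<Rightarrow> 'w) rep" where
  "rep_sum I M =
     \<lparr> spc = (\<lambda>x. {v. (\<forall>i\<in>I. v i \<in> spc (M i) x) \<and> (\<forall>i. i \<notin> I \<longrightarrow> v i = 0)}),
       arr = (\<lambda>e v i. if i \<in> I then arr (M i) e (v i) else 0) \<rparr>"

definition rep_plus ::
    "('v, 'e, 'w::zero) rep \<Rightarrow> ('v, 'e, 'w) rep \<Rightarrow> ('v, 'e, bool \<Rightarrow> 'w) rep" where
  "rep_plus M N = rep_sum UNIV (\<lambda>b. if b then M else N)"

definition indecomposable ::
    "('k::field \<Rightarrow> 'w::ab_group_add \<Rightarrow> 'w) \<Rightarrow> ('v, 'e) orientation \<Rightarrow> ('v, 'e, 'w) rep \<Rightarrow> bool" where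
  "indecomposable s \<Lambda> M \<longleftrightarrow> is_rep s \<Lambda> M \<and> \<not> zero_rep M \<and>
     (\<forall>N N'. is_rep s \<Lambda> N \<and> is_rep s \<Lambda> N' \<and> rep_iso s (pointwise s) \<Lambda> M (rep_plus N N') \<longrightarrow>
        zero_rep N \<or> zero_rep N')"

definition direct_summand ::
    "('k::field \<Rightarrow> 'w::ab_group_add \<Rightarrow> 'w) \<Rightarrow> ('v, 'e) orientation \<Rightarrow>
     ('v, 'e, 'w) rep \<Rightarrow> ('v, 'e, 'w) rep \<Rightarrow> bool" where
  "direct_summand s \<Lambda> X M \<longleftrightarrow> is_rep s \<Lambda> X \<and>
     (\<exists>N. is_rep s \<Lambda> N \<and> rep_iso s (pointwise s) \<Lambda> M (rep_plus X N))"


section \<open>Reflection functors\<close>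

text \<open>
  To be iterated, a reflection functor must keep the ambient space. We take functions
  \<open>'e list \<Rightarrow> 'u\<close>, where \<open>'u\<close> is an arbitrary vector space. A vector \<open>w\<close> of this type that vanishes
  at \<open>[]\<close> is an \<open>'e\<close>-indexed family of vectors of the same type, with component
  \<open>\<lambda>p. w (e # p)\<close> at \<open>e\<close>; so direct sums over sets of edges again live in this type.
  Every representation in \<open>'u\<close> occurs here up to isomorphism, as the lemma on \<open>concentrate\<close>
  below shows.
\<close>

definition component :: "'e \<Rightarrow> ('e list \<Rightarrow> 'u) \<Rightarrow> 'e list \<Rightarrow> 'u" where
  "component e w = (\<lambda>p. w (e # p))"

definition reflect ::
    "('v, 'e::finite) orientation \<Rightarrow> 'v \<Rightarrow> ('v, 'e, 'e list \<Rightarrow> 'u::ab_group_add) rep \<Rightarrow>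
     ('v, 'e, 'e list \<Rightarrow> 'u) rep" where
  "reflect \<Lambda> x M =
     \<lparr> spc = (\<lambda>z. if z = x
          then {w. w [] = 0 \<and>
                   (\<forall>e. tgt \<Lambda> e = x \<longrightarrow> component e w \<in> spc M (src \<Lambda> e)) \<and>
                   (\<forall>e. tgt \<Lambda> e \<noteq> x \<longrightarrow> component e w = 0) \<and>
                   (\<Sum>e | tgt \<Lambda> e = x. arr M e (component e w)) = 0}
          else spc M z),
       arr = (\<lambda>e. if tgt \<Lambda> e = x then component e else arr M e) \<rparr>"

fun reflect_seq ::
    "('v, 'e::finite) orientation \<Rightarrow> 'v list \<Rightarrow> ('v, 'e, 'e list \<Rightarrow> 'u::ab_group_add) rep \<Rightarrow>
     ('v, 'e, 'e list \<Rightarrow> 'u) rep" where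
  "reflect_seq \<Lambda> [] M = M"
| "reflect_seq \<Lambda> (x # S) M = reflect_seq (reorient x \<Lambda>) S (reflect \<Lambda> x M)"

definition annihilates ::
    "('v, 'e::finite) orientation \<Rightarrow> 'v list \<Rightarrow> ('v, 'e, 'e list \<Rightarrow> 'u::ab_group_add) rep \<Rightarrow>
     bool" where
  "annihilates \<Lambda> S M \<longleftrightarrow> zero_rep (reflect_seq \<Lambda> S M)"

definition preprojective ::
    "('v, 'e::finite) orientation \<Rightarrow> ('v, 'e, 'e list \<Rightarrow> 'u::ab_group_add) rep \<Rightarrow> bool" where
  "preprojective \<Lambda> M \<longleftrightarrow> (\<exists>S. admissible \<Lambda> S \<and> annihilates \<Lambda> S M)"

definition shortest_annihilating ::
    "('e::finite \<Rightarrow> 'v set) \<Rightarrow> ('v, 'e) orientation \<Rightarrow>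
     ('v, 'e, 'e list \<Rightarrow> 'u::ab_group_add) rep \<Rightarrow> 'v list \<Rightarrow> bool" where
  "shortest_annihilating \<Gamma> \<Lambda> M S \<longleftrightarrow> admissible \<Lambda> S \<and> annihilates \<Lambda> S M \<and>
     (\<forall>S'. seq_le \<Gamma> \<Lambda> S' S \<and> \<not> seq_equiv \<Gamma> \<Lambda> S' S \<longrightarrow> \<not> annihilates \<Lambda> S' M)"

definition shortest_seq ::
    "('e::finite \<Rightarrow> 'v set) \<Rightarrow> ('v, 'e) orientation \<Rightarrow>
     ('v, 'e, 'e list \<Rightarrow> 'u::ab_group_add) rep \<Rightarrow> 'v list" where
  "shortest_seq \<Gamma> \<Lambda> M = (SOME S. shortest_annihilating \<Gamma> \<Lambda> M S)"

definition concentrate :: "('v, 'e, 'u::zero) rep \<Rightarrow> ('v, 'e, 'e list \<Rightarrow> 'u) rep" where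
  "concentrate M =
     \<lparr> spc = (\<lambda>x. {w. w [] \<in> spc M x \<and> (\<forall>p. p \<noteq> [] \<longrightarrow> w p = 0)}),
       arr = (\<lambda>e w p. if p = [] then arr M e (w []) else 0) \<rparr>"

lemma vector_space_pointwise:
  assumes "vector_space s"
  shows "vector_space (pointwise s)"
proof -
  interpret vector_space s by fact
  show ?thesis
    by unfold_locales
      (auto simp: pointwise_def fun_eq_iff scale_right_distrib scale_left_distrib)
qed

lemma concentrate:
  fixes s :: "'k::field \<Rightarrow> 'u::ab_group_add \<Rightarrow> 'u" and \<Lambda> :: "('v, 'e) orientation"
  assumes s: "vector_space s" and M: "is_rep s \<Lambda> M"
  shows "is_rep (pointwise s) \<Lambda> (concentrate M)"
    and "rep_iso s (pointwise s) \<Lambda> M (concentrate M)"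
proof -
  interpret A: vector_space s by fact
  interpret B: vector_space "pointwise s" using s by (rule vector_space_pointwise)
  define j :: "'u \<Rightarrow> 'e list \<Rightarrow> 'u" where "j u = (\<lambda>p. if p = [] then u else 0)" for u
  interpret j: module_hom s "pointwise s" j
    by unfold_locales (auto simp: j_def pointwise_def fun_eq_iff)
  have spc: "spc (concentrate M) x = j ` spc M x" for x
  proof -
    have "w = j (w [])" if "\<forall>p. p \<noteq> [] \<longrightarrow> w p = 0" for w
      using that by (auto simp: j_def)
    then show ?thesis by (auto simp: concentrate_def j_def image_iff)
  qed
  have arr: "arr (concentrate M) e (j u) = j (arr M e u)" for e u
    by (auto simp: concentrate_def j_def)
  have inj: "inj j"
  proof (rule injI)
    fix u v assume "j u = j v"
    then have "j u [] = j v []" by simp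
    then show "u = v" by (simp add: j_def)
  qed
  have lin: "linear_between s s (spc M (src \<Lambda> e)) (spc M (tgt \<Lambda> e)) (arr M e)" for e
    using M by (simp add: is_rep_def)
  show "is_rep (pointwise s) \<Lambda> (concentrate M)"
    unfolding is_rep_def
  proof (intro conjI allI)
    fix x
    from M have sub: "A.subspace (spc M x)" by (simp add: is_rep_def)
    show "B.subspace (spc (concentrate M) x)"
      unfolding spc using sub by (rule j.subspace_image)
    from M obtain B where B: "finite B" "A.span B = spc M x"
      unfolding is_rep_def by blast
    show "\<exists>B. finite B \<and> B.span B = spc (concentrate M) x"
      using B by (intro exI[of _ "j ` B"]) (simp add: spc j.span_image)
  next
    fix e
    show "linear_between (pointwise s) (pointwise s) (spc (concentrate M) (src \<Lambda> e))
            (spc (concentrate M) (tgt \<Lambda> e)) (arr (concentrate M) e)"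
      using lin[of e] unfolding linear_between_def spc
      by (auto simp: arr simp flip: j.add j.scale)
  qed
  show "rep_iso s (pointwise s) \<Lambda> M (concentrate M)"
    unfolding rep_iso_def
    by (rule exI[of _ "\<lambda>_. j"])
      (auto simp: linear_between_def spc arr j.add j.scale bij_betw_def inj_on_subset[OF inj])
qed

end

theory Submission
  imports Defs
begin

text \<open>
  The proof rests on two ideas: an admissible sequence is a numerical object, and a reflection
  changes a representation at one vertex only.

  After a vertex has been reflected, all its edges must be turned back before it is a sink again. So the
  occurrences of two adjacent vertices in an admissible sequence alternate, beginning with the endpoint
  of the arrow between them, and along every arrow the numbers of occurrences satisfy
  \<open>n (src) \<le> n (tgt) \<le> n (src) + 1\<close>; such a function \<open>n\<close> is called balanced.
  Conversely each balanced function counts the occurrences in an admissible sequence, and the sequence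
  is determined by it up to equivalence. Under this dictionary \<open>\<preceq>\<close> is the pointwise order,
  the segment with index \<open>i\<close> of the canonical form has support \<open>{x. n x > i}\<close>, and the join is the
  pointwise maximum (\<open>seq_equiv_iff_count\<close>, \<open>seq_le_iff_count\<close>, \<open>seq_join_count\<close>).

  Existence and uniqueness of the shortest sequence. Let \<open>S\<close> and \<open>T\<close> annihilate \<open>M\<close>, and let \<open>R\<close> have the
  pointwise minimum of their counts. Then \<open>S \<sim> R U\<close> and \<open>T \<sim> R V\<close>, where \<open>U\<close> and \<open>V\<close> have disjoint
  supports. The functor \<open>F(U)\<close> does not change \<open>F(R) M\<close> outside the support of \<open>U\<close>, so \<open>F(R) M\<close> vanishes
  there; it also vanishes outside the support of \<open>V\<close>, hence everywhere. Thus the sequences that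
  annihilate \<open>M\<close> are closed under meets and have a least element (\<open>annihilates_meet\<close>).

  Direct sums. Reflections preserve jointly injective families of morphisms, so a sequence annihilates
  a direct sum if and only if it annihilates all the summands. As the sequences that annihilate a
  representation are exactly those above its shortest one, the shortest sequence of a direct sum is
  the join of the shortest sequences of the summands (\<open>shortest_seq_rep_sum\<close>).

  Comparison of summands. If \<open>S \<or> T\<close> annihilates \<open>X\<close>, then \<open>X = A \<oplus> B\<close> where \<open>S\<close> annihilates \<open>A\<close> and \<open>T\<close>
  annihilates \<open>B\<close> (\<open>annihilated_by_join_splits\<close>). To see this, write the sequences as \<open>S \<sim> R U\<close> and
  \<open>T \<sim> R V\<close> once more. If \<open>R\<close> is empty, then \<open>X\<close> lives on two disjoint sets of vertices, each closed
  under successors, and splits accordingly; in general the splitting of \<open>F(R) X\<close> is carried back through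
  one reflection at a time. So an indecomposable \<open>X\<close> annihilated by \<open>S \<or> T\<close> is annihilated by \<open>S\<close> or by \<open>T\<close>.
  Applied along a decomposition of \<open>M\<close> into indecomposables this yields the second part of the theorem.
\<close>

section \<open>Admissible sequences as counting functions\<close>

definition balanced :: "('v, 'e) orientation \<Rightarrow> ('v \<Rightarrow> nat) \<Rightarrow> bool" where
  "balanced \<Lambda> n \<longleftrightarrow> (\<forall>e. n (src \<Lambda> e) \<le> n (tgt \<Lambda> e) \<and> n (tgt \<Lambda> e) \<le> Suc (n (src \<Lambda> e)))"

lemma acyclic_orientation_no_loop:
  assumes "acyclic_orientation \<Gamma> \<Lambda>"
  shows "src \<Lambda> e \<noteq> tgt \<Lambda> e"
proof
  assume "src \<Lambda> e = tgt \<Lambda> e"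
  then have "(src \<Lambda> e, src \<Lambda> e) \<in> range \<Lambda>"
    by (metis prod.collapse rangeI)
  then have "(src \<Lambda> e, src \<Lambda> e) \<in> (range \<Lambda>)\<^sup>+" ..
  with assms show False
    by (simp add: acyclic_orientation_def acyclic_def)
qed

text \<open>
  After the reflection \<open>x\<close> is a source, so no cycle passes through \<open>x\<close>, and a cycle that avoids \<open>x\<close>
  consists of arrows that have not changed.
\<close>

lemma acyclic_orientation_reorient:
  assumes ac: "acyclic_orientation \<Gamma> \<Lambda>" and sink: "sink \<Lambda> x"
  shows "acyclic_orientation \<Gamma> (reorient x \<Lambda>)"
proof -
  note loop = acyclic_orientation_no_loop[OF ac]
  have edge: "c \<noteq> x \<and> (b \<noteq> x \<longrightarrow> (b, c) \<in> range \<Lambda>)" if bc: "(b, c) \<in> range (reorient x \<Lambda>)" for b c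
  proof -
    obtain e where e: "b = src (reorient x \<Lambda>) e" "c = tgt (reorient x \<Lambda>) e"
      using bc by (metis fst_conv imageE snd_conv)
    have "(src \<Lambda> e, tgt \<Lambda> e) \<in> range \<Lambda>"
      by (metis prod.collapse rangeI)
    moreover have "src \<Lambda> e \<noteq> x"
      using sink by (simp add: sink_def)
    ultimately show ?thesis
      using e loop[of e] by (auto simp: reorient_def)
  qed
  have path: "b \<noteq> x \<and> (a \<noteq> x \<longrightarrow> (a, b) \<in> (range \<Lambda>)\<^sup>+)"
    if "(a, b) \<in> (range (reorient x \<Lambda>))\<^sup>+" for a b
    using that
  proof (induction rule: trancl_induct)
    case (base b)
    then show ?case using edge by blast
  next
    case (step b c)
    then show ?case using edge[of b c] by (meson trancl.simps)
  qed
  have "acyclic (range (reorient x \<Lambda>))"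
    unfolding acyclic_def using path ac by (metis acyclic_def acyclic_orientation_def)
  moreover have "\<Gamma> e = {src (reorient x \<Lambda>) e, tgt (reorient x \<Lambda>) e}" for e
    using ac by (auto simp: acyclic_orientation_def reorient_def)
  ultimately show ?thesis
    by (simp add: acyclic_orientation_def)
qed

lemma acyclic_orientation_reorient_seq:
  "acyclic_orientation \<Gamma> \<Lambda> \<Longrightarrow> admissible \<Lambda> S \<Longrightarrow> acyclic_orientation \<Gamma> (reorient_seq S \<Lambda>)"
  by (induction S arbitrary: \<Lambda>) (auto simp: reorient_seq_def acyclic_orientation_reorient)

lemma admissible_append:
  "admissible \<Lambda> (S @ T) \<longleftrightarrow> admissible \<Lambda> S \<and> admissible (reorient_seq S \<Lambda>) T"
  by (induction S arbitrary: \<Lambda>) (auto simp: reorient_seq_def)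

text \<open>
  At an arrow into \<open>x\<close> the two inequalities change places: \<open>n y \<le> n x + 1 \<le> n y + 1\<close> for \<open>y \<rightarrow> x\<close> says the
  same as \<open>n x \<le> n y \<le> n x + 1\<close> for \<open>x \<rightarrow> y\<close>. This equivalence drives every induction along an admissible
  sequence below.
\<close>

lemma balanced_reorient_iff:
  assumes "acyclic_orientation \<Gamma> \<Lambda>" and "sink \<Lambda> x"
  shows "balanced (reorient x \<Lambda>) n \<longleftrightarrow> balanced \<Lambda> (n(x := Suc (n x)))"
  unfolding balanced_def
proof (rule iff_allI)
  fix e
  show "(n (src (reorient x \<Lambda>) e) \<le> n (tgt (reorient x \<Lambda>) e) \<and>
      n (tgt (reorient x \<Lambda>) e) \<le> Suc (n (src (reorient x \<Lambda>) e))) \<longleftrightarrow>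
    ((n(x := Suc (n x))) (src \<Lambda> e) \<le> (n(x := Suc (n x))) (tgt \<Lambda> e) \<and>
      (n(x := Suc (n x))) (tgt \<Lambda> e) \<le> Suc ((n(x := Suc (n x))) (src \<Lambda> e)))"
    using assms(2) acyclic_orientation_no_loop[OF assms(1), of e]
    by (auto simp: reorient_def sink_def)
qed

lemma count_list_Cons_fun: "count_list (x # S) = (count_list S)(x := Suc (count_list S x))"
  by (auto simp: fun_eq_iff)

lemma admissible_balanced:
  "acyclic_orientation \<Gamma> \<Lambda> \<Longrightarrow> admissible \<Lambda> S \<Longrightarrow> balanced \<Lambda> (count_list S)"
proof (induction S arbitrary: \<Lambda>)
  case Nil
  then show ?case by (simp add: balanced_def)
next
  case (Cons x S)
  then have "balanced (reorient x \<Lambda>) (count_list S)"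
    using acyclic_orientation_reorient by fastforce
  with Cons.prems show ?case
    unfolding count_list_Cons_fun by (metis admissible.simps(2) balanced_reorient_iff)
qed

text \<open>
  The support of a balanced function is closed under successors, so an element of it that has no
  successor in the support is a sink of the whole quiver.
\<close>

lemma balanced_obtains_sink:
  fixes \<Lambda> :: "('v::finite, 'e) orientation"
  assumes ac: "acyclic_orientation \<Gamma> \<Lambda>" and n: "balanced \<Lambda> n" and pos: "n z > 0"
  obtains x where "n x > 0" "sink \<Lambda> x"
proof -
  have "wf ((range \<Lambda>)\<inverse>)"
    using ac by (intro finite_acyclic_wf_converse) (auto simp: acyclic_orientation_def)
  then obtain x where x: "n x > 0" and min: "\<And>y. (y, x) \<in> (range \<Lambda>)\<inverse> \<Longrightarrow> \<not> n y > 0"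
    using pos wfE_min[of "(range \<Lambda>)\<inverse>" z "{y. n y > 0}"] by auto
  have "src \<Lambda> e \<noteq> x" for e
  proof
    assume e: "src \<Lambda> e = x"
    then have "(tgt \<Lambda> e, x) \<in> (range \<Lambda>)\<inverse>"
      by (metis converse_iff prod.collapse rangeI)
    moreover have "n x \<le> n (tgt \<Lambda> e)"
      using n e by (auto simp: balanced_def)
    ultimately show False
      using min x by fastforce
  qed
  then show ?thesis
    using that x by (auto simp: sink_def)
qed

lemma balanced_obtains_admissible:
  fixes \<Lambda> :: "('v::finite, 'e) orientation"
  assumes "acyclic_orientation \<Gamma> \<Lambda>" and "balanced \<Lambda> n"
  obtains S where "admissible \<Lambda> S" "count_list S = n"
proof -
  have "\<exists>S. admissible \<Lambda> S \<and> count_list S = n"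
    using assms
  proof (induction "\<Sum>x\<in>UNIV. n x" arbitrary: n \<Lambda> rule: less_induct)
    case less
    show ?case
    proof (cases "\<exists>z. n z > 0")
      case False
      then show ?thesis by (intro exI[of _ "[]"]) (auto simp: fun_eq_iff)
    next
      case True
      then obtain x where x: "n x > 0" "sink \<Lambda> x"
        using balanced_obtains_sink less.prems by metis
      define n' where "n' = n(x := n x - 1)"
      have n: "n = n'(x := Suc (n' x))"
        using x by (simp add: n'_def)
      have bal: "balanced (reorient x \<Lambda>) n'"
        using less.prems x n by (metis balanced_reorient_iff)
      have "sum n' UNIV < sum n UNIV"
        using x by (intro sum_strict_mono_ex1) (auto simp: n'_def intro!: exI[of _ x])
      then obtain S where S: "admissible (reorient x \<Lambda>) S" "count_list S = n'"
        using less.hyps bal acyclic_orientation_reorient[OF less.prems(1) x(2)] by blast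
      show ?thesis
        using S x n by (intro exI[of _ "x # S"]) (simp add: count_list_Cons_fun del: count_list.simps)
    qed
  qed
  then show ?thesis using that by blast
qed

text \<open>
  What is left of a balanced function after an admissible sequence below it can still be played out on
  the reflected orientation; this is where the order on sequences becomes the pointwise order.
\<close>

lemma balanced_diff:
  "acyclic_orientation \<Gamma> \<Lambda> \<Longrightarrow> admissible \<Lambda> S \<Longrightarrow> balanced \<Lambda> n \<Longrightarrow> count_list S \<le> n
    \<Longrightarrow> balanced (reorient_seq S \<Lambda>) (\<lambda>x. n x - count_list S x)"
proof (induction S arbitrary: \<Lambda> n)
  case Nil
  then show ?case by (simp add: reorient_seq_def)
next
  case (Cons x S)
  define n' where "n' = n(x := n x - 1)"
  have le: "count_list (x # S) y \<le> n y" for y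
    using Cons.prems(4) by (rule le_funD)
  have n: "n = n'(x := Suc (n' x))"
    using le[of x] by (auto simp: n'_def)
  have "balanced (reorient x \<Lambda>) n'"
    using Cons.prems n by (metis balanced_reorient_iff admissible.simps(2))
  moreover have "count_list S \<le> n'"
  proof (rule le_funI)
    show "count_list S y \<le> n' y" for y
      using le[of y] by (auto simp: n'_def split: if_splits)
  qed
  moreover have "acyclic_orientation \<Gamma> (reorient x \<Lambda>)"
    using Cons.prems acyclic_orientation_reorient by auto
  ultimately have "balanced (reorient_seq S (reorient x \<Lambda>)) (\<lambda>y. n' y - count_list S y)"
    using Cons by simp
  moreover have "(\<lambda>y. n' y - count_list S y) = (\<lambda>y. n y - count_list (x # S) y)"
    by (auto simp: n'_def fun_eq_iff)
  ultimately show ?case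
    by (simp add: reorient_seq_def)
qed

lemma admissible_obtains_extension:
  fixes \<Lambda> :: "('v::finite, 'e) orientation"
  assumes ac: "acyclic_orientation \<Gamma> \<Lambda>" and S: "admissible \<Lambda> S"
    and n: "balanced \<Lambda> n" and le: "count_list S \<le> n"
  obtains U where "admissible \<Lambda> (S @ U)" "count_list (S @ U) = n"
proof -
  obtain U where U: "admissible (reorient_seq S \<Lambda>) U" "count_list U = (\<lambda>x. n x - count_list S x)"
    using balanced_obtains_admissible acyclic_orientation_reorient_seq[OF ac S]
      balanced_diff[OF ac S n le] by metis
  have "count_list (S @ U) = n"
  proof
    show "count_list (S @ U) x = n x" for x
      using U le_funD[OF le, of x] by simp
  qed
  then show ?thesis
    using that U S by (auto simp: admissible_append)
qed

section \<open>Equivalence, order and join in terms of counting functions\<close>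

lemma seq_equiv_refl: "admissible \<Lambda> S \<Longrightarrow> seq_equiv \<Gamma> \<Lambda> S S"
  by (simp add: seq_equiv_def)

lemma seq_equiv_sym: "seq_equiv \<Gamma> \<Lambda> S T \<Longrightarrow> seq_equiv \<Gamma> \<Lambda> T S"
  by (simp add: seq_equiv_def equivclp_sym)

lemma seq_equiv_trans: "seq_equiv \<Gamma> \<Lambda> S T \<Longrightarrow> seq_equiv \<Gamma> \<Lambda> T R \<Longrightarrow> seq_equiv \<Gamma> \<Lambda> S R"
  unfolding seq_equiv_def by (meson equivclp_trans)

lemma interchange_seq_equiv: "interchange \<Gamma> \<Lambda> S T \<Longrightarrow> seq_equiv \<Gamma> \<Lambda> S T"
  by (simp add: seq_equiv_def r_into_equivclp) (simp add: interchange_def)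

lemma seq_equiv_Cons:
  assumes eq: "seq_equiv \<Gamma> (reorient x \<Lambda>) S T" and sink: "sink \<Lambda> x"
  shows "seq_equiv \<Gamma> \<Lambda> (x # S) (x # T)"
proof -
  have Cons: "interchange \<Gamma> \<Lambda> (x # S) (x # T)" if "interchange \<Gamma> (reorient x \<Lambda>) S T" for S T
    using that sink unfolding interchange_def by (metis admissible.simps(2) append_Cons)
  have "equivclp (interchange \<Gamma> (reorient x \<Lambda>)) S T"
    using eq by (simp add: seq_equiv_def)
  then have "equivclp (interchange \<Gamma> \<Lambda>) (x # S) (x # T)"
  proof (induction rule: equivclp_induct)
    case base
    then show ?case by simp
  next
    case (step T R)
    then show ?case
      by (meson Cons equivclp_sym equivclp_trans r_into_equivclp)
  qed
  then show ?thesis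
    using eq sink by (simp add: seq_equiv_def)
qed

lemma sink_reorient_other:
  assumes "sink \<Lambda> x" "sink \<Lambda> y" "x \<noteq> y"
  shows "sink (reorient x \<Lambda>) y"
  using assms by (auto simp: sink_def reorient_def)

lemma reorient_commute: "reorient x (reorient y \<Lambda>) = reorient y (reorient x \<Lambda>)"
  by (auto simp: reorient_def fun_eq_iff)

text \<open>
  A vertex \<open>a\<close> that comes before the sink \<open>x\<close> is itself a sink at that moment, and two sinks are not joined
  by an edge; so \<open>x\<close> can pass \<open>a\<close>.
\<close>

lemma sink_moves_to_front:
  assumes "acyclic_orientation \<Gamma> \<Lambda>" "admissible \<Lambda> (A @ x # B)" "sink \<Lambda> x" "x \<notin> set A"
  shows "seq_equiv \<Gamma> \<Lambda> (A @ x # B) (x # A @ B)"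
  using assms
proof (induction A arbitrary: \<Lambda>)
  case Nil
  then show ?case using seq_equiv_refl[of \<Lambda> "x # B" \<Gamma>] by simp
next
  case (Cons a A)
  have a: "sink \<Lambda> a" "x \<noteq> a"
    using Cons.prems by auto
  have "seq_equiv \<Gamma> (reorient a \<Lambda>) (A @ x # B) (x # A @ B)"
    using Cons a sink_reorient_other[of \<Lambda> a x] acyclic_orientation_reorient by fastforce
  then have 1: "seq_equiv \<Gamma> \<Lambda> (a # A @ x # B) (a # x # A @ B)"
    by (rule seq_equiv_Cons) fact
  then have adm: "admissible \<Lambda> (a # x # A @ B)"
    by (simp add: seq_equiv_def)
  moreover have "admissible \<Lambda> (x # a # A @ B)"
    using adm Cons.prems(3) a sink_reorient_other[of \<Lambda> x a]
    by (simp add: reorient_commute[of x a])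
  moreover have "\<Gamma> e \<noteq> {a, x}" for e
  proof
    assume "\<Gamma> e = {a, x}"
    then have "src \<Lambda> e \<in> {a, x}"
      using Cons.prems(1) unfolding acyclic_orientation_def by (metis insertI1)
    with a(1) Cons.prems(3) show False
      by (auto simp: sink_def)
  qed
  ultimately have "interchange \<Gamma> \<Lambda> (a # x # A @ B) (x # a # A @ B)"
    unfolding interchange_def
    by (intro conjI exI[of _ "[]"] exI[of _ a] exI[of _ x] exI[of _ "A @ B"]) auto
  with 1 show ?case
    by (auto intro: seq_equiv_trans interchange_seq_equiv)
qed

lemma interchange_count: "interchange \<Gamma> \<Lambda> S T \<Longrightarrow> count_list S = count_list T"
  by (auto simp: interchange_def fun_eq_iff)

text \<open>
  The first term \<open>x\<close> of \<open>S\<close> is a sink and occurs in \<open>T\<close>. Its first occurrence in \<open>T\<close> can be moved to the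
  front, which leaves two shorter sequences with equal counts on the reflected orientation.
\<close>

lemma seq_equiv_iff_count:
  assumes ac: "acyclic_orientation \<Gamma> \<Lambda>" and "admissible \<Lambda> S" "admissible \<Lambda> T"
  shows "seq_equiv \<Gamma> \<Lambda> S T \<longleftrightarrow> count_list S = count_list T"
proof
  assume "seq_equiv \<Gamma> \<Lambda> S T"
  then have "equivclp (interchange \<Gamma> \<Lambda>) S T"
    by (simp add: seq_equiv_def)
  then show "count_list S = count_list T"
    by (induction rule: equivclp_induct) (auto dest: interchange_count)
next
  assume "count_list S = count_list T"
  with assms show "seq_equiv \<Gamma> \<Lambda> S T"
  proof (induction S arbitrary: \<Lambda> T)
    case Nil
    then have "set T = {}"
      by (metis count_list_0_iff count_list.simps(1) ex_in_conv)
    with Nil show ?case by (simp add: seq_equiv_refl)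
  next
    case (Cons x S)
    have "x \<in> set T"
      using Cons.prems(4) by (metis count_notin list.set_intros(1) count_list_0_iff)
    then obtain A B where T: "T = A @ x # B" and A: "x \<notin> set A"
      by (meson split_list_first)
    have sink: "sink \<Lambda> x"
      using Cons.prems by simp
    have front: "seq_equiv \<Gamma> \<Lambda> T (x # A @ B)"
      using Cons.prems A T sink sink_moves_to_front by metis
    have "count_list S y = count_list (A @ B) y" for y
      using fun_cong[OF Cons.prems(4), of y] by (auto simp: T split: if_splits)
    then have "seq_equiv \<Gamma> (reorient x \<Lambda>) S (A @ B)"
      using Cons.prems front acyclic_orientation_reorient
      by (intro Cons.IH) (auto simp: seq_equiv_def fun_eq_iff)
    then have "seq_equiv \<Gamma> \<Lambda> (x # S) (x # A @ B)"
      by (rule seq_equiv_Cons) fact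
    with front show ?case
      by (meson seq_equiv_sym seq_equiv_trans)
  qed
qed

lemma seq_le_iff_count:
  fixes \<Lambda> :: "('v::finite, 'e) orientation"
  assumes ac: "acyclic_orientation \<Gamma> \<Lambda>" and S: "admissible \<Lambda> S" and T: "admissible \<Lambda> T"
  shows "seq_le \<Gamma> \<Lambda> S T \<longleftrightarrow> count_list S \<le> count_list T"
proof
  assume "seq_le \<Gamma> \<Lambda> S T"
  then obtain U where "seq_equiv \<Gamma> \<Lambda> T (S @ U)"
    by (auto simp: seq_le_def)
  then have "count_list T = count_list (S @ U)"
    using ac by (metis seq_equiv_def seq_equiv_iff_count)
  then show "count_list S \<le> count_list T"
    by (auto simp: le_fun_def)
next
  assume "count_list S \<le> count_list T"
  then obtain U where "admissible \<Lambda> (S @ U)" "count_list (S @ U) = count_list T"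
    using admissible_obtains_extension[OF ac S admissible_balanced[OF ac T]] by metis
  then show "seq_le \<Gamma> \<Lambda> S T"
    unfolding seq_le_def using S T seq_equiv_iff_count[OF ac]
    by (intro conjI exI[of _ U]) (auto simp: admissible_append)
qed

lemma balanced_min: "balanced \<Lambda> m \<Longrightarrow> balanced \<Lambda> n \<Longrightarrow> balanced \<Lambda> (\<lambda>x. min (m x) (n x))"
  unfolding balanced_def by (metis min.mono min_Suc_Suc)

lemma balanced_max: "balanced \<Lambda> m \<Longrightarrow> balanced \<Lambda> n \<Longrightarrow> balanced \<Lambda> (\<lambda>x. max (m x) (n x))"
  unfolding balanced_def by (metis max.mono max_Suc_Suc)

lemma distinct_count_list_le: "distinct A \<longleftrightarrow> (\<forall>x. count_list A x \<le> 1)"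
proof (induction A)
  case (Cons a A)
  have "(\<forall>x. count_list (a # A) x \<le> 1) \<longleftrightarrow> (\<forall>x. count_list A x \<le> 1) \<and> count_list A a = 0"
  proof (intro iffI conjI allI)
    assume *: "\<forall>x. count_list (a # A) x \<le> 1"
    show "count_list A x \<le> 1" for x
      using *[rule_format, of x] by (simp split: if_splits)
    show "count_list A a = 0"
      using *[rule_format, of a] by simp
  qed auto
  then show ?case
    unfolding Cons.IH[symmetric] count_list_0_iff by simp blast
qed simp

text \<open>
  The supports of the segments decrease and the segments have no repetitions, so \<open>x\<close> occurs once in each
  of the first \<open>count_list S x\<close> segments and in no later one.
\<close>

lemma canonical_form_count:
  assumes ac: "acyclic_orientation \<Gamma> \<Lambda>" and cf: "canonical_form \<Gamma> \<Lambda> S Ss"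
  shows "i < count_list S x \<longleftrightarrow> x \<in> seg_supp Ss i"
proof -
  have "count_list S = count_list (concat Ss)"
    using cf ac unfolding canonical_form_def by (metis seq_equiv_def seq_equiv_iff_count)
  moreover have "i < count_list (concat Ss) x \<longleftrightarrow> x \<in> seg_supp Ss i"
    if "\<And>i. i < length Ss \<Longrightarrow> distinct (Ss ! i) \<and> set (Ss ! i) = set (concat (drop i Ss))" for Ss i
    using that
  proof (induction Ss arbitrary: i)
    case Nil
    then show ?case by (simp add: seg_supp_def)
  next
    case (Cons A Ss)
    have A: "distinct A" "set A = set A \<union> set (concat Ss)"
      using Cons.prems[of 0] by auto
    have cA: "count_list A x = (if x \<in> set A then 1 else 0)"
      using A(1) by (auto simp: distinct_count_list_le le_Suc_eq count_list_0_iff)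
    have IH: "i < count_list (concat Ss) x \<longleftrightarrow> x \<in> seg_supp Ss i" for i
    proof (rule Cons.IH)
      show "distinct (Ss ! i) \<and> set (Ss ! i) = set (concat (drop i Ss))" if "i < length Ss" for i
        using Cons.prems[of "Suc i"] that by simp
    qed
    show ?case
    proof (cases i)
      case 0
      have "x \<notin> set (concat Ss) \<Longrightarrow> count_list (concat Ss) x = 0"
        by (rule count_notin)
      then show ?thesis
        using A cA 0 by (auto simp: seg_supp_def)
    next
      case (Suc j)
      have supp: "seg_supp (A # Ss) i = seg_supp Ss j"
        by (simp add: seg_supp_def Suc)
      have sub: "j < count_list (concat Ss) x \<Longrightarrow> x \<in> set A"
        using A(2) by (metis UnCI count_notin not_less_zero)
      have "i < count_list (concat (A # Ss)) x \<longleftrightarrow> j < count_list (concat Ss) x"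
        using sub A(2) by (cases "x \<in> set A") (auto simp: cA Suc count_notin)
      then show ?thesis
        by (simp only: supp IH)
    qed
  qed
  ultimately show ?thesis
    using cf by (simp add: canonical_form_def)
qed

text \<open>
  The first segment must contain each vertex of the support once. Its count \<open>min (count_list S x) 1\<close> is
  balanced, so it can be split off from \<open>S\<close> up to equivalence.
\<close>

lemma canonical_form_exists:
  fixes \<Lambda> :: "('v::finite, 'e) orientation"
  assumes "acyclic_orientation \<Gamma> \<Lambda>" "admissible \<Lambda> S"
  shows "\<exists>Ss. canonical_form \<Gamma> \<Lambda> S Ss"
  using assms
proof (induction "length S" arbitrary: S \<Lambda> rule: less_induct)
  case less
  note ac = less.prems(1)
  show ?case
  proof (cases "S = []")
    case True
    then show ?thesis
      by (intro exI[of _ "[]"]) (simp add: canonical_form_def seq_equiv_refl)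
  next
    case False
    have bal: "balanced \<Lambda> (count_list S)"
      by (rule admissible_balanced) fact+
    have "balanced \<Lambda> (\<lambda>x. min (count_list S x) 1)"
      by (rule balanced_min[OF bal]) (simp add: balanced_def)
    then obtain A where A: "admissible \<Lambda> A" "count_list A = (\<lambda>x. min (count_list S x) 1)"
      using balanced_obtains_admissible[OF ac] by metis
    obtain U where U: "admissible \<Lambda> (A @ U)" "count_list (A @ U) = count_list S"
      using admissible_obtains_extension[OF ac A(1) bal] A(2) by (metis le_funI min.cobounded1)
    have setA: "set A = set S"
    proof -
      have "count_list A x = 0 \<longleftrightarrow> count_list S x = 0" for x
        by (simp add: A(2) min_def)
      then show ?thesis
        unfolding count_list_0_iff by auto
    qed
    have distA: "distinct A"
      by (simp add: distinct_count_list_le A(2))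
    have "length (A @ U) = length S"
      using U(2) by (metis finite_UNIV subset_UNIV sum_count_set)
    moreover have "A \<noteq> []"
      using setA False by auto
    ultimately have "length U < length S"
      by (cases A) auto
    then obtain Us where Us: "canonical_form \<Gamma> (reorient_seq A \<Lambda>) U Us"
      using less.hyps[of U "reorient_seq A \<Lambda>"] U(1) acyclic_orientation_reorient_seq[OF ac A(1)]
      by (auto simp: admissible_append)
    then have eq: "admissible (reorient_seq A \<Lambda>) (concat Us)" "count_list U = count_list (concat Us)"
      using acyclic_orientation_reorient_seq[OF ac A(1)]
      unfolding canonical_form_def by (metis seq_equiv_def seq_equiv_iff_count)+
    have "count_list S x = count_list (A @ concat Us) x" for x
      using fun_cong[OF U(2), of x] by (simp add: eq(2))
    then have "seq_equiv \<Gamma> \<Lambda> S (concat (A # Us))"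
      using seq_equiv_iff_count[OF ac less.prems(2), of "A @ concat Us"] A(1) eq(1)
      by (auto simp: admissible_append fun_eq_iff)
    moreover have "set (concat Us) \<subseteq> set A"
    proof
      fix x assume "x \<in> set (concat Us)"
      then have "count_list (A @ U) x \<noteq> 0"
        using eq(2) by (auto simp: count_list_0_iff)
      then show "x \<in> set A"
        by (simp add: U(2) setA count_list_0_iff)
    qed
    ultimately have "canonical_form \<Gamma> \<Lambda> S (A # Us)"
      using Us \<open>A \<noteq> []\<close> distA unfolding canonical_form_def
      by (auto simp: nth_Cons split: nat.splits)
    then show ?thesis ..
  qed
qed

lemma seg_supp_nonempty_iff:
  assumes "canonical_form \<Gamma> \<Lambda> S Ss"
  shows "seg_supp Ss i \<noteq> {} \<longleftrightarrow> i < length Ss"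
  using assms unfolding canonical_form_def seg_supp_def by (metis set_empty)

text \<open>
  The supports prescribed for the join are the sets \<open>{x. i < max (count_list S x) (count_list T x)}\<close>.
  Since a maximum of balanced functions is balanced, a sequence with these segments exists, and the
  representative chosen in the definition of the join has the same counts.
\<close>

lemma seq_join_count:
  fixes \<Lambda> :: "('v::finite, 'e) orientation"
  assumes ac: "acyclic_orientation \<Gamma> \<Lambda>" and S: "admissible \<Lambda> S" and T: "admissible \<Lambda> T"
  shows "admissible \<Lambda> (seq_join \<Gamma> \<Lambda> S T) \<and>
    count_list (seq_join \<Gamma> \<Lambda> S T) = (\<lambda>x. max (count_list S x) (count_list T x))"
proof (cases "S = [] \<or> T = []")
  case True
  then show ?thesis
    using S T by (auto simp: seq_join_def fun_eq_iff)
next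
  case False
  define P where "P R \<longleftrightarrow> admissible \<Lambda> R \<and>
    (\<exists>Ss Ts Rs. canonical_form \<Gamma> \<Lambda> S Ss \<and> canonical_form \<Gamma> \<Lambda> T Ts \<and>
       canonical_form \<Gamma> \<Lambda> R Rs \<and> length Rs = max (length Ss) (length Ts) \<and>
       (\<forall>i < length Rs. set (Rs ! i) = seg_supp Ss i \<union> seg_supp Ts i))" for R
  have join: "seq_join \<Gamma> \<Lambda> S T = (SOME R. P R)"
    using False by (simp add: seq_join_def P_def)
  obtain Ss Ts where cf: "canonical_form \<Gamma> \<Lambda> S Ss" "canonical_form \<Gamma> \<Lambda> T Ts"
    using canonical_form_exists[OF ac] S T by metis
  obtain R where R: "admissible \<Lambda> R" "count_list R = (\<lambda>x. max (count_list S x) (count_list T x))"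
    using balanced_obtains_admissible[OF ac] balanced_max admissible_balanced[OF ac] S T by metis
  obtain Rs where Rs: "canonical_form \<Gamma> \<Lambda> R Rs"
    using canonical_form_exists[OF ac R(1)] by blast
  have supp: "seg_supp Rs i = seg_supp Ss i \<union> seg_supp Ts i" for i
    using canonical_form_count[OF ac Rs, of i] canonical_form_count[OF ac cf(1), of i]
      canonical_form_count[OF ac cf(2), of i] by (auto simp: R(2) less_max_iff_disj)
  have "i < length Rs \<longleftrightarrow> i < max (length Ss) (length Ts)" for i
    using supp[of i] seg_supp_nonempty_iff[OF Rs, of i] seg_supp_nonempty_iff[OF cf(1), of i]
      seg_supp_nonempty_iff[OF cf(2), of i] by (auto simp: less_max_iff_disj)
  then have "length Rs = max (length Ss) (length Ts)"
    by (metis linorder_neqE_nat order_less_irrefl)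
  then have "P R"
    unfolding P_def using R(1) cf Rs supp by (metis seg_supp_def)
  then have "P (seq_join \<Gamma> \<Lambda> S T)"
    unfolding join by (rule someI)
  then obtain Ss Ts Rs where *: "canonical_form \<Gamma> \<Lambda> S Ss" "canonical_form \<Gamma> \<Lambda> T Ts"
      "canonical_form \<Gamma> \<Lambda> (seq_join \<Gamma> \<Lambda> S T) Rs" "length Rs = max (length Ss) (length Ts)"
      "\<forall>i < length Rs. set (Rs ! i) = seg_supp Ss i \<union> seg_supp Ts i"
    by (auto simp: P_def)
  have "seg_supp Rs i = seg_supp Ss i \<union> seg_supp Ts i" for i
    using *(4,5) by (auto simp: seg_supp_def)
  then have "i < count_list (seq_join \<Gamma> \<Lambda> S T) x \<longleftrightarrow> i < max (count_list S x) (count_list T x)" for i x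
    using *(1-3)[THEN canonical_form_count[OF ac], of i x] by (auto simp: less_max_iff_disj)
  then have "count_list (seq_join \<Gamma> \<Lambda> S T) x = max (count_list S x) (count_list T x)" for x
    by (metis linorder_neqE_nat order_less_irrefl)
  with \<open>P (seq_join \<Gamma> \<Lambda> S T)\<close> show ?thesis
    by (auto simp: P_def)
qed

lemma seq_equiv_iff_seq_le:
  fixes \<Lambda> :: "('v::finite, 'e) orientation"
  assumes "acyclic_orientation \<Gamma> \<Lambda>" "admissible \<Lambda> S" "admissible \<Lambda> T"
  shows "seq_equiv \<Gamma> \<Lambda> S T \<longleftrightarrow> seq_le \<Gamma> \<Lambda> S T \<and> seq_le \<Gamma> \<Lambda> T S"
  using assms by (auto simp: seq_equiv_iff_count seq_le_iff_count)

lemma foldr_seq_join_least: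
  fixes \<Lambda> :: "('v::finite, 'e) orientation"
  assumes ac: "acyclic_orientation \<Gamma> \<Lambda>" and "\<forall>S\<in>set Ss. admissible \<Lambda> S" and T: "admissible \<Lambda> T"
  shows "admissible \<Lambda> (foldr (seq_join \<Gamma> \<Lambda>) Ss []) \<and>
    (seq_le \<Gamma> \<Lambda> (foldr (seq_join \<Gamma> \<Lambda>) Ss []) T \<longleftrightarrow> (\<forall>S\<in>set Ss. seq_le \<Gamma> \<Lambda> S T))"
  using assms(2)
proof (induction Ss)
  case Nil
  then show ?case using T by (simp add: seq_le_iff_count[OF ac] le_fun_def)
next
  case (Cons S Ss)
  let ?J = "foldr (seq_join \<Gamma> \<Lambda>) Ss []"
  have S: "admissible \<Lambda> S" and J: "admissible \<Lambda> ?J"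
    using Cons by auto
  have "seq_le \<Gamma> \<Lambda> (seq_join \<Gamma> \<Lambda> S ?J) T \<longleftrightarrow> seq_le \<Gamma> \<Lambda> S T \<and> seq_le \<Gamma> \<Lambda> ?J T"
    using seq_join_count[OF ac S J] S J T by (auto simp: seq_le_iff_count[OF ac] le_fun_def)
  then show ?case
    using Cons seq_join_count[OF ac S J] by auto
qed

section \<open>Reflections and morphisms of representations\<close>

text \<open>
  Reflections make sense in any dimension. Finite dimension only matters for splitting a representation
  into indecomposables, so it is kept out of the statements about reflections.
\<close>

definition linear_rep ::
    "('k::field \<Rightarrow> 'w::ab_group_add \<Rightarrow> 'w) \<Rightarrow> ('v, 'e) orientation \<Rightarrow> ('v, 'e, 'w) rep \<Rightarrow> bool" where
  "linear_rep s \<Lambda> M \<longleftrightarrow> (\<forall>x. module.subspace s (spc M x)) \<and>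
     (\<forall>e. linear_between s s (spc M (src \<Lambda> e)) (spc M (tgt \<Lambda> e)) (arr M e))"

definition rep_hom ::
    "('k \<Rightarrow> 'w::ab_group_add \<Rightarrow> 'w) \<Rightarrow> ('k \<Rightarrow> 'z::ab_group_add \<Rightarrow> 'z) \<Rightarrow> ('v, 'e) orientation \<Rightarrow>
     ('v, 'e, 'w) rep \<Rightarrow> ('v, 'e, 'z) rep \<Rightarrow> ('v \<Rightarrow> 'w \<Rightarrow> 'z) \<Rightarrow> bool" where
  "rep_hom s s' \<Lambda> M N \<phi> \<longleftrightarrow>
     (\<forall>x. linear_between s s' (spc M x) (spc N x) (\<phi> x)) \<and>
     (\<forall>e. \<forall>v \<in> spc M (src \<Lambda> e). \<phi> (tgt \<Lambda> e) (arr M e v) = arr N e (\<phi> (src \<Lambda> e) v))"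

text \<open>
  A single notion for the two kinds of morphisms attached to a direct sum: the injection of a summand is
  jointly injective on its own, and so is the family of all projections.
\<close>

definition jointly_injective ::
    "('v, 'e, 'w) rep \<Rightarrow> 'j set \<Rightarrow> ('j \<Rightarrow> 'v \<Rightarrow> 'w::zero \<Rightarrow> 'z::zero) \<Rightarrow> bool" where
  "jointly_injective M J \<phi> \<longleftrightarrow> (\<forall>x. \<forall>v \<in> spc M x. (\<forall>j\<in>J. \<phi> j x v = 0) \<longrightarrow> v = 0)"

lemma rep_hom_mem: "rep_hom s s' \<Lambda> M N \<phi> \<Longrightarrow> v \<in> spc M x \<Longrightarrow> \<phi> x v \<in> spc N x"
  unfolding rep_hom_def linear_between_def by blast

lemma is_rep_linear_rep: "is_rep s \<Lambda> M \<Longrightarrow> linear_rep s \<Lambda> M"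
  by (simp add: is_rep_def linear_rep_def)

lemma linear_rep_subspace: "linear_rep s \<Lambda> M \<Longrightarrow> module.subspace s (spc M x)"
  by (simp add: linear_rep_def)

lemma linear_rep_arr:
  "linear_rep s \<Lambda> M \<Longrightarrow> linear_between s s (spc M (src \<Lambda> e)) (spc M (tgt \<Lambda> e)) (arr M e)"
  by (simp add: linear_rep_def)

lemma linear_rep_arr_closed:
  "linear_rep s \<Lambda> M \<Longrightarrow> v \<in> spc M (src \<Lambda> e) \<Longrightarrow> arr M e v \<in> spc M (tgt \<Lambda> e)"
  using linear_rep_arr[of s \<Lambda> M e] by (auto simp: linear_between_def)

context
  fixes s :: "'k::field \<Rightarrow> 'w::ab_group_add \<Rightarrow> 'w" and V :: "'w set"
  assumes s: "vector_space s" and V: "module.subspace s V"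
begin

interpretation S: vector_space s by (rule s)

lemma zero_in_subspace: "0 \<in> V"
  by (rule S.subspace_0[OF V])

lemma linear_between_0:
  assumes "linear_between s s' V W f"
  shows "f 0 = 0"
proof -
  have "f (0 + 0) = f 0 + f 0"
    using assms zero_in_subspace unfolding linear_between_def by blast
  then show ?thesis by simp
qed

lemma linear_between_diff:
  assumes f: "linear_between s s' V W f" and uv: "u \<in> V" "v \<in> V"
  shows "f (u - v) = f u - f v"
proof -
  have "f (u - v + v) = f (u - v) + f v"
    using f uv S.subspace_diff[OF V] unfolding linear_between_def by blast
  then show ?thesis by (simp add: eq_diff_eq)
qed

lemma linear_between_sum:
  assumes f: "linear_between s s' V W f" and "finite I" and "\<And>i. i \<in> I \<Longrightarrow> u i \<in> V"
  shows "f (\<Sum>i\<in>I. u i) = (\<Sum>i\<in>I. f (u i))"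
  using assms(2,3)
proof (induction rule: finite_induct)
  case empty
  then show ?case using linear_between_0[OF f] by simp
next
  case (insert i I)
  then have "(\<Sum>i\<in>I. u i) \<in> V"
    by (intro S.subspace_sum V) auto
  with insert show ?case
    using f by (simp add: linear_between_def)
qed

end

lemma pointwise_apply: "pointwise s c v i = s c (v i)"
  by (simp add: pointwise_def)

lemma component_simps [simp]:
  "component e 0 = 0" "component e (u + v) = component e u + component e v"
  "component e (u - v) = component e u - component e v"
  "component e (pointwise s c u) = pointwise s c (component e u)"
  by (auto simp: component_def pointwise_def fun_eq_iff)

text \<open>
  The vector of the space at \<open>x\<close> of a reflected representation that has the components \<open>u e\<close>, where \<open>e\<close>
  runs through the arrows ending at \<open>x\<close>.
\<close>

definition assemble :: "('v, 'e) orientation \<Rightarrow> 'v \<Rightarrow> ('e \<Rightarrow> 'e list \<Rightarrow> 'u) \<Rightarrow> 'e list \<Rightarrow> 'u::zero" where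
  "assemble \<Lambda> x u p = (case p of [] \<Rightarrow> 0 | e # q \<Rightarrow> if tgt \<Lambda> e = x then u e q else 0)"

lemma assemble_Nil [simp]: "assemble \<Lambda> x u [] = 0"
  by (simp add: assemble_def)

lemma component_assemble [simp]: "component e (assemble \<Lambda> x u) = (if tgt \<Lambda> e = x then u e else 0)"
  by (auto simp: component_def assemble_def fun_eq_iff)

lemma list_fun_eqI:
  assumes "u [] = v []" "\<And>e. component e u = component e v"
  shows "u = v"
proof
  show "u p = v p" for p
    using assms by (cases p) (auto simp: component_def fun_eq_iff)
qed

lemma spc_reflect_other [simp]: "z \<noteq> x \<Longrightarrow> spc (reflect \<Lambda> x M) z = spc M z"
  by (simp add: reflect_def)

lemma mem_spc_reflect_iff:
  "w \<in> spc (reflect \<Lambda> x M) x \<longleftrightarrow> w [] = 0 \<and>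
     (\<forall>e. tgt \<Lambda> e = x \<longrightarrow> component e w \<in> spc M (src \<Lambda> e)) \<and>
     (\<forall>e. tgt \<Lambda> e \<noteq> x \<longrightarrow> component e w = 0) \<and>
     (\<Sum>e | tgt \<Lambda> e = x. arr M e (component e w)) = 0"
  by (simp add: reflect_def)

lemma arr_reflect: "arr (reflect \<Lambda> x M) e = (if tgt \<Lambda> e = x then component e else arr M e)"
  by (simp add: reflect_def)

lemma reflect_linear_rep:
  fixes s :: "'k::field \<Rightarrow> 'u::ab_group_add \<Rightarrow> 'u" and \<Lambda> :: "('v, 'e::finite) orientation"
  assumes s: "vector_space s" and ac: "acyclic_orientation \<Gamma> \<Lambda>" and sink: "sink \<Lambda> x"
    and M: "linear_rep (pointwise s) \<Lambda> M"
  shows "linear_rep (pointwise s) (reorient x \<Lambda>) (reflect \<Lambda> x M)"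
proof -
  interpret S: vector_space "pointwise s :: 'k \<Rightarrow> ('e list \<Rightarrow> 'u) \<Rightarrow> 'e list \<Rightarrow> 'u"
    using s by (rule vector_space_pointwise)
  interpret s: vector_space s by fact
  let ?R = "reflect \<Lambda> x M"
  have sub: "S.subspace (spc M z)" for z
    using M by (rule linear_rep_subspace)
  note loop = acyclic_orientation_no_loop[OF ac]
  have src: "src \<Lambda> e \<noteq> x" for e
    using sink by (simp add: sink_def)
  have lin: "linear_between (pointwise s) (pointwise s) (spc M (src \<Lambda> e)) (spc M (tgt \<Lambda> e)) (arr M e)" for e
    using M by (rule linear_rep_arr)
  have arr0: "arr M e 0 = 0" for e
    by (rule linear_between_0[OF S.vector_space_axioms sub lin])
  have arr_add: "arr M e (u + v) = arr M e u + arr M e v"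
    if "u \<in> spc M (src \<Lambda> e)" "v \<in> spc M (src \<Lambda> e)" for e u v
    using lin[of e] that by (simp add: linear_between_def)
  have arr_scale: "arr M e (pointwise s c u) = pointwise s c (arr M e u)"
    if "u \<in> spc M (src \<Lambda> e)" for e u c
    using lin[of e] that by (simp add: linear_between_def)
  have "S.subspace (spc ?R z)" for z
  proof (cases "z = x")
    case True
    have "S.subspace (spc ?R x)"
      unfolding S.subspace_def
    proof (intro conjI ballI allI)
      show "0 \<in> spc ?R x"
        by (simp add: mem_spc_reflect_iff arr0 S.subspace_0[OF sub])
    next
      fix u v assume "u \<in> spc ?R x" "v \<in> spc ?R x"
      then show "u + v \<in> spc ?R x"
        by (simp add: mem_spc_reflect_iff S.subspace_add[OF sub] arr_add sum.distrib)
    next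
      fix c u assume u: "u \<in> spc ?R x"
      then have "(\<Sum>e | tgt \<Lambda> e = x. arr M e (pointwise s c (component e u)))
          = pointwise s c (\<Sum>e | tgt \<Lambda> e = x. arr M e (component e u))"
        unfolding S.scale_sum_right by (intro sum.cong) (auto simp: mem_spc_reflect_iff arr_scale)
      with u show "pointwise s c u \<in> spc ?R x"
        by (simp add: mem_spc_reflect_iff S.subspace_scale[OF sub]) (simp add: pointwise_def)
    qed
    with True show ?thesis by simp
  qed (simp add: sub)
  moreover have "linear_between (pointwise s) (pointwise s) (spc ?R (src (reorient x \<Lambda>) e))
      (spc ?R (tgt (reorient x \<Lambda>) e)) (arr ?R e)" for e
  proof (cases "tgt \<Lambda> e = x")
    case True
    then show ?thesis
      using src[of e]
      by (auto simp: reorient_def linear_between_def arr_reflect mem_spc_reflect_iff)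
  next
    case False
    then show ?thesis
      using src[of e] lin[of e] by (simp add: reorient_def arr_reflect)
  qed
  ultimately show ?thesis
    by (simp add: linear_rep_def)
qed

text \<open>
  The kernel at \<open>x\<close> is a subspace of a direct sum of spaces at other vertices, and a reflected morphism acts
  componentwise on it. So a vector killed by all the reflected morphisms has all its components killed
  by the original ones. The reflected maps respect the kernels because morphisms commute with the map
  whose kernel is taken.
\<close>

lemma reflect_jointly_injective_homs:
  fixes s :: "'k::field \<Rightarrow> 'u::ab_group_add \<Rightarrow> 'u" and \<Lambda> :: "('v, 'e::finite) orientation"
    and \<phi> :: "'j \<Rightarrow> 'v \<Rightarrow> ('e list \<Rightarrow> 'u) \<Rightarrow> 'e list \<Rightarrow> 'u"
  assumes s: "vector_space s" and ac: "acyclic_orientation \<Gamma> \<Lambda>" and sink: "sink \<Lambda> x"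
    and M: "linear_rep (pointwise s) \<Lambda> M"
    and hom: "\<And>j. j \<in> J \<Longrightarrow> rep_hom (pointwise s) (pointwise s) \<Lambda> M (N j) (\<phi> j)"
    and inj: "jointly_injective M J \<phi>"
  obtains \<psi> where
    "\<And>j. j \<in> J \<Longrightarrow> rep_hom (pointwise s) (pointwise s) (reorient x \<Lambda>) (reflect \<Lambda> x M) (reflect \<Lambda> x (N j)) (\<psi> j)"
    "jointly_injective (reflect \<Lambda> x M) J \<psi>"
proof
  interpret S: vector_space "pointwise s :: 'k \<Rightarrow> ('e list \<Rightarrow> 'u) \<Rightarrow> 'e list \<Rightarrow> 'u"
    using s by (rule vector_space_pointwise)
  interpret s: vector_space s by fact
  define \<psi> where "\<psi> j z = (if z = x then \<lambda>w. assemble \<Lambda> x (\<lambda>e. \<phi> j (src \<Lambda> e) (component e w)) else \<phi> j z)"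
    for j z
  have src: "src \<Lambda> e \<noteq> x" for e
    using sink by (simp add: sink_def)
  have sub: "S.subspace (spc M z)" for z
    using M by (rule linear_rep_subspace)
  show "rep_hom (pointwise s) (pointwise s) (reorient x \<Lambda>) (reflect \<Lambda> x M) (reflect \<Lambda> x (N j)) (\<psi> j)"
    if j: "j \<in> J" for j
  proof -
    have lin: "linear_between (pointwise s) (pointwise s) (spc M z) (spc (N j) z) (\<phi> j z)" for z
      using hom[OF j] by (simp add: rep_hom_def)
    have comm: "arr (N j) e (\<phi> j (src \<Lambda> e) v) = \<phi> j (tgt \<Lambda> e) (arr M e v)"
      if "v \<in> spc M (src \<Lambda> e)" for e v
      using hom[OF j] that by (simp add: rep_hom_def)
    have add: "\<phi> j z (u + v) = \<phi> j z u + \<phi> j z v" if "u \<in> spc M z" "v \<in> spc M z" for z u v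
      using lin[of z] that by (simp add: linear_between_def)
    have scale: "\<phi> j z (pointwise s c v) = pointwise s c (\<phi> j z v)" if "v \<in> spc M z" for z c v
      using lin[of z] that by (simp add: linear_between_def)
    have closed: "\<phi> j z v \<in> spc (N j) z" if "v \<in> spc M z" for z v
      using lin[of z] that by (auto simp: linear_between_def)
    have zero: "\<phi> j z 0 = 0" for z
      by (rule linear_between_0[OF S.vector_space_axioms sub lin])
    have mem: "\<psi> j x w \<in> spc (reflect \<Lambda> x (N j)) x" if w: "w \<in> spc (reflect \<Lambda> x M) x" for w
    proof -
      have "(\<Sum>e | tgt \<Lambda> e = x. arr (N j) e (\<phi> j (src \<Lambda> e) (component e w)))
          = (\<Sum>e | tgt \<Lambda> e = x. \<phi> j x (arr M e (component e w)))"
        using w by (intro sum.cong) (auto simp: mem_spc_reflect_iff comm)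
      also have "\<dots> = \<phi> j x (\<Sum>e | tgt \<Lambda> e = x. arr M e (component e w))"
        using w linear_rep_arr_closed[OF M]
        by (intro linear_between_sum[OF S.vector_space_axioms sub lin, symmetric])
          (auto simp: mem_spc_reflect_iff)
      also have "\<dots> = 0"
        using w by (simp add: mem_spc_reflect_iff zero)
      finally show ?thesis
        using w by (auto simp: \<psi>_def mem_spc_reflect_iff closed)
    qed
    have "linear_between (pointwise s) (pointwise s) (spc (reflect \<Lambda> x M) z) (spc (reflect \<Lambda> x (N j)) z) (\<psi> j z)" for z
    proof (cases "z = x")
      case True
      have "\<psi> j x (u + v) = \<psi> j x u + \<psi> j x v"
        if "u \<in> spc (reflect \<Lambda> x M) x" "v \<in> spc (reflect \<Lambda> x M) x" for u v
        using that by (rule_tac list_fun_eqI) (simp_all add: \<psi>_def mem_spc_reflect_iff add)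
      moreover have "\<psi> j x (pointwise s c u) = pointwise s c (\<psi> j x u)"
        if "u \<in> spc (reflect \<Lambda> x M) x" for u c
      proof (rule list_fun_eqI)
        show "\<psi> j x (pointwise s c u) [] = pointwise s c (\<psi> j x u) []"
          by (simp add: \<psi>_def pointwise_apply)
        show "component e (\<psi> j x (pointwise s c u)) = component e (pointwise s c (\<psi> j x u))" for e
          using that by (cases "tgt \<Lambda> e = x") (simp_all add: \<psi>_def mem_spc_reflect_iff scale)
      qed
      ultimately show ?thesis
        using mem True by (auto simp: linear_between_def)
    qed (simp add: lin \<psi>_def)
    moreover have "\<psi> j (tgt (reorient x \<Lambda>) e) (arr (reflect \<Lambda> x M) e v)
        = arr (reflect \<Lambda> x (N j)) e (\<psi> j (src (reorient x \<Lambda>) e) v)"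
      if "v \<in> spc (reflect \<Lambda> x M) (src (reorient x \<Lambda>) e)" for e v
      using that src[of e] by (auto simp: reorient_def arr_reflect \<psi>_def comm split: if_splits)
    ultimately show ?thesis
      by (simp add: rep_hom_def)
  qed
  show "jointly_injective (reflect \<Lambda> x M) J \<psi>"
    unfolding jointly_injective_def
  proof (intro allI ballI impI)
    fix z v assume v: "v \<in> spc (reflect \<Lambda> x M) z" and 0: "\<forall>j\<in>J. \<psi> j z v = 0"
    show "v = 0"
    proof (cases "z = x")
      case True
      have "component e v = 0" for e
      proof (cases "tgt \<Lambda> e = x")
        case e: True
        have "\<phi> j (src \<Lambda> e) (component e v) = 0" if "j \<in> J" for j
        proof -
          have "component e (\<psi> j x v) = 0"
            using 0 that True by simp
          then show ?thesis
            by (simp add: \<psi>_def e)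
        qed
        then show ?thesis
          using inj v e True by (auto simp: jointly_injective_def mem_spc_reflect_iff)
      qed (use v True in \<open>simp add: mem_spc_reflect_iff\<close>)
      then show ?thesis
        using v True by (rule_tac list_fun_eqI) (auto simp: mem_spc_reflect_iff)
    next
      case False
      then show ?thesis
        using v 0 inj by (auto simp: jointly_injective_def \<psi>_def)
    qed
  qed
qed

text \<open>
  A nonzero representation has no jointly injective family of morphisms to zero representations, and the
  reflections along \<open>S\<close> preserve such families.
\<close>

lemma annihilates_if_jointly_injective:
  fixes s :: "'k::field \<Rightarrow> 'u::ab_group_add \<Rightarrow> 'u" and \<Lambda> :: "('v, 'e::finite) orientation"
    and \<phi> :: "'j \<Rightarrow> 'v \<Rightarrow> ('e list \<Rightarrow> 'u) \<Rightarrow> 'e list \<Rightarrow> 'u"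
  assumes s: "vector_space s" and "acyclic_orientation \<Gamma> \<Lambda>" and "admissible \<Lambda> S"
    and "linear_rep (pointwise s) \<Lambda> M"
    and "\<And>j. j \<in> J \<Longrightarrow> rep_hom (pointwise s) (pointwise s) \<Lambda> M (N j) (\<phi> j)"
    and "jointly_injective M J \<phi>"
    and "\<And>j. j \<in> J \<Longrightarrow> annihilates \<Lambda> S (N j)"
  shows "annihilates \<Lambda> S M"
  using assms(2-)
proof (induction S arbitrary: \<Lambda> M N \<phi>)
  case Nil
  interpret S: vector_space "pointwise s :: 'k \<Rightarrow> ('e list \<Rightarrow> 'u) \<Rightarrow> 'e list \<Rightarrow> 'u"
    using s by (rule vector_space_pointwise)
  have "v = 0" if "v \<in> spc M z" for z v
  proof -
    have "\<phi> j z v = 0" if "j \<in> J" for j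
      using rep_hom_mem[OF Nil.prems(4)[OF that] \<open>v \<in> spc M z\<close>] Nil.prems(6)[OF that]
      by (simp add: annihilates_def zero_rep_def)
    then show ?thesis
      using Nil.prems(5) that by (auto simp: jointly_injective_def)
  qed
  moreover have "0 \<in> spc M z" for z
    by (rule S.subspace_0[OF linear_rep_subspace[OF Nil.prems(3)]])
  ultimately show ?case
    by (auto simp: annihilates_def zero_rep_def)
next
  case (Cons x S)
  have sink: "sink \<Lambda> x"
    using Cons.prems by simp
  obtain \<psi> where \<psi>:
    "\<And>j. j \<in> J \<Longrightarrow> rep_hom (pointwise s) (pointwise s) (reorient x \<Lambda>) (reflect \<Lambda> x M) (reflect \<Lambda> x (N j)) (\<psi> j)"
    "jointly_injective (reflect \<Lambda> x M) J \<psi>"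
    using reflect_jointly_injective_homs[OF s Cons.prems(1) sink Cons.prems(3,4,5)] by blast
  have ann: "annihilates (reorient x \<Lambda>) S (reflect \<Lambda> x (N j))" if "j \<in> J" for j
    using Cons.prems(6)[OF that] by (simp add: annihilates_def)
  have adm: "admissible (reorient x \<Lambda>) S"
    using Cons.prems(2) by simp
  have "annihilates (reorient x \<Lambda>) S (reflect \<Lambda> x M)"
    by (rule Cons.IH[OF acyclic_orientation_reorient[OF Cons.prems(1) sink] adm
          reflect_linear_rep[OF s Cons.prems(1) sink Cons.prems(3)] \<psi> ann])
  then show ?case
    by (simp add: annihilates_def)
qed

lemma annihilates_if_injective_hom:
  fixes s :: "'k::field \<Rightarrow> 'u::ab_group_add \<Rightarrow> 'u" and \<Lambda> :: "('v, 'e::finite) orientation"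
  assumes "vector_space s" and "acyclic_orientation \<Gamma> \<Lambda>" and "admissible \<Lambda> S"
    and "linear_rep (pointwise s) \<Lambda> M" and "rep_hom (pointwise s) (pointwise s) \<Lambda> M N \<phi>"
    and "\<And>x v. v \<in> spc M x \<Longrightarrow> \<phi> x v = 0 \<Longrightarrow> v = 0" and "annihilates \<Lambda> S N"
  shows "annihilates \<Lambda> S M"
  by (rule annihilates_if_jointly_injective[where J = UNIV and N = "\<lambda>_::unit. N" and \<phi> = "\<lambda>_. \<phi>"])
    (use assms in \<open>auto simp: jointly_injective_def\<close>)

section \<open>The shortest annihilating sequence\<close>

lemma reflect_seq_append:
  "reflect_seq \<Lambda> (S @ T) M = reflect_seq (reorient_seq S \<Lambda>) T (reflect_seq \<Lambda> S M)"
  by (induction S arbitrary: \<Lambda> M) (auto simp: reorient_seq_def)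

lemma spc_reflect_seq_other: "z \<notin> set S \<Longrightarrow> spc (reflect_seq \<Lambda> S M) z = spc M z"
  by (induction S arbitrary: \<Lambda> M) auto

text \<open>
  No arrow that ends at \<open>x\<close> meets \<open>y\<close>, so the kernel at \<open>x\<close> is formed from the same spaces and maps whether
  or not the representation has been reflected at \<open>y\<close> before.
\<close>

lemma spc_reflect_reflect:
  assumes "x \<noteq> y" and "\<And>e. {src \<Lambda> e, tgt \<Lambda> e} \<noteq> {x, y}"
  shows "spc (reflect (reorient y \<Lambda>) x (reflect \<Lambda> y M)) x = spc (reflect \<Lambda> x M) x"
proof -
  have tgt: "tgt (reorient y \<Lambda>) e = x \<longleftrightarrow> tgt \<Lambda> e = x" for e
    using assms(1) assms(2)[of e] by (auto simp: reorient_def)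
  have "src (reorient y \<Lambda>) e = src \<Lambda> e \<and> src \<Lambda> e \<noteq> y" if "tgt \<Lambda> e = x" for e
    using assms(1) assms(2)[of e] that by (auto simp: reorient_def)
  moreover have "(\<Sum>e | tgt \<Lambda> e = x. arr (reflect \<Lambda> y M) e (component e w))
      = (\<Sum>e | tgt \<Lambda> e = x. arr M e (component e w))" for w
    using assms(1) by (intro sum.cong) (auto simp: arr_reflect)
  ultimately show ?thesis
    by (auto simp: mem_spc_reflect_iff tgt)
qed

lemma reflect_commute:
  assumes "x \<noteq> y" and "\<And>e. {src \<Lambda> e, tgt \<Lambda> e} \<noteq> {x, y}"
  shows "reflect (reorient x \<Lambda>) y (reflect \<Lambda> x M) = reflect (reorient y \<Lambda>) x (reflect \<Lambda> y M)"
proof (rule rep.equality)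
  let ?L = "reflect (reorient x \<Lambda>) y (reflect \<Lambda> x M)"
  let ?R = "reflect (reorient y \<Lambda>) x (reflect \<Lambda> y M)"
  have yx: "{src \<Lambda> e, tgt \<Lambda> e} \<noteq> {y, x}" for e
    using assms(2)[of e] by (simp add: insert_commute)
  show "spc ?L = spc ?R"
  proof
    show "spc ?L z = spc ?R z" for z
      using assms(1) spc_reflect_reflect[OF assms, where M = M]
        spc_reflect_reflect[OF assms(1)[symmetric] yx, where M = M]
      by (cases "z = x"; cases "z = y") simp_all
  qed
  show "arr ?L = arr ?R"
  proof
    fix e
    have "tgt (reorient y \<Lambda>) e = x \<longleftrightarrow> tgt \<Lambda> e = x" "tgt (reorient x \<Lambda>) e = y \<longleftrightarrow> tgt \<Lambda> e = y"
      using assms(1) assms(2)[of e] yx[of e] by (auto simp: reorient_def)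
    then show "arr ?L e = arr ?R e"
      by (simp add: arr_reflect)
  qed
qed simp

lemma reflect_seq_equiv:
  fixes \<Lambda> :: "('v, 'e::finite) orientation"
  assumes ac: "acyclic_orientation \<Gamma> \<Lambda>" and eq: "seq_equiv \<Gamma> \<Lambda> S T"
  shows "reflect_seq \<Lambda> S M = reflect_seq \<Lambda> T M"
proof -
  have step: "reflect_seq \<Lambda> S M = reflect_seq \<Lambda> T M" if ST: "interchange \<Gamma> \<Lambda> S T" for S T
  proof -
    obtain A x y B where S: "S = A @ [x, y] @ B" "T = A @ [y, x] @ B" and xy: "\<nexists>e. \<Gamma> e = {x, y}"
      and adm: "admissible \<Lambda> S"
      using ST by (auto simp: interchange_def)
    let ?\<Lambda> = "reorient_seq A \<Lambda>"
    have "acyclic_orientation \<Gamma> ?\<Lambda>"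
      using adm S by (intro acyclic_orientation_reorient_seq[OF ac]) (simp add: admissible_append)
    then have "{src ?\<Lambda> e, tgt ?\<Lambda> e} \<noteq> {x, y}" for e
      using xy by (metis acyclic_orientation_def)
    then have "reflect (reorient x ?\<Lambda>) y (reflect ?\<Lambda> x (reflect_seq \<Lambda> A M))
        = reflect (reorient y ?\<Lambda>) x (reflect ?\<Lambda> y (reflect_seq \<Lambda> A M))"
      by (cases "x = y") (simp, rule reflect_commute)
    then show ?thesis
      by (simp add: S reflect_seq_append reorient_commute[of x y])
  qed
  have "equivclp (interchange \<Gamma> \<Lambda>) S T"
    using eq by (simp add: seq_equiv_def)
  then show ?thesis
    by (induction rule: equivclp_induct) (auto dest: step)
qed

lemma annihilates_seq_equiv:
  fixes \<Lambda> :: "('v, 'e::finite) orientation"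
  assumes "acyclic_orientation \<Gamma> \<Lambda>" and "seq_equiv \<Gamma> \<Lambda> S T"
  shows "annihilates \<Lambda> S M \<longleftrightarrow> annihilates \<Lambda> T M"
  using reflect_seq_equiv[OF assms, of M] by (simp add: annihilates_def)

lemma reflect_seq_linear_rep:
  fixes s :: "'k::field \<Rightarrow> 'u::ab_group_add \<Rightarrow> 'u" and \<Lambda> :: "('v, 'e::finite) orientation"
  assumes s: "vector_space s"
  shows "acyclic_orientation \<Gamma> \<Lambda> \<Longrightarrow> admissible \<Lambda> S \<Longrightarrow> linear_rep (pointwise s) \<Lambda> M
    \<Longrightarrow> linear_rep (pointwise s) (reorient_seq S \<Lambda>) (reflect_seq \<Lambda> S M)"
proof (induction S arbitrary: \<Lambda> M)
  case (Cons x S)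
  have sink: "sink \<Lambda> x" and S: "admissible (reorient x \<Lambda>) S"
    using Cons.prems(2) by auto
  have "linear_rep (pointwise s) (reorient_seq S (reorient x \<Lambda>))
      (reflect_seq (reorient x \<Lambda>) S (reflect \<Lambda> x M))"
    by (rule Cons.IH[OF acyclic_orientation_reorient[OF Cons.prems(1) sink] S
          reflect_linear_rep[OF s Cons.prems(1) sink Cons.prems(3)]])
  then show ?case
    by (simp add: reorient_seq_def)
qed (simp add: reorient_seq_def)

text \<open>
  The zero representation is the case of an empty family of morphisms.
\<close>

lemma annihilates_zero_rep:
  fixes s :: "'k::field \<Rightarrow> 'u::ab_group_add \<Rightarrow> 'u" and \<Lambda> :: "('v, 'e::finite) orientation"
    and M :: "('v, 'e, 'e list \<Rightarrow> 'u) rep"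
  assumes "vector_space s" and "acyclic_orientation \<Gamma> \<Lambda>" and "admissible \<Lambda> S"
    and "linear_rep (pointwise s) \<Lambda> M" and "zero_rep M"
  shows "annihilates \<Lambda> S M"
  by (rule annihilates_if_jointly_injective[where J = "{}::unit set" and N = "\<lambda>_. M" and \<phi> = "\<lambda>_ _ v. v",
        OF assms(1-4)]) (use assms(5) in \<open>auto simp: jointly_injective_def zero_rep_def\<close>)

lemma annihilates_mono:
  fixes s :: "'k::field \<Rightarrow> 'u::ab_group_add \<Rightarrow> 'u" and \<Lambda> :: "('v, 'e::finite) orientation"
    and M :: "('v, 'e, 'e list \<Rightarrow> 'u) rep"
  assumes s: "vector_space s" and ac: "acyclic_orientation \<Gamma> \<Lambda>"
    and M: "linear_rep (pointwise s) \<Lambda> M"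
    and le: "seq_le \<Gamma> \<Lambda> S T" and ann: "annihilates \<Lambda> S M"
  shows "annihilates \<Lambda> T M"
proof -
  obtain U where U: "admissible (reorient_seq S \<Lambda>) U" "seq_equiv \<Gamma> \<Lambda> T (S @ U)"
    and S: "admissible \<Lambda> S"
    using le by (auto simp: seq_le_def)
  have "annihilates (reorient_seq S \<Lambda>) U (reflect_seq \<Lambda> S M)"
    using ann by (intro annihilates_zero_rep[OF s acyclic_orientation_reorient_seq[OF ac S] U(1)
          reflect_seq_linear_rep[OF s ac S M]]) (simp add: annihilates_def)
  then have "annihilates \<Lambda> (S @ U) M"
    by (simp add: annihilates_def reflect_seq_append)
  then show ?thesis
    by (simp add: annihilates_seq_equiv[OF ac U(2)])
qed

lemma obtain_meet:
  fixes \<Lambda> :: "('v::finite, 'e) orientation"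
  assumes ac: "acyclic_orientation \<Gamma> \<Lambda>" and S: "admissible \<Lambda> S" and T: "admissible \<Lambda> T"
  obtains R U V where "admissible \<Lambda> (R @ U)" "admissible \<Lambda> (R @ V)"
    "seq_equiv \<Gamma> \<Lambda> S (R @ U)" "seq_equiv \<Gamma> \<Lambda> T (R @ V)" "set U \<inter> set V = {}"
    "count_list R = (\<lambda>x. min (count_list S x) (count_list T x))"
proof -
  note bal = admissible_balanced[OF ac S] admissible_balanced[OF ac T]
  obtain R where R: "admissible \<Lambda> R" "count_list R = (\<lambda>x. min (count_list S x) (count_list T x))"
    using balanced_obtains_admissible[OF ac balanced_min[OF bal]] by metis
  obtain U where U: "admissible \<Lambda> (R @ U)" "count_list (R @ U) = count_list S"
    using admissible_obtains_extension[OF ac R(1) bal(1)] R(2) by (metis le_funI min.cobounded1)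
  obtain V where V: "admissible \<Lambda> (R @ V)" "count_list (R @ V) = count_list T"
    using admissible_obtains_extension[OF ac R(1) bal(2)] R(2) by (metis le_funI min.cobounded2)
  have "count_list U x = 0 \<or> count_list V x = 0" for x
    using fun_cong[OF U(2), of x] fun_cong[OF V(2), of x] fun_cong[OF R(2), of x] by auto
  then have "set U \<inter> set V = {}"
    by (auto simp: count_list_0_iff)
  then show ?thesis
    using that U V R seq_equiv_iff_count[OF ac S U(1)] seq_equiv_iff_count[OF ac T V(1)] by metis
qed

text \<open>
  With \<open>S \<sim> R U\<close> and \<open>T \<sim> R V\<close> as in \<open>obtain_meet\<close>, the reflections along \<open>U\<close> do not change the spaces of
  \<open>F(R) M\<close> outside the support of \<open>U\<close>, and similarly for \<open>V\<close>. The supports are disjoint, so every space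
  of \<open>F(R) M\<close> already vanishes.
\<close>

lemma annihilates_meet:
  fixes \<Lambda> :: "('v::finite, 'e::finite) orientation"
  assumes ac: "acyclic_orientation \<Gamma> \<Lambda>" and S: "admissible \<Lambda> S" "annihilates \<Lambda> S M"
    and T: "admissible \<Lambda> T" "annihilates \<Lambda> T M"
  obtains R where "admissible \<Lambda> R" "annihilates \<Lambda> R M" "seq_le \<Gamma> \<Lambda> R S" "seq_le \<Gamma> \<Lambda> R T"
proof -
  obtain R U V where adm: "admissible \<Lambda> (R @ U)" "admissible \<Lambda> (R @ V)"
    and eq: "seq_equiv \<Gamma> \<Lambda> S (R @ U)" "seq_equiv \<Gamma> \<Lambda> T (R @ V)"
    and disj: "set U \<inter> set V = {}"
    by (rule obtain_meet[OF ac S(1) T(1)])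
  have ann: "annihilates \<Lambda> (R @ U) M" "annihilates \<Lambda> (R @ V) M"
    using S T by (simp_all add: annihilates_seq_equiv[OF ac eq(1)] annihilates_seq_equiv[OF ac eq(2)])
  have "spc (reflect_seq \<Lambda> R M) z = {0}" for z
  proof -
    have "z \<notin> set U \<or> z \<notin> set V"
      using disj by auto
    then show ?thesis
      using ann unfolding annihilates_def zero_rep_def reflect_seq_append
      by (metis spc_reflect_seq_other)
  qed
  then have "annihilates \<Lambda> R M"
    by (simp add: annihilates_def zero_rep_def)
  moreover have "admissible \<Lambda> R"
    using adm by (simp add: admissible_append)
  moreover have "seq_le \<Gamma> \<Lambda> R S" "seq_le \<Gamma> \<Lambda> R T"
    unfolding seq_le_def using adm eq S T by (auto simp: admissible_append)
  ultimately show ?thesis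
    using that by blast
qed

text \<open>
  Minimal elements are least because the annihilating sequences are closed under meets.
\<close>

lemma shortest_annihilating_iff_least:
  fixes \<Lambda> :: "('v::finite, 'e::finite) orientation"
  assumes ac: "acyclic_orientation \<Gamma> \<Lambda>"
  shows "shortest_annihilating \<Gamma> \<Lambda> M S \<longleftrightarrow> admissible \<Lambda> S \<and> annihilates \<Lambda> S M \<and>
     (\<forall>T. admissible \<Lambda> T \<and> annihilates \<Lambda> T M \<longrightarrow> seq_le \<Gamma> \<Lambda> S T)"
proof
  assume S: "shortest_annihilating \<Gamma> \<Lambda> M S"
  then have adm: "admissible \<Lambda> S" and ann: "annihilates \<Lambda> S M"
    by (auto simp: shortest_annihilating_def)
  have "seq_le \<Gamma> \<Lambda> S T" if T: "admissible \<Lambda> T" "annihilates \<Lambda> T M" for T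
  proof -
    obtain R where R: "admissible \<Lambda> R" "annihilates \<Lambda> R M" "seq_le \<Gamma> \<Lambda> R S" "seq_le \<Gamma> \<Lambda> R T"
      by (rule annihilates_meet[OF ac adm ann T])
    then have "seq_equiv \<Gamma> \<Lambda> R S"
      using S by (auto simp: shortest_annihilating_def)
    then show ?thesis
      using R(1,4) adm T(1) by (simp add: seq_le_iff_count[OF ac] seq_equiv_iff_count[OF ac])
  qed
  with adm ann show "admissible \<Lambda> S \<and> annihilates \<Lambda> S M \<and>
     (\<forall>T. admissible \<Lambda> T \<and> annihilates \<Lambda> T M \<longrightarrow> seq_le \<Gamma> \<Lambda> S T)"
    by blast
next
  assume S: "admissible \<Lambda> S \<and> annihilates \<Lambda> S M \<and>
     (\<forall>T. admissible \<Lambda> T \<and> annihilates \<Lambda> T M \<longrightarrow> seq_le \<Gamma> \<Lambda> S T)"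
  have "\<not> annihilates \<Lambda> S' M" if "seq_le \<Gamma> \<Lambda> S' S" "\<not> seq_equiv \<Gamma> \<Lambda> S' S" for S'
  proof
    assume "annihilates \<Lambda> S' M"
    moreover have "admissible \<Lambda> S'"
      using that(1) by (simp add: seq_le_def)
    ultimately show False
      using S that seq_equiv_iff_seq_le[OF ac] by blast
  qed
  with S show "shortest_annihilating \<Gamma> \<Lambda> M S"
    by (simp add: shortest_annihilating_def)
qed

lemma shortest_annihilating_exists:
  fixes \<Lambda> :: "('v::finite, 'e::finite) orientation"
  assumes ac: "acyclic_orientation \<Gamma> \<Lambda>" and M: "preprojective \<Lambda> M"
  shows "\<exists>S. shortest_annihilating \<Gamma> \<Lambda> M S"
proof -
  obtain S where S: "admissible \<Lambda> S" "annihilates \<Lambda> S M"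
    and min: "\<And>T. admissible \<Lambda> T \<Longrightarrow> annihilates \<Lambda> T M \<Longrightarrow> length S \<le> length T"
    using M ex_has_least_nat[of "\<lambda>S. admissible \<Lambda> S \<and> annihilates \<Lambda> S M" _ length]
    unfolding preprojective_def by blast
  have "seq_le \<Gamma> \<Lambda> S T" if T: "admissible \<Lambda> T" "annihilates \<Lambda> T M" for T
  proof -
    obtain R where R: "admissible \<Lambda> R" "annihilates \<Lambda> R M" "seq_le \<Gamma> \<Lambda> R S" "seq_le \<Gamma> \<Lambda> R T"
      by (rule annihilates_meet[OF ac S T])
    obtain U where "seq_equiv \<Gamma> \<Lambda> S (R @ U)"
      using R(3) by (auto simp: seq_le_def)
    then have U: "count_list S = count_list (R @ U)"
      using seq_equiv_iff_count[OF ac] unfolding seq_equiv_def by blast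
    then have "length S = length (R @ U)"
      using sum_count_set[of S UNIV] sum_count_set[of "R @ U" UNIV] by simp
    then have "U = []"
      using min[OF R(1,2)] by simp
    then show ?thesis
      using U R S T by (simp add: seq_le_iff_count[OF ac])
  qed
  with S show ?thesis
    unfolding shortest_annihilating_iff_least[OF ac] by blast
qed

lemma shortest_annihilating_shortest_seq:
  fixes \<Lambda> :: "('v::finite, 'e::finite) orientation"
  assumes "acyclic_orientation \<Gamma> \<Lambda>" and "preprojective \<Lambda> M"
  shows "shortest_annihilating \<Gamma> \<Lambda> M (shortest_seq \<Gamma> \<Lambda> M)"
  unfolding shortest_seq_def by (rule someI_ex, rule shortest_annihilating_exists) fact+

lemma shortest_seq_admissible:
  fixes \<Lambda> :: "('v::finite, 'e::finite) orientation"
  assumes "acyclic_orientation \<Gamma> \<Lambda>" and "preprojective \<Lambda> M"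
  shows "admissible \<Lambda> (shortest_seq \<Gamma> \<Lambda> M)"
  using shortest_annihilating_shortest_seq[OF assms] unfolding shortest_annihilating_def by blast

text \<open>
  The shortest sequence turns every question about annihilation into one about the order on sequences.
\<close>

lemma annihilates_iff_shortest_seq_le:
  fixes s :: "'k::field \<Rightarrow> 'u::ab_group_add \<Rightarrow> 'u" and \<Lambda> :: "('v::finite, 'e::finite) orientation"
    and M :: "('v, 'e, 'e list \<Rightarrow> 'u) rep"
  assumes s: "vector_space s" and ac: "acyclic_orientation \<Gamma> \<Lambda>"
    and M: "linear_rep (pointwise s) \<Lambda> M" "preprojective \<Lambda> M" and T: "admissible \<Lambda> T"
  shows "annihilates \<Lambda> T M \<longleftrightarrow> seq_le \<Gamma> \<Lambda> (shortest_seq \<Gamma> \<Lambda> M) T"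
proof -
  have "shortest_annihilating \<Gamma> \<Lambda> M (shortest_seq \<Gamma> \<Lambda> M)"
    by (rule shortest_annihilating_shortest_seq) fact+
  then show ?thesis
    using T annihilates_mono[OF s ac M(1)] unfolding shortest_annihilating_iff_least[OF ac] by blast
qed

section \<open>Internal direct sums\<close>

text \<open>
  Summands are families of subspaces of the given representation. In this form a direct sum stays in one
  ambient space and can be compared with its reflection by equality, without isomorphisms.
\<close>

definition internal_sum ::
    "('k::field \<Rightarrow> 'w::ab_group_add \<Rightarrow> 'w) \<Rightarrow> ('v, 'e) orientation \<Rightarrow> ('v, 'e, 'w) rep \<Rightarrow>
     ('v \<Rightarrow> 'w set) \<Rightarrow> ('v \<Rightarrow> 'w set) \<Rightarrow> bool" where
  "internal_sum s \<Lambda> M A B \<longleftrightarrow>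
     linear_rep s \<Lambda> (M\<lparr>spc := A\<rparr>) \<and> linear_rep s \<Lambda> (M\<lparr>spc := B\<rparr>) \<and>
     (\<forall>x. spc M x = {a + b |a b. a \<in> A x \<and> b \<in> B x}) \<and> (\<forall>x. A x \<inter> B x = {0})"

lemma internal_sum_commute: "internal_sum s \<Lambda> M A B \<Longrightarrow> internal_sum s \<Lambda> M B A"
  unfolding internal_sum_def by (auto simp: Int_commute) (metis add.commute)+

lemma internal_sum_linear_rep: "internal_sum s \<Lambda> M A B \<Longrightarrow> linear_rep s \<Lambda> (M\<lparr>spc := A\<rparr>)"
  by (simp add: internal_sum_def)

lemma internal_sum_decompose:
  assumes "internal_sum s \<Lambda> M A B" and "v \<in> spc M x"
  obtains a b where "a \<in> A x" "b \<in> B x" "v = a + b"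
  using assms by (auto simp: internal_sum_def)

context
  fixes s :: "'k::field \<Rightarrow> 'w::ab_group_add \<Rightarrow> 'w" and \<Lambda> :: "('v, 'e) orientation"
    and M :: "('v, 'e, 'w) rep" and A B :: "'v \<Rightarrow> 'w set"
  assumes s: "vector_space s" and sum: "internal_sum s \<Lambda> M A B"
begin

interpretation S: vector_space s by (rule s)

lemma internal_sum_subspace: "module.subspace s (A x)" "module.subspace s (B x)"
  using sum by (auto simp: internal_sum_def linear_rep_def)

lemma internal_sum_subset: "A x \<subseteq> spc M x"
proof
  fix a assume "a \<in> A x"
  moreover have "0 \<in> B x"
    by (rule S.subspace_0[OF internal_sum_subspace(2)])
  ultimately show "a \<in> spc M x"
    using sum unfolding internal_sum_def by (metis (mono_tags, lifting) add.right_neutral mem_Collect_eq)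
qed

lemma internal_sum_unique:
  assumes "a \<in> A x" "b \<in> B x" "a' \<in> A x" "b' \<in> B x" and eq: "a + b = a' + b'"
  shows "a = a'" "b = b'"
proof -
  have "a - a' = b' - b"
    using eq by (simp add: algebra_simps)
  moreover have "a - a' \<in> A x" "b' - b \<in> B x"
    using assms internal_sum_subspace by (auto intro: S.subspace_diff)
  ultimately have "a - a' \<in> A x \<inter> B x"
    by simp
  moreover have "A x \<inter> B x = {0}"
    using sum by (simp add: internal_sum_def)
  ultimately have "a - a' = 0"
    by blast
  with eq show "a = a'" "b = b'"
    by auto
qed

lemma internal_sum_restriction_hom:
  "rep_hom s s \<Lambda> (M\<lparr>spc := A\<rparr>) M (\<lambda>_ v. v)"
  using internal_sum_subset by (auto simp: rep_hom_def linear_between_def)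

end

text \<open>
  The complement is the kernel, within \<open>V\<close>, of a linear projection onto \<open>I\<close>.
\<close>

lemma subspace_complement:
  assumes s: "vector_space s" and V: "module.subspace s V" and I: "module.subspace s I" "I \<subseteq> V"
  obtains C where "module.subspace s C" "C \<subseteq> V" "I \<inter> C = {0}" "\<And>v. v \<in> V \<Longrightarrow> \<exists>a\<in>I. \<exists>c\<in>C. v = a + c"
proof -
  interpret S: vector_space s by fact
  interpret P: vector_space_pair s s by unfold_locales
  obtain g where g: "range g \<subseteq> I" "Vector_Spaces.linear s s g" "\<And>v. v \<in> I \<Longrightarrow> g v = v"
    using P.linear_exists_left_inverse_on[OF S.linear_id I(1)] by auto
  interpret g: Vector_Spaces.linear s s g by fact
  define C where "C = V \<inter> {v. g v = 0}"
  show ?thesis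
  proof
    show "S.subspace C"
      unfolding C_def by (intro S.subspace_inter V g.subspace_kernel)
    show "C \<subseteq> V" by (simp add: C_def)
    show "I \<inter> C = {0}"
      using g(3) I V by (auto simp: C_def g.zero S.subspace_0)
    fix v assume v: "v \<in> V"
    have gv: "g v \<in> I" using g(1) by blast
    then have "v - g v \<in> C"
      using v I(2) V g(3) by (auto simp: C_def g.diff S.subspace_diff)
    then show "\<exists>a\<in>I. \<exists>c\<in>C. v = a + c"
      using gv by (intro bexI[of _ "g v"] bexI[of _ "v - g v"]) auto
  qed
qed

text \<open>
  The space at the sink is irrelevant for reflecting: only \<open>A'\<close> at the other vertices enters. A vector of
  the kernel with all components in \<open>A\<close> splits as \<open>a + b\<close> along the decomposition; comparing components
  shows that those of \<open>b\<close> vanish, hence the kernel formed inside \<open>A\<close> is \<open>A x\<close>.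
\<close>

lemma reflect_restrict:
  fixes s :: "'k::field \<Rightarrow> 'u::ab_group_add \<Rightarrow> 'u" and \<Lambda> :: "('v, 'e::finite) orientation"
    and M :: "('v, 'e, 'e list \<Rightarrow> 'u) rep"
  assumes s: "vector_space s" and sink: "sink \<Lambda> x"
    and sum: "internal_sum (pointwise s) (reorient x \<Lambda>) (reflect \<Lambda> x M) A B"
    and A': "\<And>z. z \<noteq> x \<Longrightarrow> A' z = A z"
  shows "reflect \<Lambda> x (M\<lparr>spc := A'\<rparr>) = (reflect \<Lambda> x M)\<lparr>spc := A\<rparr>"
proof (rule rep.equality)
  note s' = vector_space_pointwise[OF s]
  note sum' = internal_sum_commute[OF sum]
  have src: "src \<Lambda> e \<noteq> x" for e
    using sink by (simp add: sink_def)
  have comp_A: "component e w \<in> A (src \<Lambda> e)" if "w \<in> A x" "tgt \<Lambda> e = x" for e w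
    using linear_rep_arr_closed[OF internal_sum_linear_rep[OF sum], of w e] that src[of e]
    by (simp add: reorient_def arr_reflect)
  have comp_B: "component e w \<in> B (src \<Lambda> e)" if "w \<in> B x" "tgt \<Lambda> e = x" for e w
    using linear_rep_arr_closed[OF internal_sum_linear_rep[OF sum'], of w e] that src[of e]
    by (simp add: reorient_def arr_reflect)
  have sub: "A z \<subseteq> spc (reflect \<Lambda> x M) z" "B z \<subseteq> spc (reflect \<Lambda> x M) z" for z
    by (rule internal_sum_subset[OF s' sum], rule internal_sum_subset[OF s' sum'])
  have "spc (reflect \<Lambda> x (M\<lparr>spc := A'\<rparr>)) x = A x"
  proof (intro set_eqI iffI)
    fix w assume "w \<in> A x"
    then show "w \<in> spc (reflect \<Lambda> x (M\<lparr>spc := A'\<rparr>)) x"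
      using subsetD[OF sub(1), of w x] comp_A src by (auto simp: mem_spc_reflect_iff A')
  next
    fix w assume w: "w \<in> spc (reflect \<Lambda> x (M\<lparr>spc := A'\<rparr>)) x"
    have wA: "component e w \<in> A (src \<Lambda> e)" if "tgt \<Lambda> e = x" for e
      using w that src[of e] by (auto simp: mem_spc_reflect_iff A')
    have "component e w \<in> spc M (src \<Lambda> e)" if "tgt \<Lambda> e = x" for e
      using subsetD[OF sub(1) wA[OF that]] src[of e] by simp
    then have "w \<in> spc (reflect \<Lambda> x M) x"
      using w by (simp add: mem_spc_reflect_iff)
    then obtain a b where ab: "a \<in> A x" "b \<in> B x" "w = a + b"
      by (rule internal_sum_decompose[OF sum])
    have "component e b = 0" for e
    proof (cases "tgt \<Lambda> e = x")
      case True
      have "0 \<in> B (src \<Lambda> e)"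
        by (rule zero_in_subspace[OF s' internal_sum_subspace(2)[OF s' sum]])
      then show ?thesis
        by (rule internal_sum_unique(2)[OF s' sum comp_A[OF ab(1) True] comp_B[OF ab(2) True] wA[OF True]])
          (simp add: ab(3) fun_eq_iff)
    next
      case False
      then show ?thesis
        using subsetD[OF sub(2) ab(2)] by (simp add: mem_spc_reflect_iff)
    qed
    moreover have "b [] = 0"
      using subsetD[OF sub(2) ab(2)] by (simp add: mem_spc_reflect_iff)
    ultimately have "b = 0"
      by (rule_tac list_fun_eqI) auto
    with ab show "w \<in> A x" by simp
  qed
  then show "spc (reflect \<Lambda> x (M\<lparr>spc := A'\<rparr>)) = spc ((reflect \<Lambda> x M)\<lparr>spc := A\<rparr>)"
    using A' by (auto simp: fun_eq_iff reflect_def)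
  show "arr (reflect \<Lambda> x (M\<lparr>spc := A'\<rparr>)) = arr ((reflect \<Lambda> x M)\<lparr>spc := A\<rparr>)"
    by (simp add: fun_eq_iff arr_reflect)
qed simp

text \<open>
  The image in the space at \<open>x\<close> of the direct sum of the spaces \<open>A (src \<Lambda> e)\<close> over all arrows \<open>e\<close> ending
  at \<open>x\<close>.
\<close>

definition incoming_sums ::
    "('v, 'e::finite) orientation \<Rightarrow> 'v \<Rightarrow> ('v, 'e, 'w::ab_group_add) rep \<Rightarrow> ('v \<Rightarrow> 'w set) \<Rightarrow> 'w set" where
  "incoming_sums \<Lambda> x M A =
     {\<Sum>e | tgt \<Lambda> e = x. arr M e (u e) |u. \<forall>e. tgt \<Lambda> e = x \<longrightarrow> u e \<in> A (src \<Lambda> e)}"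

lemma incoming_sumsI:
  "(\<And>e. tgt \<Lambda> e = x \<Longrightarrow> u e \<in> A (src \<Lambda> e)) \<Longrightarrow> (\<Sum>e | tgt \<Lambda> e = x. arr M e (u e)) \<in> incoming_sums \<Lambda> x M A"
  unfolding incoming_sums_def by blast

lemma incoming_sumsE:
  assumes "v \<in> incoming_sums \<Lambda> x M A"
  obtains u where "\<And>e. tgt \<Lambda> e = x \<Longrightarrow> u e \<in> A (src \<Lambda> e)" "v = (\<Sum>e | tgt \<Lambda> e = x. arr M e (u e))"
  using assms unfolding incoming_sums_def by blast

context
  fixes s :: "'k::field \<Rightarrow> 'w::ab_group_add \<Rightarrow> 'w" and \<Lambda> :: "('v, 'e::finite) orientation"
    and M :: "('v, 'e, 'w) rep" and A :: "'v \<Rightarrow> 'w set" and x :: 'v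
  assumes s: "vector_space s" and M: "linear_rep s \<Lambda> M" and sink: "sink \<Lambda> x"
    and A: "\<And>z. z \<noteq> x \<Longrightarrow> module.subspace s (A z)" "\<And>z. z \<noteq> x \<Longrightarrow> A z \<subseteq> spc M z"
begin

interpretation S: vector_space s by (rule s)

lemma incoming_src_subspace: "S.subspace (A (src \<Lambda> e))"
  using sink A(1) by (simp add: sink_def)

lemma incoming_src_subset: "u \<in> A (src \<Lambda> e) \<Longrightarrow> u \<in> spc M (src \<Lambda> e)"
  using sink A(2) by (auto simp: sink_def)

lemma incoming_sums_subspace: "S.subspace (incoming_sums \<Lambda> x M A)"
  unfolding S.subspace_def
proof (intro conjI ballI allI)
  note lin = linear_rep_arr[OF M, unfolded linear_between_def]
  have arr0: "arr M e 0 = 0" for e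
    by (rule linear_between_0[OF s linear_rep_subspace[OF M] linear_rep_arr[OF M]])
  show "0 \<in> incoming_sums \<Lambda> x M A"
    using incoming_sumsI[of \<Lambda> x "\<lambda>_. 0" A M] S.subspace_0[OF incoming_src_subspace]
    by (simp add: arr0)
  fix v w c
  assume "v \<in> incoming_sums \<Lambda> x M A"
  then obtain u where u: "\<And>e. tgt \<Lambda> e = x \<Longrightarrow> u e \<in> A (src \<Lambda> e)" "v = (\<Sum>e | tgt \<Lambda> e = x. arr M e (u e))"
    by (rule incoming_sumsE) blast
  have "s c v = (\<Sum>e | tgt \<Lambda> e = x. arr M e (s c (u e)))"
    unfolding u(2) S.scale_sum_right
    using u(1) incoming_src_subset lin by (intro sum.cong) auto
  then show "s c v \<in> incoming_sums \<Lambda> x M A"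
    using incoming_sumsI[of \<Lambda> x "\<lambda>e. s c (u e)" A M] u(1) S.subspace_scale[OF incoming_src_subspace]
    by simp
  assume "w \<in> incoming_sums \<Lambda> x M A"
  then obtain u' where u': "\<And>e. tgt \<Lambda> e = x \<Longrightarrow> u' e \<in> A (src \<Lambda> e)" "w = (\<Sum>e | tgt \<Lambda> e = x. arr M e (u' e))"
    by (rule incoming_sumsE) blast
  have "v + w = (\<Sum>e | tgt \<Lambda> e = x. arr M e (u e + u' e))"
    unfolding u(2) u'(2) sum.distrib[symmetric]
    using u(1) u'(1) incoming_src_subset lin by (intro sum.cong) auto
  then show "v + w \<in> incoming_sums \<Lambda> x M A"
    using incoming_sumsI[of \<Lambda> x "\<lambda>e. u e + u' e" A M] u(1) u'(1) S.subspace_add[OF incoming_src_subspace]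
    by simp
qed

lemma incoming_sums_subset: "incoming_sums \<Lambda> x M A \<subseteq> spc M x"
proof
  fix v assume "v \<in> incoming_sums \<Lambda> x M A"
  then obtain u where u: "\<And>e. tgt \<Lambda> e = x \<Longrightarrow> u e \<in> A (src \<Lambda> e)" "v = (\<Sum>e | tgt \<Lambda> e = x. arr M e (u e))"
    by (rule incoming_sumsE) blast
  show "v \<in> spc M x"
    unfolding u(2) using u(1) incoming_src_subset linear_rep_arr_closed[OF M]
    by (intro S.subspace_sum linear_rep_subspace[OF M]) auto
qed

lemma arr_in_incoming_sums:
  assumes e: "tgt \<Lambda> e = x" and v: "v \<in> A (src \<Lambda> e)"
  shows "arr M e v \<in> incoming_sums \<Lambda> x M A"
proof -
  have arr0: "arr M e 0 = 0" for e
    by (rule linear_between_0[OF s linear_rep_subspace[OF M] linear_rep_arr[OF M]])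
  have "(\<Sum>e' | tgt \<Lambda> e' = x. arr M e' (if e' = e then v else 0)) = (\<Sum>e' | tgt \<Lambda> e' = x. if e' = e then arr M e v else 0)"
    by (intro sum.cong) (auto simp: arr0)
  also have "\<dots> = arr M e v"
    using e by simp
  finally show ?thesis
    using incoming_sumsI[of \<Lambda> x "\<lambda>e'. if e' = e then v else 0" A M] v S.subspace_0[OF incoming_src_subspace]
    by simp
qed

text \<open>
  No arrow starts at the sink, so a subrepresentation away from it is completed by any subspace at the
  sink that contains all the incoming images.
\<close>

lemma linear_rep_extend_at_sink:
  assumes R: "linear_rep s (reorient x \<Lambda>) (N\<lparr>spc := A\<rparr>)" and arr: "\<And>e. tgt \<Lambda> e \<noteq> x \<Longrightarrow> arr N e = arr M e"
    and D: "S.subspace D" "D \<subseteq> spc M x" "incoming_sums \<Lambda> x M A \<subseteq> D"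
  shows "linear_rep s \<Lambda> (M\<lparr>spc := A(x := D)\<rparr>)"
proof -
  have src: "src \<Lambda> e \<noteq> x" for e
    using sink by (simp add: sink_def)
  have "linear_between s s ((A(x := D)) (src \<Lambda> e)) ((A(x := D)) (tgt \<Lambda> e)) (arr M e)" for e
  proof -
    have "arr M e v \<in> (A(x := D)) (tgt \<Lambda> e)" if v: "v \<in> A (src \<Lambda> e)" for v
    proof (cases "tgt \<Lambda> e = x")
      case True
      then show ?thesis
        using arr_in_incoming_sums[OF True v] D(3) by auto
    next
      case False
      then show ?thesis
        using linear_rep_arr_closed[OF R, of v e] v src[of e] arr[of e] by (simp add: reorient_def)
    qed
    then show ?thesis
      using linear_rep_arr[OF M, of e] incoming_src_subset src[of e]
      unfolding linear_between_def by (simp add: image_subset_iff)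
  qed
  then show ?thesis
    using A(1) D(1) by (simp add: linear_rep_def)
qed

end

text \<open>
  A decomposition of the reflected representation is carried back to \<open>M\<close>. Away from \<open>x\<close> nothing changes;
  at \<open>x\<close> the images \<open>h A\<close> and \<open>h B\<close> of the incoming spaces meet only in zero, since \<open>h a = h b\<close> puts
  \<open>a - b\<close> into the kernel, which is the space of the reflection at \<open>x\<close> and splits as \<open>A x \<oplus> B x\<close>; comparison
  of components gives \<open>a \<in> A x\<close>, whence \<open>h a = 0\<close>. The two images span only the image of \<open>h\<close>; a complement
  of it, which is a sum of copies of the simple representation at \<open>x\<close>, is added to one of the summands and
  disappears again under the reflection.
\<close>

lemma internal_sum_lift:
  fixes s :: "'k::field \<Rightarrow> 'u::ab_group_add \<Rightarrow> 'u" and \<Lambda> :: "('v, 'e::finite) orientation"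
    and M :: "('v, 'e, 'e list \<Rightarrow> 'u) rep"
  assumes s: "vector_space s" and M: "linear_rep (pointwise s) \<Lambda> M" and sink: "sink \<Lambda> x"
    and sum: "internal_sum (pointwise s) (reorient x \<Lambda>) (reflect \<Lambda> x M) A B"
  obtains A' B' where "internal_sum (pointwise s) \<Lambda> M A' B'"
    "reflect \<Lambda> x (M\<lparr>spc := A'\<rparr>) = (reflect \<Lambda> x M)\<lparr>spc := A\<rparr>"
    "reflect \<Lambda> x (M\<lparr>spc := B'\<rparr>) = (reflect \<Lambda> x M)\<lparr>spc := B\<rparr>"
proof -
  let ?s = "pointwise s :: 'k \<Rightarrow> ('e list \<Rightarrow> 'u) \<Rightarrow> 'e list \<Rightarrow> 'u"
  have s': "vector_space ?s"
    using s by (rule vector_space_pointwise)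
  interpret S: vector_space ?s by fact
  note sum' = internal_sum_commute[OF sum]
  have src: "src \<Lambda> e \<noteq> x" for e
    using sink by (simp add: sink_def)
  have sub: "S.subspace (A z)" "S.subspace (B z)" for z
    using internal_sum_subspace[OF s' sum] by auto
  have subset: "A z \<subseteq> spc M z" "B z \<subseteq> spc M z" if "z \<noteq> x" for z
    using internal_sum_subset[OF s' sum, of z] internal_sum_subset[OF s' sum', of z] that by auto
  note lin = linear_rep_arr[OF M, unfolded linear_between_def]
  define I where "I = incoming_sums \<Lambda> x M (spc M)"
  define IA where "IA = incoming_sums \<Lambda> x M A"
  define IB where "IB = incoming_sums \<Lambda> x M B"
  have Isub: "S.subspace I" "I \<subseteq> spc M x"
    unfolding I_def using linear_rep_subspace[OF M]
    by (intro incoming_sums_subspace[OF s' M sink] incoming_sums_subset[OF s' M sink]; simp)+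
  have IA: "S.subspace IA" "IA \<subseteq> spc M x"
    unfolding IA_def using sub subset
    by (intro incoming_sums_subspace[OF s' M sink] incoming_sums_subset[OF s' M sink]; simp)+
  have IB: "S.subspace IB" "IB \<subseteq> spc M x"
    unfolding IB_def using sub subset
    by (intro incoming_sums_subspace[OF s' M sink] incoming_sums_subset[OF s' M sink]; simp)+
  have IAI: "IA \<subseteq> I" "IB \<subseteq> I"
    unfolding IA_def IB_def I_def incoming_sums_def using subset src by blast+
  obtain C where C: "S.subspace C" "C \<subseteq> spc M x" "I \<inter> C = {0}"
      "\<And>v. v \<in> spc M x \<Longrightarrow> \<exists>a\<in>I. \<exists>c\<in>C. v = a + c"
    using subspace_complement[OF s' linear_rep_subspace[OF M] Isub] by blast
  \<comment> \<open>The complement \<open>C\<close> of the image could be given to either summand; here the first one gets it.\<close>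
  define D where "D = {a + c |a c. a \<in> IA \<and> c \<in> C}"
  have D: "S.subspace D"
    unfolding D_def by (rule S.subspace_sums[OF IA(1) C(1)])
  have DM: "D \<subseteq> spc M x"
    using subsetD[OF IA(2)] subsetD[OF C(2)] S.subspace_add[OF linear_rep_subspace[OF M]]
    by (auto simp: D_def)
  have IAD: "IA \<subseteq> D"
  proof
    show "a \<in> D" if "a \<in> IA" for a
      unfolding D_def using that S.subspace_0[OF C(1)] by (intro CollectI exI[of _ a] exI[of _ 0]) simp
  qed
  have I_split: "\<exists>a\<in>IA. \<exists>b\<in>IB. v = a + b" if v: "v \<in> I" for v
  proof -
    obtain u where u: "\<And>e. tgt \<Lambda> e = x \<Longrightarrow> u e \<in> spc M (src \<Lambda> e)"
        "v = (\<Sum>e | tgt \<Lambda> e = x. arr M e (u e))"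
      using v unfolding I_def by (rule incoming_sumsE) blast
    have "\<exists>a b. a \<in> A (src \<Lambda> e) \<and> b \<in> B (src \<Lambda> e) \<and> u e = a + b" if "tgt \<Lambda> e = x" for e
      using internal_sum_decompose[OF sum, of "u e" "src \<Lambda> e"] u(1)[OF that] src[of e]
      by (metis spc_reflect_other)
    then obtain a b where ab: "\<And>e. tgt \<Lambda> e = x \<Longrightarrow> a e \<in> A (src \<Lambda> e) \<and> b e \<in> B (src \<Lambda> e) \<and> u e = a e + b e"
      by metis
    have "v = (\<Sum>e | tgt \<Lambda> e = x. arr M e (a e)) + (\<Sum>e | tgt \<Lambda> e = x. arr M e (b e))"
      unfolding u(2) sum.distrib[symmetric] using ab subset[OF src] lin
      by (intro sum.cong) (auto simp: subset_iff)
    then show ?thesis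
      unfolding IA_def IB_def using ab incoming_sumsI[of \<Lambda> x a A M] incoming_sumsI[of \<Lambda> x b B M] by blast
  qed
  have IAB: "v = 0" if vA: "v \<in> IA" and vB: "v \<in> IB" for v
  proof -
    obtain a where a: "\<And>e. tgt \<Lambda> e = x \<Longrightarrow> a e \<in> A (src \<Lambda> e)" "v = (\<Sum>e | tgt \<Lambda> e = x. arr M e (a e))"
      using vA unfolding IA_def by (rule incoming_sumsE) blast
    obtain b where b: "\<And>e. tgt \<Lambda> e = x \<Longrightarrow> b e \<in> B (src \<Lambda> e)" "v = (\<Sum>e | tgt \<Lambda> e = x. arr M e (b e))"
      using vB unfolding IB_def by (rule incoming_sumsE) blast
    have aM: "a e \<in> spc M (src \<Lambda> e)" "b e \<in> spc M (src \<Lambda> e)" if "tgt \<Lambda> e = x" for e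
      using a(1)[OF that] b(1)[OF that] subset[OF src] by auto
    define w where "w = assemble \<Lambda> x (\<lambda>e. a e - b e)"
    have "(\<Sum>e | tgt \<Lambda> e = x. arr M e (component e w)) = (\<Sum>e | tgt \<Lambda> e = x. arr M e (a e) - arr M e (b e))"
      using aM by (intro sum.cong)
        (auto simp: w_def linear_between_diff[OF s' linear_rep_subspace[OF M] linear_rep_arr[OF M]])
    also have "\<dots> = 0"
      using a(2) b(2) by (simp add: sum_subtractf)
    finally have "w \<in> spc (reflect \<Lambda> x M) x"
      using aM by (simp add: mem_spc_reflect_iff) 
        (simp add: w_def S.subspace_diff[OF linear_rep_subspace[OF M]])
    then obtain wa wb where w: "wa \<in> A x" "wb \<in> B x" "w = wa + wb"
      by (rule internal_sum_decompose[OF sum])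
    have wa: "component e wa = a e" if e: "tgt \<Lambda> e = x" for e
    proof -
      have "component e wa \<in> A (src \<Lambda> e)" "component e wb \<in> B (src \<Lambda> e)"
        using linear_rep_arr_closed[OF internal_sum_linear_rep[OF sum], of wa e]
          linear_rep_arr_closed[OF internal_sum_linear_rep[OF sum'], of wb e] e src[of e] w
        by (simp_all add: reorient_def arr_reflect)
      moreover have "component e w = component e wa + component e wb"
        by (simp add: w(3))
      moreover have "component e w = a e + - b e"
        by (simp add: w_def e)
      ultimately show ?thesis
        using internal_sum_unique(1)[OF s' sum, of "component e wa" "src \<Lambda> e" "component e wb" "a e" "- b e"]
          a(1)[OF e] S.subspace_neg[OF sub(2) b(1)[OF e]] by simp
    qed
    have "wa \<in> spc (reflect \<Lambda> x M) x"
      using internal_sum_subset[OF s' sum] w(1) by blast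
    then have "(\<Sum>e | tgt \<Lambda> e = x. arr M e (component e wa)) = 0"
      by (simp add: mem_spc_reflect_iff)
    moreover have "(\<Sum>e | tgt \<Lambda> e = x. arr M e (component e wa)) = v"
      unfolding a(2) by (intro sum.cong) (auto simp: wa)
    ultimately show "v = 0"
      by simp
  qed
  have repA: "linear_rep ?s \<Lambda> (M\<lparr>spc := A(x := D)\<rparr>)"
    using sub subset D DM IAD unfolding IA_def
    by (intro linear_rep_extend_at_sink[OF s' M sink _ _ internal_sum_linear_rep[OF sum]])
      (auto simp: arr_reflect)
  have repB: "linear_rep ?s \<Lambda> (M\<lparr>spc := B(x := IB)\<rparr>)"
    using sub subset IB unfolding IB_def
    by (intro linear_rep_extend_at_sink[OF s' M sink _ _ internal_sum_linear_rep[OF sum']])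
      (auto simp: arr_reflect)
  have "spc M z = {a + b |a b. a \<in> (A(x := D)) z \<and> b \<in> (B(x := IB)) z}" for z
  proof (cases "z = x")
    case True
    have "\<exists>a b. v = a + b \<and> a \<in> D \<and> b \<in> IB" if v: "v \<in> spc M x" for v
    proof -
      obtain i c where ic: "i \<in> I" "c \<in> C" "v = i + c"
        using C(4)[OF v] by blast
      obtain a b where "a \<in> IA" "b \<in> IB" "i = a + b"
        using I_split[OF ic(1)] by blast
      with ic show ?thesis
        unfolding D_def by (intro exI[of _ "a + c"] exI[of _ b]) (auto simp: algebra_simps)
    qed
    moreover have "a + b \<in> spc M x" if "a \<in> D" "b \<in> IB" for a b
      using that DM IB(2) S.subspace_add[OF linear_rep_subspace[OF M]] by blast
    ultimately show ?thesis
      using True by auto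
  next
    case False
    have "spc (reflect \<Lambda> x M) z = {a + b |a b. a \<in> A z \<and> b \<in> B z}"
      using sum unfolding internal_sum_def by blast
    with False show ?thesis
      by simp
  qed
  moreover have "(A(x := D)) z \<inter> (B(x := IB)) z = {0}" for z
  proof (cases "z = x")
    case True
    have "v = 0" if "v \<in> D" "v \<in> IB" for v
    proof -
      obtain a c where ac: "a \<in> IA" "c \<in> C" "v = a + c"
        using \<open>v \<in> D\<close> by (auto simp: D_def)
      have "c = v - a" using ac by simp
      moreover have "v - a \<in> I"
        using IAI ac that S.subspace_diff[OF Isub(1)] by blast
      ultimately have "c \<in> I \<inter> C"
        using ac(2) by simp
      then have "c = 0"
        using C(3) by simp
      with ac that show "v = 0"
        using IAB by simp
    qed
    then show ?thesis
      using True S.subspace_0[OF D] S.subspace_0[OF IB(1)] by auto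
  next
    case False
    then show ?thesis
      using sum by (auto simp: internal_sum_def)
  qed
  ultimately have "internal_sum ?s \<Lambda> M (A(x := D)) (B(x := IB))"
    unfolding internal_sum_def using repA repB by blast
  moreover have "reflect \<Lambda> x (M\<lparr>spc := A(x := D)\<rparr>) = (reflect \<Lambda> x M)\<lparr>spc := A\<rparr>"
    by (rule reflect_restrict[OF s sink sum]) simp
  moreover have "reflect \<Lambda> x (M\<lparr>spc := B(x := IB)\<rparr>) = (reflect \<Lambda> x M)\<lparr>spc := B\<rparr>"
    by (rule reflect_restrict[OF s sink sum']) simp
  ultimately show ?thesis
    using that by blast
qed

section \<open>Representations annihilated by a join\<close>

lemma admissible_reorient_other:
  "sink \<Lambda> x \<Longrightarrow> x \<notin> set V \<Longrightarrow> admissible \<Lambda> V \<Longrightarrow> admissible (reorient x \<Lambda>) V"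
proof (induction V arbitrary: \<Lambda>)
  case (Cons y V)
  then have "admissible (reorient x (reorient y \<Lambda>)) V"
    by (intro Cons.IH) (auto simp: sink_reorient_other)
  with Cons.prems show ?case
    by (simp add: sink_reorient_other reorient_commute[of x y])
qed simp

lemma admissible_append_disjoint:
  "admissible \<Lambda> U \<Longrightarrow> admissible \<Lambda> V \<Longrightarrow> set U \<inter> set V = {} \<Longrightarrow> admissible \<Lambda> (U @ V)"
  by (induction U arbitrary: \<Lambda>) (auto simp: admissible_reorient_other)

lemma linear_rep_support:
  assumes s: "vector_space s" and M: "linear_rep s \<Lambda> M"
    and X: "\<And>e. src \<Lambda> e \<in> X \<Longrightarrow> tgt \<Lambda> e \<in> X"
  shows "linear_rep s \<Lambda> (M\<lparr>spc := \<lambda>z. if z \<in> X then spc M z else {0}\<rparr>)"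
proof -
  interpret S: vector_space s by fact
  have arr0: "arr M e 0 = 0" for e
    by (rule linear_between_0[OF s linear_rep_subspace[OF M] linear_rep_arr[OF M]])
  have "linear_between s s (if src \<Lambda> e \<in> X then spc M (src \<Lambda> e) else {0})
      (if tgt \<Lambda> e \<in> X then spc M (tgt \<Lambda> e) else {0}) (arr M e)" for e
  proof (cases "src \<Lambda> e \<in> X")
    case True
    then show ?thesis
      using X linear_rep_arr[OF M, of e] by simp
  next
    case False
    have "0 \<in> spc M z" for z
      by (rule S.subspace_0[OF linear_rep_subspace[OF M]])
    with False show ?thesis
      by (simp add: linear_between_def arr0)
  qed
  then show ?thesis
    using linear_rep_subspace[OF M] by (simp add: linear_rep_def)
qed

lemma admissible_support_closed:
  assumes "acyclic_orientation \<Gamma> \<Lambda>" and "admissible \<Lambda> S" and "src \<Lambda> e \<in> set S"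
  shows "tgt \<Lambda> e \<in> set S"
proof -
  have "count_list S (src \<Lambda> e) \<le> count_list S (tgt \<Lambda> e)"
    using admissible_balanced[OF assms(1,2)] by (simp add: balanced_def)
  moreover have "count_list S (src \<Lambda> e) \<noteq> 0"
    using assms(3) by (simp add: count_list_0_iff)
  ultimately show ?thesis
    by (metis count_list_0_iff le_zero_eq)
qed

text \<open>
  The representation vanishes outside the supports of \<open>U\<close> and \<open>V\<close>. These sets are disjoint and closed under
  successors, so the restrictions of \<open>M\<close> to them are complementary subrepresentations. On its support \<open>U\<close>
  annihilates the restriction because \<open>U V\<close> does and \<open>V\<close> changes nothing there; outside, the restriction
  is zero from the start.
\<close>

lemma annihilated_disjoint_splits:
  fixes s :: "'k::field \<Rightarrow> 'u::ab_group_add \<Rightarrow> 'u" and \<Lambda> :: "('v::finite, 'e::finite) orientation"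
    and M :: "('v, 'e, 'e list \<Rightarrow> 'u) rep"
  assumes s: "vector_space s" and ac: "acyclic_orientation \<Gamma> \<Lambda>"
    and M: "linear_rep (pointwise s) \<Lambda> M"
    and U: "admissible \<Lambda> U" and V: "admissible \<Lambda> V" and disj: "set U \<inter> set V = {}"
    and ann: "annihilates \<Lambda> (U @ V) M"
  shows "\<exists>A B. internal_sum (pointwise s) \<Lambda> M A B \<and>
    annihilates \<Lambda> U (M\<lparr>spc := A\<rparr>) \<and> annihilates \<Lambda> V (M\<lparr>spc := B\<rparr>)"
proof -
  let ?s = "pointwise s :: 'k \<Rightarrow> ('e list \<Rightarrow> 'u) \<Rightarrow> 'e list \<Rightarrow> 'u"
  have s': "vector_space ?s"
    using s by (rule vector_space_pointwise)
  have 0: "0 \<in> spc M z" for z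
    by (rule zero_in_subspace[OF s' linear_rep_subspace[OF M]])
  have UV: "admissible \<Lambda> (U @ V)" and VU: "admissible \<Lambda> (V @ U)"
    using U V disj admissible_append_disjoint by (metis inf_commute)+
  have "seq_equiv \<Gamma> \<Lambda> (U @ V) (V @ U)"
    unfolding seq_equiv_iff_count[OF ac UV VU] by (simp add: fun_eq_iff)
  then have ann': "annihilates \<Lambda> (V @ U) M"
    using ann by (simp add: annihilates_seq_equiv[OF ac])
  define cut where "cut X z = (if z \<in> X then spc M z else {0})" for X z
  have rep: "linear_rep ?s \<Lambda> (M\<lparr>spc := cut (set W)\<rparr>)" if "admissible \<Lambda> W" for W
    unfolding cut_def[abs_def]
    by (rule linear_rep_support[OF s' M]) (rule admissible_support_closed[OF ac that])
  have outside: "spc M z = {0}" if "z \<notin> set U" "z \<notin> set V" for z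
    using that ann spc_reflect_seq_other[of z "U @ V" \<Lambda> M] by (simp add: annihilates_def zero_rep_def)
  have "spc M z = {a + b |a b. a \<in> cut (set U) z \<and> b \<in> cut (set V) z}" for z
    using disj outside[of z] by (auto simp: cut_def)
  moreover have "cut (set U) z \<inter> cut (set V) z = {0}" for z
    using disj 0 by (auto simp: cut_def)
  ultimately have sum: "internal_sum ?s \<Lambda> M (cut (set U)) (cut (set V))"
    using rep U V by (auto simp: internal_sum_def)
  have split: "annihilates \<Lambda> W (M\<lparr>spc := cut (set W)\<rparr>)"
    if W: "admissible \<Lambda> W" "admissible \<Lambda> (W @ W')" "annihilates \<Lambda> (W @ W') M" "set W \<inter> set W' = {}"
      and sum: "internal_sum ?s \<Lambda> M (cut (set W)) B" for W W' B
  proof -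
    let ?N = "M\<lparr>spc := cut (set W)\<rparr>"
    have "annihilates \<Lambda> (W @ W') ?N"
      by (rule annihilates_if_injective_hom[OF s ac W(2) rep[OF W(1)] internal_sum_restriction_hom[OF s' sum] _ W(3)])
    then have *: "spc (reflect_seq (reorient_seq W \<Lambda>) W' (reflect_seq \<Lambda> W ?N)) z = {0}" for z
      by (simp add: annihilates_def zero_rep_def reflect_seq_append)
    have "spc (reflect_seq \<Lambda> W ?N) z = {0}" for z
    proof (cases "z \<in> set W")
      case True
      then have "z \<notin> set W'"
        using W(4) by auto
      then show ?thesis
        using * by (metis spc_reflect_seq_other)
    next
      case False
      then show ?thesis
        by (simp add: spc_reflect_seq_other cut_def)
    qed
    then show ?thesis
      by (simp add: annihilates_def zero_rep_def)
  qed
  have "annihilates \<Lambda> U (M\<lparr>spc := cut (set U)\<rparr>)"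
    by (rule split[OF U UV ann disj sum])
  moreover have "annihilates \<Lambda> V (M\<lparr>spc := cut (set V)\<rparr>)"
    using disj by (intro split[OF V VU ann' _ internal_sum_commute[OF sum]]) auto
  ultimately show ?thesis
    using sum by blast
qed

text \<open>
  Induction on the common prefix, one reflection at a time, with \<open>internal_sum_lift\<close> as the induction step.
\<close>

lemma annihilated_prefix_splits:
  fixes s :: "'k::field \<Rightarrow> 'u::ab_group_add \<Rightarrow> 'u" and \<Lambda> :: "('v::finite, 'e::finite) orientation"
    and M :: "('v, 'e, 'e list \<Rightarrow> 'u) rep"
  assumes s: "vector_space s" and "acyclic_orientation \<Gamma> \<Lambda>"
    and "linear_rep (pointwise s) \<Lambda> M"
    and "admissible \<Lambda> (R @ U)" and "admissible \<Lambda> (R @ V)" and disj: "set U \<inter> set V = {}"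
    and "annihilates \<Lambda> (R @ U @ V) M"
  shows "\<exists>A B. internal_sum (pointwise s) \<Lambda> M A B \<and>
    annihilates \<Lambda> (R @ U) (M\<lparr>spc := A\<rparr>) \<and> annihilates \<Lambda> (R @ V) (M\<lparr>spc := B\<rparr>)"
  using assms(2-5,7)
proof (induction R arbitrary: \<Lambda> M)
  case Nil
  then show ?case
    using annihilated_disjoint_splits[OF s Nil.prems(1,2) _ _ disj] by simp
next
  case (Cons x R)
  have sink: "sink \<Lambda> x"
    using Cons.prems(3) by simp
  obtain A B where AB: "internal_sum (pointwise s) (reorient x \<Lambda>) (reflect \<Lambda> x M) A B"
    "annihilates (reorient x \<Lambda>) (R @ U) ((reflect \<Lambda> x M)\<lparr>spc := A\<rparr>)"
    "annihilates (reorient x \<Lambda>) (R @ V) ((reflect \<Lambda> x M)\<lparr>spc := B\<rparr>)"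
    using Cons.IH[OF acyclic_orientation_reorient[OF Cons.prems(1) sink]
        reflect_linear_rep[OF s Cons.prems(1) sink Cons.prems(2)]] Cons.prems(3-5)
    by (auto simp: annihilates_def)
  obtain A' B' where "internal_sum (pointwise s) \<Lambda> M A' B'"
    "reflect \<Lambda> x (M\<lparr>spc := A'\<rparr>) = (reflect \<Lambda> x M)\<lparr>spc := A\<rparr>"
    "reflect \<Lambda> x (M\<lparr>spc := B'\<rparr>) = (reflect \<Lambda> x M)\<lparr>spc := B\<rparr>"
    by (rule internal_sum_lift[OF s Cons.prems(2) sink AB(1)])
  with AB(2,3) show ?case
    by (intro exI[of _ A'] exI[of _ B']) (simp add: annihilates_def)
qed

text \<open>
  With the meet \<open>R\<close> of \<open>S \<sim> R U\<close> and \<open>T \<sim> R V\<close>, the join is \<open>R U V\<close>: the larger of two counts is the smaller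
  one plus the two excesses, one of which is zero.
\<close>

lemma annihilated_by_join_splits:
  fixes s :: "'k::field \<Rightarrow> 'u::ab_group_add \<Rightarrow> 'u" and \<Lambda> :: "('v::finite, 'e::finite) orientation"
    and M :: "('v, 'e, 'e list \<Rightarrow> 'u) rep"
  assumes s: "vector_space s" and ac: "acyclic_orientation \<Gamma> \<Lambda>"
    and M: "linear_rep (pointwise s) \<Lambda> M" and S: "admissible \<Lambda> S" and T: "admissible \<Lambda> T"
    and ann: "annihilates \<Lambda> (seq_join \<Gamma> \<Lambda> S T) M"
  obtains A B where "internal_sum (pointwise s) \<Lambda> M A B"
    "annihilates \<Lambda> S (M\<lparr>spc := A\<rparr>)" "annihilates \<Lambda> T (M\<lparr>spc := B\<rparr>)"
proof -
  obtain R U V where adm: "admissible \<Lambda> (R @ U)" "admissible \<Lambda> (R @ V)"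
    and eq: "seq_equiv \<Gamma> \<Lambda> S (R @ U)" "seq_equiv \<Gamma> \<Lambda> T (R @ V)"
    and disj: "set U \<inter> set V = {}"
    and R: "count_list R = (\<lambda>x. min (count_list S x) (count_list T x))"
    by (rule obtain_meet[OF ac S T])
  have RUV: "admissible \<Lambda> (R @ U @ V)"
    using adm admissible_append_disjoint[OF _ _ disj] unfolding admissible_append[of \<Lambda> R] by blast
  have cS: "count_list S = count_list (R @ U)" and cT: "count_list T = count_list (R @ V)"
    using eq by (simp_all add: seq_equiv_iff_count[OF ac] S T adm)
  have join: "admissible \<Lambda> (seq_join \<Gamma> \<Lambda> S T)"
    "count_list (seq_join \<Gamma> \<Lambda> S T) = (\<lambda>x. max (count_list S x) (count_list T x))"
    using seq_join_count[OF ac S T] by auto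
  have "max (count_list S x) (count_list T x) = count_list (R @ U @ V) x" for x
    using fun_cong[OF cS, of x] fun_cong[OF cT, of x] fun_cong[OF R, of x]
    unfolding count_list_append by linarith
  then have "seq_equiv \<Gamma> \<Lambda> (seq_join \<Gamma> \<Lambda> S T) (R @ U @ V)"
    unfolding seq_equiv_iff_count[OF ac join(1) RUV] join(2) by (rule ext)
  then have "annihilates \<Lambda> (R @ U @ V) M"
    using ann by (simp add: annihilates_seq_equiv[OF ac])
  then obtain A B where "internal_sum (pointwise s) \<Lambda> M A B"
    "annihilates \<Lambda> (R @ U) (M\<lparr>spc := A\<rparr>)" "annihilates \<Lambda> (R @ V) (M\<lparr>spc := B\<rparr>)"
    using annihilated_prefix_splits[OF s ac M adm disj] by blast
  then show ?thesis
    using that by (simp add: annihilates_seq_equiv[OF ac eq(1)] annihilates_seq_equiv[OF ac eq(2)])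
qed

section \<open>Internal and external direct sums\<close>

lemma rep_sum_projections:
  assumes s: "vector_space s" and M: "linear_rep s \<Lambda> M"
    and iso: "rep_iso s (pointwise s) \<Lambda> M (rep_sum I N)"
  obtains \<pi> where "\<And>i. i \<in> I \<Longrightarrow> rep_hom s s \<Lambda> M (N i) (\<pi> i)" "jointly_injective M I \<pi>"
proof -
  obtain \<phi> where lin: "\<And>x. linear_between s (pointwise s) (spc M x) (spc (rep_sum I N) x) (\<phi> x)"
    and bij: "\<And>x. bij_betw (\<phi> x) (spc M x) (spc (rep_sum I N) x)"
    and comm: "\<And>e v. v \<in> spc M (src \<Lambda> e) \<Longrightarrow> \<phi> (tgt \<Lambda> e) (arr M e v) = arr (rep_sum I N) e (\<phi> (src \<Lambda> e) v)"
    using iso by (auto simp: rep_iso_def)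
  have mem: "\<phi> x v i \<in> spc (N i) x" if "i \<in> I" "v \<in> spc M x" for x v i
    using bij_betwE[OF bij] that by (auto simp: rep_sum_def)
  have out: "\<phi> x v i = 0" if "i \<notin> I" "v \<in> spc M x" for x v i
    using bij_betwE[OF bij] that by (auto simp: rep_sum_def)
  have 0: "0 \<in> spc M x" for x
    by (rule zero_in_subspace[OF s linear_rep_subspace[OF M]])
  have \<phi>0: "\<phi> x 0 = 0" for x
    by (rule linear_between_0[OF s linear_rep_subspace[OF M] lin])
  show ?thesis
  proof (rule that)
    show "rep_hom s s \<Lambda> M (N i) (\<lambda>x v. \<phi> x v i)" if i: "i \<in> I" for i
      using i lin mem comm by (auto simp: rep_hom_def linear_between_def rep_sum_def pointwise_apply)
    show "jointly_injective M I (\<lambda>i x v. \<phi> x v i)"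
      unfolding jointly_injective_def
    proof (intro allI ballI impI)
      fix x v assume v: "v \<in> spc M x" and z: "\<forall>i\<in>I. \<phi> x v i = 0"
      have "\<phi> x v = \<phi> x 0"
      proof
        show "\<phi> x v i = \<phi> x 0 i" for i
          using z out[OF _ v, of i] by (cases "i \<in> I") (simp_all add: \<phi>0)
      qed
      then show "v = 0"
        using bij_betw_imp_inj_on[OF bij] v 0 by (meson inj_onD)
    qed
  qed
qed

text \<open>
  The injection of the summand \<open>i\<close> is the inverse of the isomorphism on vectors concentrated at \<open>i\<close>.
\<close>

lemma rep_sum_injection:
  assumes s: "vector_space s" and M: "linear_rep s \<Lambda> M"
    and iso: "rep_iso s (pointwise s) \<Lambda> M (rep_sum I N)"
    and N: "\<And>i. i \<in> I \<Longrightarrow> linear_rep s \<Lambda> (N i)" and i: "i \<in> I"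
  obtains \<iota> where "rep_hom s s \<Lambda> (N i) M \<iota>" "\<And>x v. v \<in> spc (N i) x \<Longrightarrow> \<iota> x v = 0 \<Longrightarrow> v = 0"
proof -
  interpret S: vector_space s by fact
  obtain \<phi> where lin: "\<And>x. linear_between s (pointwise s) (spc M x) (spc (rep_sum I N) x) (\<phi> x)"
    and bij: "\<And>x. bij_betw (\<phi> x) (spc M x) (spc (rep_sum I N) x)"
    and comm: "\<And>e v. v \<in> spc M (src \<Lambda> e) \<Longrightarrow> \<phi> (tgt \<Lambda> e) (arr M e v) = arr (rep_sum I N) e (\<phi> (src \<Lambda> e) v)"
    using iso by (auto simp: rep_iso_def)
  define emb where "emb v = (\<lambda>j. if j = i then v else 0)" for v :: 'b
  have N0: "0 \<in> spc (N j) x" if "j \<in> I" for j x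
    by (rule zero_in_subspace[OF s linear_rep_subspace[OF N[OF that]]])
  have emb: "emb v \<in> spc (rep_sum I N) x" if "v \<in> spc (N i) x" for v x
    using that i N0 by (auto simp: rep_sum_def emb_def)
  define \<iota> where "\<iota> x v = inv_into (spc M x) (\<phi> x) (emb v)" for x v
  have \<iota>_mem: "\<iota> x v \<in> spc M x" if "v \<in> spc (N i) x" for x v
    unfolding \<iota>_def by (rule inv_into_into) (use bij[of x] emb[OF that] in \<open>simp add: bij_betw_def\<close>)
  have \<phi>\<iota>: "\<phi> x (\<iota> x v) = emb v" if "v \<in> spc (N i) x" for x v
    unfolding \<iota>_def by (rule f_inv_into_f) (use bij[of x] emb[OF that] in \<open>simp add: bij_betw_def\<close>)
  have eqI: "\<iota> x v = w" if "v \<in> spc (N i) x" "w \<in> spc M x" "\<phi> x w = emb v" for x v w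
    using bij_betw_imp_inj_on[OF bij] \<iota>_mem[OF that(1)] that \<phi>\<iota>[OF that(1)] by (metis inj_onD)
  have sM: "S.subspace (spc M x)" and sN: "S.subspace (spc (N i) x)" for x
    using linear_rep_subspace[OF M] linear_rep_subspace[OF N[OF i]] by auto
  have "\<iota> x (u + v) = \<iota> x u + \<iota> x v" if "u \<in> spc (N i) x" "v \<in> spc (N i) x" for x u v
    using that lin[of x]
    by (intro eqI S.subspace_add sM sN \<iota>_mem) (auto simp: linear_between_def \<iota>_mem \<phi>\<iota> emb_def)
  moreover have "\<iota> x (s c v) = s c (\<iota> x v)" if "v \<in> spc (N i) x" for x c v
    using that lin[of x]
    by (intro eqI S.subspace_scale sM sN \<iota>_mem)
      (auto simp: linear_between_def \<iota>_mem \<phi>\<iota> emb_def pointwise_def)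
  moreover have "\<iota> (tgt \<Lambda> e) (arr (N i) e v) = arr M e (\<iota> (src \<Lambda> e) v)" if v: "v \<in> spc (N i) (src \<Lambda> e)" for e v
  proof (rule eqI)
    have arr0: "arr (N i) e 0 = 0"
      by (rule linear_between_0[OF s linear_rep_subspace linear_rep_arr]) (rule N[OF i])+
    show "arr (N i) e v \<in> spc (N i) (tgt \<Lambda> e)"
      by (rule linear_rep_arr_closed[OF N[OF i] v])
    show "arr M e (\<iota> (src \<Lambda> e) v) \<in> spc M (tgt \<Lambda> e)"
      by (rule linear_rep_arr_closed[OF M \<iota>_mem[OF v]])
    have "arr (N j) e 0 = 0" if "j \<in> I" for j
      by (rule linear_between_0[OF s linear_rep_subspace linear_rep_arr]) (rule N[OF that])+
    then show "\<phi> (tgt \<Lambda> e) (arr M e (\<iota> (src \<Lambda> e) v)) = emb (arr (N i) e v)"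
      using i by (auto simp: comm[OF \<iota>_mem[OF v]] \<phi>\<iota>[OF v] rep_sum_def emb_def fun_eq_iff)
  qed
  ultimately have "rep_hom s s \<Lambda> (N i) M \<iota>"
    using \<iota>_mem by (auto simp: rep_hom_def linear_between_def)
  moreover have "v = 0" if v: "v \<in> spc (N i) x" "\<iota> x v = 0" for x v
  proof -
    have "emb v = 0"
      using \<phi>\<iota>[OF v(1)] v(2) linear_between_0[OF s sM lin] by simp
    then have "emb v i = 0"
      by simp
    then show ?thesis
      by (simp add: emb_def)
  qed
  ultimately show ?thesis
    using that by blast
qed

lemma is_rep_restrict:
  assumes s: "vector_space s" and M: "is_rep s \<Lambda> M" and sum: "internal_sum s \<Lambda> M A B"
  shows "is_rep s \<Lambda> (M\<lparr>spc := A\<rparr>)"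
proof -
  interpret S: vector_space s by fact
  have "\<exists>F. finite F \<and> S.span F = A x" for x
  proof -
    obtain G where G: "finite G" "S.span G = spc M x"
      using M unfolding is_rep_def by blast
    obtain F where F: "F \<subseteq> A x" "S.independent F" "A x \<subseteq> S.span F"
      by (rule S.basis_exists)
    have "F \<subseteq> S.span G"
      using F(1) G(2) internal_sum_subset[OF s sum] by blast
    then have "finite F"
      using S.independent_span_bound[OF G(1) F(2)] by blast
    moreover have "S.span F = A x"
      using F S.span_minimal[OF F(1) internal_sum_subspace(1)[OF s sum]] by blast
    ultimately show ?thesis
      by blast
  qed
  then show ?thesis
    using internal_sum_linear_rep[OF sum] by (simp add: is_rep_def linear_rep_def)
qed

text \<open>
  The isomorphism sends a vector to its pair of components, with \<open>True\<close> indexing the first one.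
\<close>

lemma internal_sum_rep_plus:
  assumes s: "vector_space s" and M: "linear_rep s \<Lambda> M" and sum: "internal_sum s \<Lambda> M A B"
  shows "rep_iso s (pointwise s) \<Lambda> M (rep_plus (M\<lparr>spc := A\<rparr>) (M\<lparr>spc := B\<rparr>))"
proof -
  interpret S: vector_space s by fact
  note sum' = internal_sum_commute[OF sum]
  define \<phi> where "\<phi> x v = (\<lambda>i. if i then fst (SOME p. fst p \<in> A x \<and> snd p \<in> B x \<and> v = fst p + snd p)
      else snd (SOME p. fst p \<in> A x \<and> snd p \<in> B x \<and> v = fst p + snd p))" for x v
  have \<phi>: "\<phi> x (a + b) = (\<lambda>i. if i then a else b)" if "a \<in> A x" "b \<in> B x" for x a b
  proof -
    let ?P = "\<lambda>p. fst p \<in> A x \<and> snd p \<in> B x \<and> a + b = fst p + snd p"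
    define q where "q = (SOME p. ?P p)"
    have "?P q"
      unfolding q_def by (rule someI[of ?P "(a, b)"]) (use that in simp)
    then have q: "fst q = a" "snd q = b"
      using internal_sum_unique[OF s sum that, of "fst q" "snd q"] by auto
    have "\<phi> x (a + b) = (\<lambda>i. if i then fst q else snd q)"
      unfolding \<phi>_def q_def ..
    then show ?thesis
      unfolding q .
  qed
  have spc: "spc (rep_plus (M\<lparr>spc := A\<rparr>) (M\<lparr>spc := B\<rparr>)) x = {v. v True \<in> A x \<and> v False \<in> B x}" for x
    by (auto simp: rep_plus_def rep_sum_def split: if_splits)
  have arr: "arr (rep_plus (M\<lparr>spc := A\<rparr>) (M\<lparr>spc := B\<rparr>)) e v = (\<lambda>i. arr M e (v i))" for e v
    by (auto simp: rep_plus_def rep_sum_def)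
  note lin = linear_rep_arr[OF M, unfolded linear_between_def]
  note sub = internal_sum_subspace[OF s sum]
  have "linear_between s (pointwise s) (spc M x) {v. v True \<in> A x \<and> v False \<in> B x} (\<phi> x)" for x
    unfolding linear_between_def
  proof (intro conjI ballI allI subsetI)
    fix w assume "w \<in> \<phi> x ` spc M x"
    then show "w \<in> {v. v True \<in> A x \<and> v False \<in> B x}"
      by (auto elim!: internal_sum_decompose[OF sum] simp: \<phi>)
  next
    fix u v assume "u \<in> spc M x" "v \<in> spc M x"
    then obtain a b a' b' where ab: "a \<in> A x" "b \<in> B x" "u = a + b"
      and ab': "a' \<in> A x" "b' \<in> B x" "v = a' + b'"
      by (metis internal_sum_decompose[OF sum])
    have "u + v = (a + a') + (b + b')"
      by (simp add: ab ab' algebra_simps)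
    then have "\<phi> x (u + v) = (\<lambda>i. if i then a + a' else b + b')"
      using ab ab' sub by (simp only:) (intro \<phi> S.subspace_add)
    then show "\<phi> x (u + v) = \<phi> x u + \<phi> x v"
      using \<phi>[OF ab(1,2)] \<phi>[OF ab'(1,2)] by (simp add: ab(3) ab'(3) fun_eq_iff)
  next
    fix c v assume "v \<in> spc M x"
    then obtain a b where "a \<in> A x" "b \<in> B x" "v = a + b"
      by (rule internal_sum_decompose[OF sum])
    then show "\<phi> x (s c v) = pointwise s c (\<phi> x v)"
      using \<phi>[of "s c a" x "s c b"] sub
      by (auto simp: \<phi> fun_eq_iff pointwise_def S.scale_right_distrib S.subspace_scale)
  qed
  moreover have "bij_betw (\<phi> x) (spc M x) {v. v True \<in> A x \<and> v False \<in> B x}" for x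
  proof (rule bij_betw_byWitness[where f' = "\<lambda>v. v True + v False"])
    show "\<forall>v\<in>spc M x. \<phi> x v True + \<phi> x v False = v"
      by (auto elim!: internal_sum_decompose[OF sum] simp: \<phi>)
    show "\<forall>v\<in>{v. v True \<in> A x \<and> v False \<in> B x}. \<phi> x (v True + v False) = v"
      by (auto simp: \<phi> fun_eq_iff)
    show "\<phi> x ` spc M x \<subseteq> {v. v True \<in> A x \<and> v False \<in> B x}"
      by (auto elim!: internal_sum_decompose[OF sum] simp: \<phi>)
    show "(\<lambda>v. v True + v False) ` {v. v True \<in> A x \<and> v False \<in> B x} \<subseteq> spc M x"
      using sum by (auto simp: internal_sum_def)
  qed
  moreover have "\<phi> (tgt \<Lambda> e) (arr M e v) = (\<lambda>i. arr M e (\<phi> (src \<Lambda> e) v i))" if v: "v \<in> spc M (src \<Lambda> e)" for e v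
  proof -
    obtain a b where ab: "a \<in> A (src \<Lambda> e)" "b \<in> B (src \<Lambda> e)" "v = a + b"
      using v by (rule internal_sum_decompose[OF sum])
    have "arr M e a \<in> A (tgt \<Lambda> e)" "arr M e b \<in> B (tgt \<Lambda> e)"
      using linear_rep_arr_closed[OF internal_sum_linear_rep[OF sum], of a e]
        linear_rep_arr_closed[OF internal_sum_linear_rep[OF sum'], of b e] ab by simp_all
    moreover have "arr M e v = arr M e a + arr M e b"
      using ab internal_sum_subset[OF s sum] internal_sum_subset[OF s sum'] lin by blast
    ultimately show ?thesis
      using ab by (auto simp: \<phi>)
  qed
  ultimately show ?thesis
    unfolding rep_iso_def spc arr by blast
qed

text \<open>
  The two summands are recovered inside \<open>M\<close> as the kernels \<open>K\<close> of the projections, so the first one is the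
  kernel of the projection with index \<open>False\<close>.
\<close>

lemma rep_plus_internal_sum:
  assumes s: "vector_space s" and M: "linear_rep s \<Lambda> M"
    and N: "linear_rep s \<Lambda> N" and N': "linear_rep s \<Lambda> N'"
    and iso: "rep_iso s (pointwise s) \<Lambda> M (rep_plus N N')"
  obtains A B where "internal_sum s \<Lambda> M A B"
    "zero_rep (M\<lparr>spc := A\<rparr>) \<Longrightarrow> zero_rep N" "zero_rep (M\<lparr>spc := B\<rparr>) \<Longrightarrow> zero_rep N'"
proof -
  interpret S: vector_space s by fact
  have spc: "spc (rep_plus N N') x = {v. v True \<in> spc N x \<and> v False \<in> spc N' x}" for x
    by (auto simp: rep_plus_def rep_sum_def split: if_splits)
  obtain \<phi> where lin: "\<And>x. linear_between s (pointwise s) (spc M x) (spc (rep_plus N N') x) (\<phi> x)"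
    and bij: "\<And>x. bij_betw (\<phi> x) (spc M x) (spc (rep_plus N N') x)"
    and comm: "\<And>e v. v \<in> spc M (src \<Lambda> e) \<Longrightarrow> \<phi> (tgt \<Lambda> e) (arr M e v) = arr (rep_plus N N') e (\<phi> (src \<Lambda> e) v)"
    using iso by (auto simp: rep_iso_def)
  have sM: "S.subspace (spc M x)" for x
    by (rule linear_rep_subspace[OF M])
  have N0: "0 \<in> spc N x" "0 \<in> spc N' x" for x
    using S.subspace_0 linear_rep_subspace N N' by metis+
  have arr0: "arr N e 0 = 0" "arr N' e 0 = 0" for e
    by (rule linear_between_0[OF s linear_rep_subspace[OF N] linear_rep_arr[OF N]],
        rule linear_between_0[OF s linear_rep_subspace[OF N'] linear_rep_arr[OF N']])
  have \<phi>0: "\<phi> x 0 = 0" for x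
    by (rule linear_between_0[OF s sM lin])
  have \<phi>_add: "\<phi> x (u + v) = \<phi> x u + \<phi> x v" if "u \<in> spc M x" "v \<in> spc M x" for x u v
    using lin[of x] that by (simp add: linear_between_def)
  have \<phi>_scale: "\<phi> x (s c u) = pointwise s c (\<phi> x u)" if "u \<in> spc M x" for x u c
    using lin[of x] that by (simp add: linear_between_def)
  have inj: "u = v" if "\<phi> x u = \<phi> x v" "u \<in> spc M x" "v \<in> spc M x" for x u v
    using bij_betw_imp_inj_on[OF bij] that by (meson inj_onD)
  have surj: "\<exists>v\<in>spc M x. \<phi> x v = (\<lambda>i. if i then n else n')" if "n \<in> spc N x" "n' \<in> spc N' x" for x n n'
  proof -
    have "(\<lambda>i. if i then n else n') \<in> \<phi> x ` spc M x"
      using bij[of x] that unfolding bij_betw_def spc by simp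
    then show ?thesis
      by (metis imageE)
  qed
  define K where "K i x = {v \<in> spc M x. \<phi> x v i = 0}" for i x
  have rep: "linear_rep s \<Lambda> (M\<lparr>spc := K i\<rparr>)" for i
  proof -
    have "S.subspace (K i x)" for x
      unfolding S.subspace_def using S.subspace_0[OF sM] S.subspace_add[OF sM] S.subspace_scale[OF sM]
      by (auto simp: K_def \<phi>0 \<phi>_add \<phi>_scale pointwise_apply)
    moreover have "arr M e v \<in> K i (tgt \<Lambda> e)" if "v \<in> K i (src \<Lambda> e)" for e v
      using that linear_rep_arr_closed[OF M] arr0
      by (auto simp: K_def comm rep_plus_def rep_sum_def)
    ultimately show ?thesis
      using linear_rep_arr[OF M] by (auto simp: linear_rep_def linear_between_def K_def)
  qed
  have "spc M x = {a + b |a b. a \<in> K False x \<and> b \<in> K True x}" for x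
  proof (intro set_eqI iffI)
    fix v assume v: "v \<in> spc M x"
    have vN: "\<phi> x v True \<in> spc N x" "\<phi> x v False \<in> spc N' x"
      using bij_betwE[OF bij] v unfolding spc by blast+
    obtain a where a: "a \<in> spc M x" "\<phi> x a = (\<lambda>i. if i then \<phi> x v True else 0)"
      using surj[OF vN(1) N0(2)] by blast
    obtain b where b: "b \<in> spc M x" "\<phi> x b = (\<lambda>i. if i then 0 else \<phi> x v False)"
      using surj[OF N0(1) vN(2)] by blast
    have "\<phi> x v = \<phi> x (a + b)"
      using a b by (auto simp: \<phi>_add fun_eq_iff)
    then have "v = a + b"
      using inj v a b S.subspace_add[OF sM] by blast
    moreover have "a \<in> K False x" "b \<in> K True x"
      using a(1) b(1) fun_cong[OF a(2), of False] fun_cong[OF b(2), of True] by (simp_all add: K_def)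
    ultimately show "v \<in> {a + b |a b. a \<in> K False x \<and> b \<in> K True x}"
      by blast
  qed (auto simp: K_def S.subspace_add[OF sM])
  moreover have "K False x \<inter> K True x = {0}" for x
  proof -
    have "v = 0" if "v \<in> spc M x" "\<phi> x v False = 0" "\<phi> x v True = 0" for v
    proof (rule inj)
      show "\<phi> x v = \<phi> x 0"
      proof
        show "\<phi> x v i = \<phi> x 0 i" for i
          using that by (cases i) (simp_all add: \<phi>0)
      qed
    qed (use that S.subspace_0[OF sM] in auto)
    then show ?thesis
      using S.subspace_0[OF sM] by (auto simp: K_def \<phi>0)
  qed
  ultimately have sum: "internal_sum s \<Lambda> M (K False) (K True)"
    unfolding internal_sum_def using rep by blast
  have "zero_rep N" if z: "zero_rep (M\<lparr>spc := K False\<rparr>)"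
  proof -
    have "n = 0" if n: "n \<in> spc N x" for n x
    proof -
      obtain v where v: "v \<in> spc M x" "\<phi> x v = (\<lambda>i. if i then n else 0)"
        using surj[OF n N0(2)] by blast
      then have "v \<in> K False x"
        by (simp add: K_def)
      then have "v = 0"
        using z by (auto simp: zero_rep_def)
      then have "\<phi> x v True = 0"
        by (simp add: \<phi>0)
      then show "n = 0"
        by (simp add: v(2))
    qed
    then show ?thesis
      using N0(1) by (auto simp: zero_rep_def)
  qed
  moreover have "zero_rep N'" if z: "zero_rep (M\<lparr>spc := K True\<rparr>)"
  proof -
    have "n = 0" if n: "n \<in> spc N' x" for n x
    proof -
      obtain v where v: "v \<in> spc M x" "\<phi> x v = (\<lambda>i. if i then 0 else n)"
        using surj[OF N0(1) n] by blast
      then have "v \<in> K True x"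
        by (simp add: K_def)
      then have "v = 0"
        using z by (auto simp: zero_rep_def)
      then have "\<phi> x v False = 0"
        by (simp add: \<phi>0)
      then show "n = 0"
        by (simp add: v(2))
    qed
    then show ?thesis
      using N0(2) by (auto simp: zero_rep_def)
  qed
  ultimately show ?thesis
    using that[OF sum] by blast
qed

section \<open>Decomposition into indecomposable summands\<close>

lemma dim_strict_subspace:
  assumes s: "vector_space s" and V: "finite F" "module.span s F = V"
    and A: "module.subspace s A" "A \<subseteq> V" "A \<noteq> V"
  shows "vector_space.dim s A < vector_space.dim s V"
proof -
  interpret S: vector_space s by fact
  obtain BA where BA: "BA \<subseteq> A" "S.independent BA" "A \<subseteq> S.span BA" "card BA = S.dim A"
    by (rule S.basis_exists)
  obtain BV where BV: "BA \<subseteq> BV" "BV \<subseteq> V" "S.independent BV" "V \<subseteq> S.span BV"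
    using S.maximal_independent_subset_extend[of BA V] BA(1,2) A(2) by blast
  have "finite BV"
    using S.independent_span_bound[OF V(1) BV(3)] V(2) BV(2) by blast
  moreover have "BA \<noteq> BV"
    using S.span_minimal[OF BA(1) A(1)] BV(4) A(2,3) by blast
  ultimately have "card BA < card BV"
    using BV(1) by (intro psubset_card_mono) auto
  then show ?thesis
    using BA(4) S.basis_card_eq_dim[OF BV(2,4,3)] by simp
qed

lemma internal_sum_zero:
  assumes "internal_sum s \<Lambda> M A B" and "zero_rep (M\<lparr>spc := A\<rparr>)"
  shows "M\<lparr>spc := B\<rparr> = M"
proof -
  have "B = spc M"
    using assms by (auto simp: internal_sum_def zero_rep_def fun_eq_iff)
  then show ?thesis by simp
qed

lemma indecomposable_internal_sum:
  assumes s: "vector_space s" and M: "indecomposable s \<Lambda> M" and sum: "internal_sum s \<Lambda> M A B"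
  shows "M\<lparr>spc := A\<rparr> = M \<or> M\<lparr>spc := B\<rparr> = M"
proof -
  have rep: "is_rep s \<Lambda> M"
    using M by (simp add: indecomposable_def)
  note sum' = internal_sum_commute[OF sum]
  have "zero_rep (M\<lparr>spc := A\<rparr>) \<or> zero_rep (M\<lparr>spc := B\<rparr>)"
    using M is_rep_restrict[OF s rep sum] is_rep_restrict[OF s rep sum']
      internal_sum_rep_plus[OF s is_rep_linear_rep[OF rep] sum]
    unfolding indecomposable_def by blast
  then show ?thesis
    using internal_sum_zero[OF sum] internal_sum_zero[OF sum'] by blast
qed

lemma internal_sum_direct_summand:
  assumes s: "vector_space s" and M: "is_rep s \<Lambda> M" and sum: "internal_sum s \<Lambda> M A B"
  shows "direct_summand s \<Lambda> (M\<lparr>spc := A\<rparr>) M"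
  unfolding direct_summand_def
  using is_rep_restrict[OF s M sum] is_rep_restrict[OF s M internal_sum_commute[OF sum]]
    internal_sum_rep_plus[OF s is_rep_linear_rep[OF M] sum] by blast

lemma direct_summand_injection:
  assumes s: "vector_space s" and M: "is_rep s \<Lambda> M" and X: "direct_summand s \<Lambda> X M"
  obtains \<iota> where "rep_hom s s \<Lambda> X M \<iota>" "\<And>x v. v \<in> spc X x \<Longrightarrow> \<iota> x v = 0 \<Longrightarrow> v = 0"
proof -
  obtain N where N: "is_rep s \<Lambda> N" "rep_iso s (pointwise s) \<Lambda> M (rep_plus X N)" and X': "is_rep s \<Lambda> X"
    using X by (auto simp: direct_summand_def)
  show ?thesis
  proof (rule rep_sum_injection[OF s is_rep_linear_rep[OF M] N(2)[unfolded rep_plus_def], of True])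
    show "linear_rep s \<Lambda> (if i then X else N)" for i
      using N(1) X' by (simp add: is_rep_linear_rep)
  qed (use that in auto)
qed

text \<open>
  Induction on the total dimension. Proving a property along decompositions takes the place of choosing a
  list of indecomposable summands.
\<close>

lemma decomposition_induct:
  fixes s :: "'k::field \<Rightarrow> 'w::ab_group_add \<Rightarrow> 'w" and \<Lambda> :: "('v::finite, 'e) orientation"
  assumes s: "vector_space s" and M: "is_rep s \<Lambda> M"
    and zero: "\<And>M. is_rep s \<Lambda> M \<Longrightarrow> zero_rep M \<Longrightarrow> P M"
    and indec: "\<And>M. indecomposable s \<Lambda> M \<Longrightarrow> P M"
    and sum: "\<And>M A B. is_rep s \<Lambda> M \<Longrightarrow> internal_sum s \<Lambda> M A B \<Longrightarrow>
      P (M\<lparr>spc := A\<rparr>) \<Longrightarrow> P (M\<lparr>spc := B\<rparr>) \<Longrightarrow> P M"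
  shows "P M"
  using M
proof (induction "\<Sum>x\<in>UNIV. vector_space.dim s (spc M x)" arbitrary: M rule: less_induct)
  case less
  interpret S: vector_space s by fact
  note M = less.prems
  \<comment> \<open>A summand with a nonzero complement is strictly smaller at a vertex where the complement is nonzero.\<close>
  have smaller: "(\<Sum>x\<in>UNIV. S.dim (A x)) < (\<Sum>x\<in>UNIV. S.dim (spc M x))"
    if AB: "internal_sum s \<Lambda> M A B" and B: "\<not> zero_rep (M\<lparr>spc := B\<rparr>)" for A B
  proof -
    have lt: "S.dim (A x) < S.dim (spc M x)" if "A x \<noteq> spc M x" for x
    proof -
      obtain F where "finite F" "S.span F = spc M x"
        using M unfolding is_rep_def by blast
      then show ?thesis
        using dim_strict_subspace[OF s _ _ internal_sum_subspace(1)[OF s AB] internal_sum_subset[OF s AB] that]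
        by blast
    qed
    obtain x where x: "B x \<noteq> {0}"
      using B by (auto simp: zero_rep_def)
    have "A x \<inter> B x = {0}" "B x \<subseteq> spc M x"
      using AB internal_sum_subset[OF s internal_sum_commute[OF AB]] by (auto simp: internal_sum_def)
    then have strict: "A x \<noteq> spc M x"
      using x by blast
    have "S.dim (A y) \<le> S.dim (spc M y)" for y
      using lt[of y] by (cases "A y = spc M y") simp_all
    with lt[OF strict] show ?thesis
      by (intro sum_strict_mono_ex1) auto
  qed
  consider "zero_rep M" | "indecomposable s \<Lambda> M" | "\<not> zero_rep M" "\<not> indecomposable s \<Lambda> M"
    by blast
  then show ?case
  proof cases
    case 3
    then obtain N N' where N: "is_rep s \<Lambda> N" "is_rep s \<Lambda> N'" "\<not> zero_rep N" "\<not> zero_rep N'"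
      and iso: "rep_iso s (pointwise s) \<Lambda> M (rep_plus N N')"
      using M unfolding indecomposable_def by blast
    obtain A B where AB: "internal_sum s \<Lambda> M A B"
      "\<not> zero_rep (M\<lparr>spc := A\<rparr>)" "\<not> zero_rep (M\<lparr>spc := B\<rparr>)"
      using rep_plus_internal_sum[OF s is_rep_linear_rep[OF M] is_rep_linear_rep[OF N(1)]
          is_rep_linear_rep[OF N(2)] iso] N(3,4) by metis
    note BA = internal_sum_commute[OF AB(1)]
    have "P (M\<lparr>spc := A\<rparr>)"
      using smaller[OF AB(1,3)] by (intro less.hyps is_rep_restrict[OF s M AB(1)]) simp
    moreover have "P (M\<lparr>spc := B\<rparr>)"
      using smaller[OF BA AB(2)] by (intro less.hyps is_rep_restrict[OF s M BA]) simp
    ultimately show ?thesis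
      using sum[OF M AB(1)] by blast
  qed (use M zero indec in auto)
qed

lemma internal_sum_whole:
  assumes s: "vector_space s" and M: "linear_rep s \<Lambda> M"
  shows "internal_sum s \<Lambda> M (spc M) (\<lambda>_. {0})"
proof -
  have "linear_rep s \<Lambda> (M\<lparr>spc := \<lambda>_. {0}\<rparr>)"
    using linear_rep_support[OF s M, of "{}"] by simp
  then show ?thesis
    using M zero_in_subspace[OF s linear_rep_subspace[OF M]] by (auto simp: internal_sum_def)
qed

lemma internal_sum_trans:
  assumes s: "vector_space s" and M: "linear_rep s \<Lambda> M" and AB: "internal_sum s \<Lambda> M A B"
    and CD: "internal_sum s \<Lambda> (M\<lparr>spc := A\<rparr>) C D"
  shows "internal_sum s \<Lambda> M C (\<lambda>x. {d + b |d b. d \<in> D x \<and> b \<in> B x})"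
proof -
  interpret S: vector_space s by fact
  note DC = internal_sum_commute[OF CD] and BA = internal_sum_commute[OF AB]
  let ?E = "\<lambda>x. {d + b |d b. d \<in> D x \<and> b \<in> B x}"
  have A: "A x = {c + d |c d. c \<in> C x \<and> d \<in> D x}" for x
    using CD unfolding internal_sum_def by simp
  have MAB: "spc M x = {a + b |a b. a \<in> A x \<and> b \<in> B x}" for x
    using AB unfolding internal_sum_def by blast
  have D_A: "D x \<subseteq> A x" for x
    using internal_sum_subset[OF s DC, of x] by simp
  have sub: "A x \<subseteq> spc M x" "B x \<subseteq> spc M x" for x
    using internal_sum_subset[OF s AB, of x] internal_sum_subset[OF s BA, of x] by simp_all
  have E_M: "?E x \<subseteq> spc M x" for x
    unfolding MAB using D_A by blast
  have repC: "linear_rep s \<Lambda> (M\<lparr>spc := C\<rparr>)"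
    using internal_sum_linear_rep[OF CD] by simp
  have repD: "linear_rep s \<Lambda> (M\<lparr>spc := D\<rparr>)"
    using internal_sum_linear_rep[OF DC] by simp
  have "arr M e w \<in> ?E (tgt \<Lambda> e)" if w: "w \<in> ?E (src \<Lambda> e)" for e w
  proof -
    obtain d b where db: "d \<in> D (src \<Lambda> e)" "b \<in> B (src \<Lambda> e)" "w = d + b"
      using w by blast
    have "arr M e w = arr M e d + arr M e b"
      using db D_A sub linear_rep_arr[OF M, of e] unfolding linear_between_def by blast
    moreover have "arr M e d \<in> D (tgt \<Lambda> e)" "arr M e b \<in> B (tgt \<Lambda> e)"
      using linear_rep_arr_closed[OF repD, of d e] db
        linear_rep_arr_closed[OF internal_sum_linear_rep[OF BA], of b e] by simp_all
    ultimately show ?thesis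
      by blast
  qed
  then have "linear_between s s (?E (src \<Lambda> e)) (?E (tgt \<Lambda> e)) (arr M e)" for e
    using linear_rep_arr[OF M, of e] E_M unfolding linear_between_def by (meson image_subsetI subsetD)
  moreover have "S.subspace (?E x)" for x
    by (rule S.subspace_sums[OF internal_sum_subspace(2)[OF s CD] internal_sum_subspace(2)[OF s AB]])
  ultimately have "linear_rep s \<Lambda> (M\<lparr>spc := ?E\<rparr>)"
    by (simp add: linear_rep_def)
  moreover have "spc M x = {c + e |c e. c \<in> C x \<and> e \<in> ?E x}" for x
    unfolding MAB A
  proof (intro set_eqI iffI; clarsimp)
    show "\<exists>c' e. c + d + b = c' + e \<and> c' \<in> C x \<and> (\<exists>d b. e = d + b \<and> d \<in> D x \<and> b \<in> B x)"
      if "c \<in> C x" "d \<in> D x" "b \<in> B x" for c d b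
      using that by (intro exI[of _ c] exI[of _ "d + b"]) (auto simp: add.assoc)
    show "\<exists>a b'. c + (d + b) = a + b' \<and> (\<exists>c d. a = c + d \<and> c \<in> C x \<and> d \<in> D x) \<and> b' \<in> B x"
      if "c \<in> C x" "d \<in> D x" "b \<in> B x" for c d b
      using that by (intro exI[of _ "c + d"] exI[of _ b]) (auto simp: add.assoc)
  qed
  moreover have "C x \<inter> ?E x = {0}" for x
  proof -
    have "v = 0" if v: "v \<in> C x" "v \<in> ?E x" for v
    proof -
      obtain d b where db: "d \<in> D x" "b \<in> B x" "v = d + b"
        using v(2) by blast
      have vA: "v \<in> A x" and dA: "d \<in> A x"
        using internal_sum_subset[OF s CD, of x] v(1) db(1) D_A by auto
      have B0: "0 \<in> B x" and C0: "0 \<in> C x" and D0: "0 \<in> D x"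
        using S.subspace_0 internal_sum_subspace[OF s AB] internal_sum_subspace[OF s CD] by blast+
      have "v = d"
        using internal_sum_unique(1)[OF s AB vA B0 dA db(2)] db(3) by simp
      then show "v = 0"
        using internal_sum_unique(1)[OF s CD v(1) D0 C0 db(1)] by simp
    qed
    moreover have "0 \<in> C x" "0 \<in> ?E x"
      using S.subspace_0[OF internal_sum_subspace(1)[OF s CD]] S.subspace_0[OF \<open>S.subspace (?E x)\<close>] by auto
    ultimately show ?thesis
      by blast
  qed
  ultimately show ?thesis
    unfolding internal_sum_def using repC by blast
qed

text \<open>
  One direction uses the injection of each summand, the other the family of all projections.
\<close>

lemma annihilates_rep_sum_iff:
  fixes s :: "'k::field \<Rightarrow> 'u::ab_group_add \<Rightarrow> 'u" and \<Lambda> :: "('v, 'e::finite) orientation"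
    and M :: "('v, 'e, 'e list \<Rightarrow> 'u) rep"
  assumes s: "vector_space s" and ac: "acyclic_orientation \<Gamma> \<Lambda>" and S: "admissible \<Lambda> S"
    and M: "linear_rep (pointwise s) \<Lambda> M"
    and N: "\<And>i. i \<in> I \<Longrightarrow> linear_rep (pointwise s) \<Lambda> (N i)"
    and iso: "rep_iso (pointwise s) (pointwise (pointwise s)) \<Lambda> M (rep_sum I N)"
  shows "annihilates \<Lambda> S M \<longleftrightarrow> (\<forall>i\<in>I. annihilates \<Lambda> S (N i))"
proof
  note s' = vector_space_pointwise[OF s]
  show "\<forall>i\<in>I. annihilates \<Lambda> S (N i)" if ann: "annihilates \<Lambda> S M"
  proof
    fix i assume i: "i \<in> I"
    obtain \<iota> where \<iota>: "rep_hom (pointwise s) (pointwise s) \<Lambda> (N i) M \<iota>"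
      "\<And>x v. v \<in> spc (N i) x \<Longrightarrow> \<iota> x v = 0 \<Longrightarrow> v = 0"
      by (rule rep_sum_injection[OF s' M iso N i]) blast+
    then show "annihilates \<Lambda> S (N i)"
      by (rule annihilates_if_injective_hom[OF s ac S N[OF i] _ _ ann])
  qed
  show "annihilates \<Lambda> S M" if "\<forall>i\<in>I. annihilates \<Lambda> S (N i)"
  proof -
    obtain \<pi> where "\<And>i. i \<in> I \<Longrightarrow> rep_hom (pointwise s) (pointwise s) \<Lambda> M (N i) (\<pi> i)"
      "jointly_injective M I \<pi>"
      by (rule rep_sum_projections[OF s' M iso]) blast
    then show ?thesis
      using that by (intro annihilates_if_jointly_injective[OF s ac S M]) auto
  qed
qed

lemma annihilates_internal_sum_iff:
  fixes s :: "'k::field \<Rightarrow> 'u::ab_group_add \<Rightarrow> 'u" and \<Lambda> :: "('v, 'e::finite) orientation"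
    and M :: "('v, 'e, 'e list \<Rightarrow> 'u) rep"
  assumes s: "vector_space s" and ac: "acyclic_orientation \<Gamma> \<Lambda>" and S: "admissible \<Lambda> S"
    and M: "linear_rep (pointwise s) \<Lambda> M" and sum: "internal_sum (pointwise s) \<Lambda> M A B"
  shows "annihilates \<Lambda> S M \<longleftrightarrow> annihilates \<Lambda> S (M\<lparr>spc := A\<rparr>) \<and> annihilates \<Lambda> S (M\<lparr>spc := B\<rparr>)"
proof -
  have "linear_rep (pointwise s) \<Lambda> (if i then M\<lparr>spc := A\<rparr> else M\<lparr>spc := B\<rparr>)" for i
    using sum by (simp add: internal_sum_def)
  then have "annihilates \<Lambda> S M \<longleftrightarrow> (\<forall>i\<in>UNIV. annihilates \<Lambda> S (if i then M\<lparr>spc := A\<rparr> else M\<lparr>spc := B\<rparr>))"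
    using internal_sum_rep_plus[OF vector_space_pointwise[OF s] M sum]
    by (intro annihilates_rep_sum_iff[OF s ac S M]) (auto simp: rep_plus_def)
  then show ?thesis
    by (auto simp: all_bool_eq)
qed

lemma annihilates_direct_summand:
  fixes s :: "'k::field \<Rightarrow> 'u::ab_group_add \<Rightarrow> 'u" and \<Lambda> :: "('v, 'e::finite) orientation"
    and M :: "('v, 'e, 'e list \<Rightarrow> 'u) rep"
  assumes s: "vector_space s" and ac: "acyclic_orientation \<Gamma> \<Lambda>" and S: "admissible \<Lambda> S"
    and M: "is_rep (pointwise s) \<Lambda> M" and X: "direct_summand (pointwise s) \<Lambda> X M"
    and ann: "annihilates \<Lambda> S M"
  shows "annihilates \<Lambda> S X"
proof -
  obtain \<iota> where \<iota>: "rep_hom (pointwise s) (pointwise s) \<Lambda> X M \<iota>"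
    "\<And>x v. v \<in> spc X x \<Longrightarrow> \<iota> x v = 0 \<Longrightarrow> v = 0"
    by (rule direct_summand_injection[OF vector_space_pointwise[OF s] M X]) blast+
  have "linear_rep (pointwise s) \<Lambda> X"
    using X by (simp add: direct_summand_def is_rep_linear_rep)
  then show ?thesis
    by (rule annihilates_if_injective_hom[OF s ac S _ \<iota> ann])
qed

text \<open>
  Passing to a summand in the induction is harmless: summands of a summand of \<open>M\<close> are summands of \<open>M\<close> by
  \<open>internal_sum_trans\<close>.
\<close>

lemma annihilates_if_indecomposable_summands:
  fixes s :: "'k::field \<Rightarrow> 'u::ab_group_add \<Rightarrow> 'u" and \<Lambda> :: "('v::finite, 'e::finite) orientation"
    and M :: "('v, 'e, 'e list \<Rightarrow> 'u) rep"
  assumes s: "vector_space s" and ac: "acyclic_orientation \<Gamma> \<Lambda>" and S: "admissible \<Lambda> S"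
    and M: "is_rep (pointwise s) \<Lambda> M"
    and "\<And>A B. internal_sum (pointwise s) \<Lambda> M A B \<Longrightarrow> indecomposable (pointwise s) \<Lambda> (M\<lparr>spc := A\<rparr>)
      \<Longrightarrow> annihilates \<Lambda> S (M\<lparr>spc := A\<rparr>)"
  shows "annihilates \<Lambda> S M"
  using assms(5)
proof (induction rule: decomposition_induct[OF vector_space_pointwise[OF s] M])
  case (1 M)
  then show ?case
    using annihilates_zero_rep[OF s ac S is_rep_linear_rep] by blast
next
  case (2 M)
  have "linear_rep (pointwise s) \<Lambda> M"
    using 2 by (simp add: indecomposable_def is_rep_linear_rep)
  then have "annihilates \<Lambda> S (M\<lparr>spc := spc M\<rparr>)"
    using 2 by (intro 2(2)[OF internal_sum_whole[OF vector_space_pointwise[OF s]]]) simp_all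
  then show ?case
    by simp
next
  case (3 M A B)
  note s' = vector_space_pointwise[OF s]
  note lin = is_rep_linear_rep[OF 3(1)]
  note BA = internal_sum_commute[OF 3(2)]
  have "annihilates \<Lambda> S (M\<lparr>spc := A\<rparr>)"
    using 3(5) internal_sum_trans[OF s' lin 3(2)] by (intro 3(3)) auto
  moreover have "annihilates \<Lambda> S (M\<lparr>spc := B\<rparr>)"
    using 3(5) internal_sum_trans[OF s' lin BA] by (intro 3(4)) auto
  ultimately show ?case
    by (simp add: annihilates_internal_sum_iff[OF s ac S lin 3(2)])
qed

text \<open>
  If \<open>M\<close> is a sum of \<open>A\<close> and \<open>B\<close>, then the join of the shortest sequences of \<open>A\<close> and \<open>B\<close> annihilates \<open>M\<close>, so it
  lies above the shortest sequence of \<open>M\<close> and annihilates \<open>X\<close>. An indecomposable \<open>X\<close> cannot split properly,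
  so by \<open>annihilated_by_join_splits\<close> it is annihilated by the shortest sequence of \<open>A\<close> or of \<open>B\<close>, and the
  induction goes on inside that summand.
\<close>

lemma indecomposable_annihilated_via_summand:
  fixes s :: "'k::field \<Rightarrow> 'u::ab_group_add \<Rightarrow> 'u" and \<Lambda> :: "('v::finite, 'e::finite) orientation"
    and M X :: "('v, 'e, 'e list \<Rightarrow> 'u) rep"
  assumes s: "vector_space s" and ac: "acyclic_orientation \<Gamma> \<Lambda>"
    and X: "indecomposable (pointwise s) \<Lambda> X"
    and M: "is_rep (pointwise s) \<Lambda> M" and pre: "preprojective \<Lambda> M"
    and ann: "annihilates \<Lambda> (shortest_seq \<Gamma> \<Lambda> M) X"
  shows "\<exists>A B. internal_sum (pointwise s) \<Lambda> M A B \<and> indecomposable (pointwise s) \<Lambda> (M\<lparr>spc := A\<rparr>) \<and>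
    annihilates \<Lambda> (shortest_seq \<Gamma> \<Lambda> (M\<lparr>spc := A\<rparr>)) X"
  using pre ann
proof (induction rule: decomposition_induct[OF vector_space_pointwise[OF s] M])
  note s' = vector_space_pointwise[OF s]
  have Xlin: "linear_rep (pointwise s) \<Lambda> X"
    using X by (simp add: indecomposable_def is_rep_linear_rep)
  {
    case (1 M)
    have "annihilates \<Lambda> [] M"
      using 1 by (simp add: annihilates_def)
    then have "seq_le \<Gamma> \<Lambda> (shortest_seq \<Gamma> \<Lambda> M) []"
      using annihilates_iff_shortest_seq_le[OF s ac is_rep_linear_rep[OF 1(1)] 1(3), of "[]"] by simp
    then have "annihilates \<Lambda> [] X"
      using 1(4) annihilates_mono[OF s ac Xlin] by blast
    then show ?case
      using X by (simp add: annihilates_def indecomposable_def)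
  next
    case (2 M)
    have "linear_rep (pointwise s) \<Lambda> M"
      using 2 by (simp add: indecomposable_def is_rep_linear_rep)
    then show ?case
      using 2 internal_sum_whole[OF s', of \<Lambda> M]
      by (intro exI[of _ "spc M"] exI[of _ "\<lambda>_. {0}"]) simp
  next
    case (3 M A B)
    note lin = is_rep_linear_rep[OF 3(1)]
    note AB = 3(2) and BA = internal_sum_commute[OF 3(2)]
    note ann_iff = annihilates_internal_sum_iff[OF s ac _ lin AB]
    let ?MA = "M\<lparr>spc := A\<rparr>" and ?MB = "M\<lparr>spc := B\<rparr>"
    let ?SA = "shortest_seq \<Gamma> \<Lambda> ?MA" and ?SB = "shortest_seq \<Gamma> \<Lambda> ?MB"
    have pre: "preprojective \<Lambda> ?MA" "preprojective \<Lambda> ?MB"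
      using 3(5) ann_iff by (auto simp: preprojective_def)
    note linA = internal_sum_linear_rep[OF AB] and linB = internal_sum_linear_rep[OF BA]
    have adm: "admissible \<Lambda> ?SA" "admissible \<Lambda> ?SB"
      using pre shortest_seq_admissible[OF ac] by auto
    let ?J = "seq_join \<Gamma> \<Lambda> ?SA ?SB"
    have J: "admissible \<Lambda> ?J" "seq_le \<Gamma> \<Lambda> ?SA ?J" "seq_le \<Gamma> \<Lambda> ?SB ?J"
      using seq_join_count[OF ac adm] adm by (auto simp: seq_le_iff_count[OF ac] le_fun_def)
    have "annihilates \<Lambda> ?J M"
      using J pre by (simp add: ann_iff annihilates_iff_shortest_seq_le[OF s ac] linA linB)
    then have "seq_le \<Gamma> \<Lambda> (shortest_seq \<Gamma> \<Lambda> M) ?J"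
      using annihilates_iff_shortest_seq_le[OF s ac lin 3(5) J(1)] by simp
    then have "annihilates \<Lambda> ?J X"
      using 3(6) annihilates_mono[OF s ac Xlin] by blast
    then obtain C D where CD: "internal_sum (pointwise s) \<Lambda> X C D"
      "annihilates \<Lambda> ?SA (X\<lparr>spc := C\<rparr>)" "annihilates \<Lambda> ?SB (X\<lparr>spc := D\<rparr>)"
      by (rule annihilated_by_join_splits[OF s ac Xlin adm])
    then consider "annihilates \<Lambda> ?SA X" | "annihilates \<Lambda> ?SB X"
      using indecomposable_internal_sum[OF s' X CD(1)] by metis
    then show ?case
    proof cases
      case 1
      then obtain C D where "internal_sum (pointwise s) \<Lambda> ?MA C D"
        "indecomposable (pointwise s) \<Lambda> (M\<lparr>spc := C\<rparr>)" "annihilates \<Lambda> (shortest_seq \<Gamma> \<Lambda> (M\<lparr>spc := C\<rparr>)) X"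
        using 3(3) pre(1) by auto
      then show ?thesis
        using internal_sum_trans[OF s' lin AB] by blast
    next
      case 2
      then obtain C D where "internal_sum (pointwise s) \<Lambda> ?MB C D"
        "indecomposable (pointwise s) \<Lambda> (M\<lparr>spc := C\<rparr>)" "annihilates \<Lambda> (shortest_seq \<Gamma> \<Lambda> (M\<lparr>spc := C\<rparr>)) X"
        using 3(4) pre(2) by auto
      then show ?thesis
        using internal_sum_trans[OF s' lin BA] by blast
    qed
  }
qed

section \<open>Shortest annihilating sequences and direct sums\<close>

text \<open>
  The shortest sequence of \<open>M\<close> and the join of those of the \<open>N i\<close> have the same upper bounds: an admissible
  sequence \<open>T\<close> lies above either of them exactly when it annihilates every \<open>N i\<close>.
\<close>

lemma shortest_seq_rep_sum:
  fixes s :: "'k::field \<Rightarrow> 'u::ab_group_add \<Rightarrow> 'u" and \<Lambda> :: "('v::finite, 'e::finite) orientation"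
    and M :: "('v, 'e, 'e list \<Rightarrow> 'u) rep" and N :: "nat \<Rightarrow> ('v, 'e, 'e list \<Rightarrow> 'u) rep" and m :: "nat \<Rightarrow> nat"
  assumes s: "vector_space s" and ac: "acyclic_orientation \<Gamma> \<Lambda>"
    and M: "linear_rep (pointwise s) \<Lambda> M" "preprojective \<Lambda> M"
    and N: "\<And>i. i < t \<Longrightarrow> linear_rep (pointwise s) \<Lambda> (N i)" and m: "\<And>i. i < t \<Longrightarrow> m i > 0"
    and iso: "rep_iso (pointwise s) (pointwise (pointwise s)) \<Lambda> M
      (rep_sum (SIGMA i:{..<t}. {..<m i}) (\<lambda>(i, j). N i))"
  shows "(\<forall>i<t. preprojective \<Lambda> (N i)) \<and>
    seq_equiv \<Gamma> \<Lambda> (shortest_seq \<Gamma> \<Lambda> M)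
      (foldr (seq_join \<Gamma> \<Lambda>) (map (\<lambda>i. shortest_seq \<Gamma> \<Lambda> (N i)) [0..<t]) [])"
proof -
  let ?SM = "shortest_seq \<Gamma> \<Lambda> M" and ?SN = "map (\<lambda>i. shortest_seq \<Gamma> \<Lambda> (N i)) [0..<t]"
  let ?J = "foldr (seq_join \<Gamma> \<Lambda>) ?SN []"
  have ann: "annihilates \<Lambda> T M \<longleftrightarrow> (\<forall>i<t. annihilates \<Lambda> T (N i))" if "admissible \<Lambda> T" for T
  proof -
    have "annihilates \<Lambda> T M \<longleftrightarrow> (\<forall>p\<in>(SIGMA i:{..<t}. {..<m i}). annihilates \<Lambda> T ((\<lambda>(i, j). N i) p))"
      using N by (intro annihilates_rep_sum_iff[OF s ac that M(1) _ iso]) auto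
    also have "\<dots> \<longleftrightarrow> (\<forall>i<t. annihilates \<Lambda> T (N i))"
      using m by force
    finally show ?thesis .
  qed
  have pre: "preprojective \<Lambda> (N i)" if "i < t" for i
    using M(2) ann that by (auto simp: preprojective_def)
  have SM: "admissible \<Lambda> ?SM"
    by (rule shortest_seq_admissible[OF ac M(2)])
  have SN: "\<forall>S\<in>set ?SN. admissible \<Lambda> S"
    using shortest_seq_admissible[OF ac pre] by auto
  note J = foldr_seq_join_least[OF ac SN]
  have J_adm: "admissible \<Lambda> ?J"
    using J[OF SM] by blast
  have le_iff: "seq_le \<Gamma> \<Lambda> ?SM T \<longleftrightarrow> seq_le \<Gamma> \<Lambda> ?J T" if T: "admissible \<Lambda> T" for T
  proof -
    have "seq_le \<Gamma> \<Lambda> ?SM T \<longleftrightarrow> (\<forall>i<t. annihilates \<Lambda> T (N i))"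
      using annihilates_iff_shortest_seq_le[OF s ac M T] ann[OF T] by simp
    also have "\<dots> \<longleftrightarrow> (\<forall>i<t. seq_le \<Gamma> \<Lambda> (shortest_seq \<Gamma> \<Lambda> (N i)) T)"
      using annihilates_iff_shortest_seq_le[OF s ac N pre T] by simp
    also have "\<dots> \<longleftrightarrow> seq_le \<Gamma> \<Lambda> ?J T"
      using J[OF T] by auto
    finally show ?thesis .
  qed
  have "seq_equiv \<Gamma> \<Lambda> ?SM ?J"
    unfolding seq_equiv_iff_seq_le[OF ac SM J_adm]
    using le_iff[OF SM] le_iff[OF J_adm] seq_le_iff_count[OF ac SM SM] seq_le_iff_count[OF ac J_adm J_adm]
    by blast
  with pre show ?thesis
    by blast
qed

text \<open>
  The left-hand side says that the shortest sequence of \<open>M\<close> annihilates \<open>L\<close>, that is, each indecomposable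
  summand \<open>X\<close> of \<open>L\<close>. By \<open>indecomposable_annihilated_via_summand\<close> it does so because the shortest sequence
  of a single indecomposable summand of \<open>M\<close> already annihilates \<open>X\<close>.
\<close>

lemma shortest_seq_le_iff_summands:
  fixes s :: "'k::field \<Rightarrow> 'u::ab_group_add \<Rightarrow> 'u" and \<Lambda> :: "('v::finite, 'e::finite) orientation"
    and L M :: "('v, 'e, 'e list \<Rightarrow> 'u) rep"
  assumes s: "vector_space s" and ac: "acyclic_orientation \<Gamma> \<Lambda>"
    and M: "is_rep (pointwise s) \<Lambda> M" "preprojective \<Lambda> M"
    and L: "is_rep (pointwise s) \<Lambda> L" "preprojective \<Lambda> L"
  shows "seq_le \<Gamma> \<Lambda> (shortest_seq \<Gamma> \<Lambda> L) (shortest_seq \<Gamma> \<Lambda> M) \<longleftrightarrow>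
    (\<forall>X. indecomposable (pointwise s) \<Lambda> X \<and> direct_summand (pointwise s) \<Lambda> X L \<longrightarrow>
      (\<exists>Y. indecomposable (pointwise s) \<Lambda> Y \<and> direct_summand (pointwise s) \<Lambda> Y M \<and>
        seq_le \<Gamma> \<Lambda> (shortest_seq \<Gamma> \<Lambda> X) (shortest_seq \<Gamma> \<Lambda> Y)))"
    (is "?le \<longleftrightarrow> ?summands")
proof -
  note s' = vector_space_pointwise[OF s]
  note linM = is_rep_linear_rep[OF M(1)] and linL = is_rep_linear_rep[OF L(1)]
  have SM: "admissible \<Lambda> (shortest_seq \<Gamma> \<Lambda> M)"
    by (rule shortest_seq_admissible[OF ac M(2)])
  have pre: "preprojective \<Lambda> X"
    if "is_rep (pointwise s) \<Lambda> N" "preprojective \<Lambda> N" "direct_summand (pointwise s) \<Lambda> X N"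
    for X N :: "('v, 'e, 'e list \<Rightarrow> 'u) rep"
    using that annihilates_direct_summand[OF s ac _ that(1,3)] by (auto simp: preprojective_def)
  have lin: "linear_rep (pointwise s) \<Lambda> X" if "direct_summand (pointwise s) \<Lambda> X N"
    for X N :: "('v, 'e, 'e list \<Rightarrow> 'u) rep"
    using that by (simp add: direct_summand_def is_rep_linear_rep)
  have ann_M: "annihilates \<Lambda> (shortest_seq \<Gamma> \<Lambda> M) M"
    using annihilates_iff_shortest_seq_le[OF s ac linM M(2) SM] SM by (simp add: seq_le_iff_count[OF ac])
  have le_iff: "?le \<longleftrightarrow> annihilates \<Lambda> (shortest_seq \<Gamma> \<Lambda> M) L"
    using annihilates_iff_shortest_seq_le[OF s ac linL L(2) SM] by simp
  show ?thesis
  proof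
    assume ?le
    show ?summands
    proof (intro allI impI, elim conjE)
      fix X assume X: "indecomposable (pointwise s) \<Lambda> X" "direct_summand (pointwise s) \<Lambda> X L"
      have "annihilates \<Lambda> (shortest_seq \<Gamma> \<Lambda> M) X"
        using annihilates_direct_summand[OF s ac SM L(1) X(2)] \<open>?le\<close> le_iff by blast
      then obtain A B where AB: "internal_sum (pointwise s) \<Lambda> M A B"
        "indecomposable (pointwise s) \<Lambda> (M\<lparr>spc := A\<rparr>)"
        "annihilates \<Lambda> (shortest_seq \<Gamma> \<Lambda> (M\<lparr>spc := A\<rparr>)) X"
        using indecomposable_annihilated_via_summand[OF s ac X(1) M] by blast
      have Y: "direct_summand (pointwise s) \<Lambda> (M\<lparr>spc := A\<rparr>) M"
        by (rule internal_sum_direct_summand[OF s' M(1) AB(1)])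
      have "seq_le \<Gamma> \<Lambda> (shortest_seq \<Gamma> \<Lambda> X) (shortest_seq \<Gamma> \<Lambda> (M\<lparr>spc := A\<rparr>))"
        using AB(3) annihilates_iff_shortest_seq_le[OF s ac lin[OF X(2)] pre[OF L X(2)]
            shortest_seq_admissible[OF ac pre[OF M Y]]] by simp
      with AB(2) Y show "\<exists>Y. indecomposable (pointwise s) \<Lambda> Y \<and> direct_summand (pointwise s) \<Lambda> Y M \<and>
        seq_le \<Gamma> \<Lambda> (shortest_seq \<Gamma> \<Lambda> X) (shortest_seq \<Gamma> \<Lambda> Y)"
        by blast
    qed
  next
    assume summands: ?summands
    have "annihilates \<Lambda> (shortest_seq \<Gamma> \<Lambda> M) (L\<lparr>spc := A\<rparr>)"
      if A: "internal_sum (pointwise s) \<Lambda> L A B" "indecomposable (pointwise s) \<Lambda> (L\<lparr>spc := A\<rparr>)" for A B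
    proof -
      let ?X = "L\<lparr>spc := A\<rparr>"
      have X: "direct_summand (pointwise s) \<Lambda> ?X L"
        by (rule internal_sum_direct_summand[OF s' L(1) A(1)])
      then obtain Y where Y: "direct_summand (pointwise s) \<Lambda> Y M"
        "seq_le \<Gamma> \<Lambda> (shortest_seq \<Gamma> \<Lambda> ?X) (shortest_seq \<Gamma> \<Lambda> Y)"
        using summands A(2) by blast
      have SX: "admissible \<Lambda> (shortest_seq \<Gamma> \<Lambda> ?X)" and SY: "admissible \<Lambda> (shortest_seq \<Gamma> \<Lambda> Y)"
        using shortest_seq_admissible[OF ac] pre[OF L X] pre[OF M Y(1)] by blast+
      have "seq_le \<Gamma> \<Lambda> (shortest_seq \<Gamma> \<Lambda> Y) (shortest_seq \<Gamma> \<Lambda> M)"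
        using annihilates_direct_summand[OF s ac SM M(1) Y(1) ann_M]
          annihilates_iff_shortest_seq_le[OF s ac lin[OF Y(1)] pre[OF M Y(1)] SM] by simp
      then have "seq_le \<Gamma> \<Lambda> (shortest_seq \<Gamma> \<Lambda> ?X) (shortest_seq \<Gamma> \<Lambda> M)"
        using Y(2) SX SY SM by (auto simp: seq_le_iff_count[OF ac])
      then show ?thesis
        using annihilates_iff_shortest_seq_le[OF s ac lin[OF X] pre[OF L X] SM] by simp
    qed
    then have "annihilates \<Lambda> (shortest_seq \<Gamma> \<Lambda> M) L"
      by (rule annihilates_if_indecomposable_summands[OF s ac SM L(1)])
    then show ?le
      using le_iff by simp
  qed
qed

theorem theorem3p4:
  fixes \<Gamma> :: "'e::finite \<Rightarrow> 'v::finite set"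
    and \<Lambda> :: "('v, 'e) orientation"
    and scale :: "'k::field \<Rightarrow> 'u::ab_group_add \<Rightarrow> 'u"
    and M :: "('v, 'e, 'e list \<Rightarrow> 'u) rep"
  assumes "connected_graph \<Gamma>"
    and "acyclic_orientation \<Gamma> \<Lambda>"
    and "vector_space scale"
    and "is_rep (pointwise scale) \<Lambda> M"
    and "preprojective \<Lambda> M"
  shows
    "((\<exists>S. shortest_annihilating \<Gamma> \<Lambda> M S) \<and>
      (\<forall>S T. shortest_annihilating \<Gamma> \<Lambda> M S \<and> shortest_annihilating \<Gamma> \<Lambda> M T \<longrightarrow>
         seq_equiv \<Gamma> \<Lambda> S T) \<and>
      (\<forall>(t::nat) (N :: nat \<Rightarrow> ('v, 'e, 'e list \<Rightarrow> 'u) rep) (m :: nat \<Rightarrow> nat).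
         (\<forall>i<t. indecomposable (pointwise scale) \<Lambda> (N i) \<and> m i > 0) \<and>
         (\<forall>i<t. \<forall>j<t. i \<noteq> j \<longrightarrow>
            \<not> rep_iso (pointwise scale) (pointwise scale) \<Lambda> (N i) (N j)) \<and>
         rep_iso (pointwise scale) (pointwise (pointwise scale)) \<Lambda> M
           (rep_sum (SIGMA i:{..<t}. {..<m i}) (\<lambda>(i, j). N i))
         \<longrightarrow>
         (\<forall>i<t. preprojective \<Lambda> (N i)) \<and>
         seq_equiv \<Gamma> \<Lambda> (shortest_seq \<Gamma> \<Lambda> M)
           (foldr (seq_join \<Gamma> \<Lambda>) (map (\<lambda>i. shortest_seq \<Gamma> \<Lambda> (N i)) [0..<t]) [])))
     \<and>
     (\<forall>L :: ('v, 'e, 'e list \<Rightarrow> 'u) rep.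
        is_rep (pointwise scale) \<Lambda> L \<and> preprojective \<Lambda> L \<longrightarrow>
        (seq_le \<Gamma> \<Lambda> (shortest_seq \<Gamma> \<Lambda> L) (shortest_seq \<Gamma> \<Lambda> M) \<longleftrightarrow>
         (\<forall>X. indecomposable (pointwise scale) \<Lambda> X \<and> direct_summand (pointwise scale) \<Lambda> X L \<longrightarrow>
            (\<exists>Y. indecomposable (pointwise scale) \<Lambda> Y \<and> direct_summand (pointwise scale) \<Lambda> Y M \<and>
               seq_le \<Gamma> \<Lambda> (shortest_seq \<Gamma> \<Lambda> X) (shortest_seq \<Gamma> \<Lambda> Y)))))"
proof (intro conjI allI impI, goal_cases)
  case 1
  show ?case
    by (rule shortest_annihilating_exists[OF assms(2,5)])
next
  case (2 S T)
  then show ?case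
    unfolding shortest_annihilating_iff_least[OF assms(2)] by (metis assms(2) seq_equiv_iff_seq_le)
next
  case (3 t N m i)
  then show ?case
    using shortest_seq_rep_sum[OF assms(3,2) is_rep_linear_rep[OF assms(4)] assms(5), of t N m]
    by (auto simp: indecomposable_def is_rep_linear_rep)
next
  case (4 t N m)
  then show ?case
    using shortest_seq_rep_sum[OF assms(3,2) is_rep_linear_rep[OF assms(4)] assms(5), of t N m]
    by (auto simp: indecomposable_def is_rep_linear_rep)
next
  case (5 L)
  then show ?case
    using shortest_seq_le_iff_summands[OF assms(3,2,4,5)] by blast
qed

end
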